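(* Let $M=S^3/I^*$ be the Poincaré dodecahedral space with its spherical metric $g_0$. There exists a function $F\in E_{168}(g_0)$ which is Morse and has at least eight critical points. In fact, one can choose $F\in E_{168}(g_0)$ Morse with exactly twelve critical points.
   Context: $I^*\subset SU(2)$ is the binary icosahedral group (order $120$), acting freely and isometrically on the unit sphere $S^3\subset\mathbb C^2$; $g_0$ is the metric of constant curvature $1$ induced on $M=S^3/I^*$. $E_{168}(g_0)$ denotes the real eigenspace, for the eigenvalue $168$, of the nonnegative Laplace--Beltrami operator of $g_0$ on $M$; $168$ is its first positive eigenvalue and $\dim E_{168}(g_0)=13$. *)

theory Defs
  imports "HOL-Analysis.Analysis"
begin

text \<open>The group of unit quaternions is identified with SU(2): the quaternion a + bi + cj + dk
  is the matrix below, so that i = diag(i, -i), and j, k have the rows (0,1), (-1,0)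
  and (0,i), (i,0).\<close>

definition quaternion_matrix :: "real ^ 4 \<Rightarrow> complex ^ 2 ^ 2" where
  "quaternion_matrix q =
     vector [vector [Complex (q $ 1) (q $ 2), Complex (q $ 3) (q $ 4)],
             vector [Complex (- (q $ 3)) (q $ 4), Complex (q $ 1) (- (q $ 2))]]"

definition golden_ratio :: real where
  "golden_ratio = (1 + sqrt 5) / 2"

text \<open>The 120 unit icosians: 8 quaternions of the form (\<plusminus>1, 0, 0, 0) up to position, 16 of the form
  (\<plusminus>1, \<plusminus>1, \<plusminus>1, \<plusminus>1)/2, and the 96 even permutations of
  (0, \<plusminus>1, \<plusminus>1/\<phi>, \<plusminus>\<phi>)/2, where \<phi> is the golden ratio. They form a group under
  quaternion multiplication; restricting to even permutations is essential for this.\<close>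

definition unit_icosians :: "(real ^ 4) set" where
  "unit_icosians =
     {axis i s | i s. s \<in> {1, -1}}
   \<union> {q. \<forall>i. q $ i \<in> {1/2, -1/2}}
   \<union> {(\<chi> i. vector [0, a / 2, b / (2 * golden_ratio), c * golden_ratio / 2] $ (p i)) | p a b c.
        p permutes UNIV \<and> evenperm p \<and> a \<in> {1, -1} \<and> b \<in> {1, -1} \<and> c \<in> {1, -1}}"

definition binary_icosahedral :: "(complex ^ 2 ^ 2) set" where
  "binary_icosahedral = quaternion_matrix ` unit_icosians"

text \<open>The inner product of \<^typ>\<open>complex ^ 2\<close> is the real part of the Hermitian one, i.e. the
  Euclidean inner product of the underlying real 4-space.\<close>

abbreviation S3 :: "(complex ^ 2) set" where
  "S3 \<equiv> sphere 0 1"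

fun C_k_on :: "nat \<Rightarrow> ('a::euclidean_space) set \<Rightarrow> ('a \<Rightarrow> real) \<Rightarrow> bool" where
  "C_k_on 0 U f \<longleftrightarrow> continuous_on U f"
| "C_k_on (Suc k) U f \<longleftrightarrow>
     f differentiable_on U \<and> (\<forall>v. C_k_on k U (\<lambda>x. frechet_derivative f (at x) v))"

definition smooth_S3 :: "(complex ^ 2 \<Rightarrow> real) \<Rightarrow> bool" where
  "smooth_S3 f \<longleftrightarrow>
     (\<forall>x\<in>S3. \<exists>U g. open U \<and> x \<in> U \<and> (\<forall>k. C_k_on k U g) \<and> (\<forall>y\<in>U \<inter> S3. f y = g y))"

definition tangent_space :: "complex ^ 2 \<Rightarrow> (complex ^ 2) set" where
  "tangent_space x = {v. v \<bullet> x = 0}"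

definition tangent_proj :: "complex ^ 2 \<Rightarrow> complex ^ 2 \<Rightarrow> complex ^ 2" where
  "tangent_proj x v = v - (v \<bullet> x) *\<^sub>R x"

text \<open>The differential at \<open>x\<close> of a map on the sphere. The derivative within the sphere is
  determined only on the tangent space at \<open>x\<close>; it is extended by zero to the normal line, which
  makes it unique.\<close>

definition sphere_deriv ::
  "(complex ^ 2 \<Rightarrow> 'b::real_normed_vector) \<Rightarrow> complex ^ 2 \<Rightarrow> complex ^ 2 \<Rightarrow> 'b" where
  "sphere_deriv f x = (THE L. (f has_derivative L) (at x within S3) \<and> L x = 0)"

definition sphere_grad :: "(complex ^ 2 \<Rightarrow> real) \<Rightarrow> complex ^ 2 \<Rightarrow> complex ^ 2" where
  "sphere_grad f x =
     (THE w. w \<in> tangent_space x \<and> (\<forall>v\<in>tangent_space x. w \<bullet> v = sphere_deriv f x v))"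

text \<open>The Levi-Civita connection of the induced metric: the tangential part of the derivative of
  the vector field \<open>X\<close> in the direction \<open>v\<close>.\<close>

definition cov_deriv ::
  "(complex ^ 2 \<Rightarrow> complex ^ 2) \<Rightarrow> complex ^ 2 \<Rightarrow> complex ^ 2 \<Rightarrow> complex ^ 2" where
  "cov_deriv X x v = tangent_proj x (sphere_deriv X x v)"

text \<open>The divergence is the trace of the endomorphism \<open>cov_deriv X x\<close> of the tangent space. As
  this endomorphism is extended by zero to the normal line, the trace may be computed in the
  standard basis of the ambient space.\<close>

definition sphere_div :: "(complex ^ 2 \<Rightarrow> complex ^ 2) \<Rightarrow> complex ^ 2 \<Rightarrow> real" where
  "sphere_div X x = (\<Sum>b\<in>Basis. cov_deriv X x b \<bullet> b)"

definition laplace_beltrami :: "(complex ^ 2 \<Rightarrow> real) \<Rightarrow> complex ^ 2 \<Rightarrow> real" where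
  "laplace_beltrami f x = - sphere_div (sphere_grad f) x"

definition sphere_hessian ::
  "(complex ^ 2 \<Rightarrow> real) \<Rightarrow> complex ^ 2 \<Rightarrow> complex ^ 2 \<Rightarrow> complex ^ 2 \<Rightarrow> real" where
  "sphere_hessian f x v w = cov_deriv (sphere_grad f) x v \<bullet> w"

definition critical_at :: "(complex ^ 2 \<Rightarrow> real) \<Rightarrow> complex ^ 2 \<Rightarrow> bool" where
  "critical_at f x \<longleftrightarrow> (\<forall>v\<in>tangent_space x. sphere_deriv f x v = 0)"

definition nondegenerate_at :: "(complex ^ 2 \<Rightarrow> real) \<Rightarrow> complex ^ 2 \<Rightarrow> bool" where
  "nondegenerate_at f x \<longleftrightarrow>
     (\<forall>v\<in>tangent_space x. (\<forall>w\<in>tangent_space x. sphere_hessian f x v w = 0) \<longrightarrow> v = 0)"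

definition orbit :: "complex ^ 2 \<Rightarrow> (complex ^ 2) set" where
  "orbit x = (\<lambda>A. A *v x) ` binary_icosahedral"

definition poincare_space :: "(complex ^ 2) set set" where
  "poincare_space = orbit ` S3"

text \<open>A function on the quotient is a function of orbits; its values at sets that are not in
  \<^const>\<open>poincare_space\<close> are irrelevant. The smooth structure and the metric of the quotient are
  those for which the projection \<^const>\<open>orbit\<close> from the sphere is a local diffeomorphism and a
  local isometry (the group acts freely and isometrically). Hence smoothness, the Laplace-Beltrami
  operator, differentials and Hessians of \<open>F\<close> at a point \<open>p\<close> are those of the lift \<open>F \<circ> orbit\<close>
  at the points of the orbit \<open>p\<close>.\<close>

definition eigenspace :: "real \<Rightarrow> ((complex ^ 2) set \<Rightarrow> real) set" where
  "eigenspace \<mu> =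
     {F. smooth_S3 (F \<circ> orbit) \<and>
         (\<forall>p\<in>poincare_space. \<forall>x\<in>p. laplace_beltrami (F \<circ> orbit) x = \<mu> * F p)}"

definition critical_points :: "((complex ^ 2) set \<Rightarrow> real) \<Rightarrow> (complex ^ 2) set set" where
  "critical_points F = {p \<in> poincare_space. \<forall>x\<in>p. critical_at (F \<circ> orbit) x}"

definition is_morse :: "((complex ^ 2) set \<Rightarrow> real) \<Rightarrow> bool" where
  "is_morse F \<longleftrightarrow> smooth_S3 (F \<circ> orbit) \<and>
     (\<forall>p\<in>critical_points F. \<forall>x\<in>p. nondegenerate_at (F \<circ> orbit) x)"

end

theory Submission
  imports Defs
begin

text \<open>Let \<open>f\<close> be the binary form of degree 12 on \<open>\<complex>\<^sup>2\<close> that is invariant under the binary icosahedral group, let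
\<open>J z = (- cnj z\<^sub>2, cnj z\<^sub>1)\<close>, and write \<open>phi m z\<close> for the \<open>m\<close>-th derivative of
\<open>t \<mapsto> f (z + t J z)\<close> at \<open>t = 0\<close>. As \<open>J\<close> commutes with the unit quaternions, every \<open>phi m\<close> is invariant
under the group. The function in question is induced by \<open>F = Re (phi 1)\<close>. It is a harmonic homogeneous
polynomial of degree 12, because each term of \<open>phi 1\<close> is a partial derivative of \<open>f\<close> times the
conjugate of the other variable and mixed partial derivatives commute; so its restriction to
the sphere is an eigenfunction for \<open>12 (12 + 2) = 168\<close>.

A tangent vector at \<open>z\<close> has the form \<open>i a z + t J z\<close> with \<open>a\<close> real and \<open>t\<close> complex, and along it the derivative of \<open>phi 1\<close> is
\<open>10 i a phi 1 + t phi 2 - 12 cnj t phi 0\<close>. Hence \<open>z\<close> is critical iff \<open>phi 1\<close> is real and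
\<open>phi 2 = 12 cnj (phi 0)\<close> (lemma \<open>critical_morse_lift\<close>). The Hessian is computed in the same way from
\<open>phi 0, \<dots>, phi 3\<close>, and its degeneracy comes down to one equation between absolute values
(lemma \<open>nondegenerate_morse_lift\<close>).

To locate the critical points, observe that \<open>|phi 1|\<^sup>2\<close> does not change when \<open>z\<close> is multiplied by a unit
complex number. It is therefore a polynomial of degree 12 on the two-sphere, the image of the Hopf map, and is
invariant under the icosahedral group, thus a combination of \<open>1\<close>, \<open>I\<^sub>6\<close>, \<open>I\<^sub>1\<^sub>0\<close> and \<open>I\<^sub>6\<^sup>2\<close> for invariants
\<open>I\<^sub>6, I\<^sub>1\<^sub>0\<close> of degrees 6 and 10, and the coefficient of \<open>I\<^sub>1\<^sub>0\<close> does not vanish. A critical point of \<open>F\<close> lies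
over a critical point of \<open>|phi 1|\<^sup>2\<close>, and there the gradients of \<open>I\<^sub>6\<close> and \<open>I\<^sub>1\<^sub>0\<close> on the sphere are linearly
dependent. Their Jacobian is, up to a constant, the product of the linear forms of the 15 mirror planes, so the
critical point lies over a mirror, and the group carries it to a point over one fixed
mirror (lemma \<open>critical_equivalent_to_mirror\<close>).

The points over that mirror are \<open>z = l (a, b)\<close> with \<open>|l| = 1\<close> and \<open>a = cos t\<close>, \<open>b = sin t\<close> real. Along the real
circle \<open>J z\<close> is the velocity, so there the functions \<open>phi m\<close> are expressed by the derivatives of \<open>f (cos t, sin t)\<close>,
which is a cubic polynomial in \<open>u = sin\<^sup>2 (2 t)\<close>. The conditions become \<open>l\<^sup>2\<^sup>0 = 1\<close> and the vanishing of the second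
derivative in \<open>t\<close>, a cubic equation with exactly two roots in \<open>[0, 1]\<close>: one belongs to the
vertices of the icosahedron, the other to 60 points in general position on the mirrors.
Over each of the two points of the sphere there are 20 critical points \<open>l (a, b)\<close>. Over the second
point, \<open>- 1\<close> identifies them in pairs; over a vertex, the group elements that fix the vertex leave
two classes. This gives \<open>10 + 2 = 12\<close> orbits, which the invariants \<open>phi 0\<close> and \<open>phi 1\<close> tell apart. The
same function also proves the weaker first claim.\<close>

section \<open>Calculus on the unit sphere\<close>

lemma tangent_proj_in [simp]:
  assumes "x \<in> S3" shows "tangent_proj x v \<in> tangent_space x"
  using assms by (simp add: tangent_proj_def tangent_space_def inner_diff_left dot_square_norm)

lemma tangent_proj_id: "v \<in> tangent_space x \<Longrightarrow> tangent_proj x v = v"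
  by (simp add: tangent_proj_def tangent_space_def)

lemma inner_tangent_proj:
  "w \<in> tangent_space x \<Longrightarrow> tangent_proj x v \<bullet> w = v \<bullet> w"
  by (simp add: tangent_proj_def tangent_space_def inner_diff_left inner_commute[of x])

text \<open>Test against the great circle through \<open>x\<close> in the direction \<open>v\<close>: composed with it, both candidates
are derivatives of the same function of one real variable.\<close>
lemma has_derivative_sphere_unique:
  fixes f :: "complex ^ 2 \<Rightarrow> 'b::real_normed_vector"
  assumes x: "x \<in> S3" and L1: "(f has_derivative L1) (at x within S3)"
    and L2: "(f has_derivative L2) (at x within S3)" and v: "v \<in> tangent_space x"
  shows "L1 v = L2 v"
proof (cases "v = 0")
  case True
  then show ?thesis using L1 L2 by (simp add: has_derivative_bounded_linear linear_simps)
next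
  case False
  define u where "u = v /\<^sub>R norm v"
  have u: "norm u = 1" "u \<bullet> x = 0"
    using False v by (simp_all add: u_def tangent_space_def)
  define c where "c = (\<lambda>t. cos t *\<^sub>R x + sin t *\<^sub>R u)"
  have "norm (c t) ^ 2 = 1" for t
  proof -
    have "norm (c t) ^ 2 = (cos t)\<^sup>2 * (norm x)\<^sup>2 + (sin t)\<^sup>2 * (norm u)\<^sup>2 + 2 * (cos t * sin t * (u \<bullet> x))"
      unfolding c_def power2_norm_eq_inner
      by (simp add: inner_add_left inner_add_right inner_commute power2_eq_square algebra_simps)
    then show ?thesis using u x by simp
  qed
  then have c_in: "range c \<subseteq> S3"
    by (auto simp: abs_square_eq_1)
  have c0: "c 0 = x" by (simp add: c_def)
  have dc: "(c has_derivative (\<lambda>t. t *\<^sub>R u)) (at 0 within UNIV)"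
    unfolding c_def by (auto intro!: derivative_eq_intros)
  have "(f \<circ> c has_derivative L \<circ> (\<lambda>t. t *\<^sub>R u)) (at 0 within UNIV)"
    if "(f has_derivative L) (at x within S3)" for L
    by (rule diff_chain_within[OF dc]) (use that c_in c0 has_derivative_subset in metis)
  from has_derivative_unique[OF this[OF L1] this[OF L2]]
  have "L1 (1 *\<^sub>R u) = L2 (1 *\<^sub>R u)" unfolding o_def by meson
  then have "L1 u = L2 u" by simp
  moreover have "v = norm v *\<^sub>R u" using False by (simp add: u_def)
  ultimately show ?thesis
    using has_derivative_bounded_linear[OF L1] has_derivative_bounded_linear[OF L2]
    by (metis bounded_linear.linear linear_scale)
qed

text \<open>The map \<open>r y = y + ((1 - y \<bullet> y) / 2) x\<close> is the identity on the sphere, and its derivative at \<open>x\<close> is the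
projection to the tangent space. So \<open>f\<close> may be replaced by \<open>f \<circ> r\<close>, whose derivative kills the
normal direction.\<close>
lemma has_derivative_sphere_tangential:
  fixes f :: "complex ^ 2 \<Rightarrow> 'b::real_normed_vector"
  assumes x: "x \<in> S3" and f: "(f has_derivative L) (at x)"
  shows "(f has_derivative (\<lambda>v. L (tangent_proj x v))) (at x within S3)"
proof -
  define r where "r = (\<lambda>y. y + ((1 - y \<bullet> y) / 2) *\<^sub>R x)"
  have xx: "x \<bullet> x = 1" using x by (simp add: dot_square_norm)
  have rx: "r x = x" by (simp add: r_def xx)
  have dr: "(r has_derivative tangent_proj x) (at x within S3)"
    unfolding r_def tangent_proj_def
    by (auto intro!: derivative_eq_intros ext simp: inner_commute)
  have "(f has_derivative L) (at (r x) within r ` S3)"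
    using f rx has_derivative_at_withinI by metis
  from diff_chain_within[OF dr this]
  have "(f \<circ> r has_derivative (\<lambda>v. L (tangent_proj x v))) (at x within S3)"
    by (simp add: o_def)
  moreover have "(f \<circ> r) y = f y" if "y \<in> S3" for y
    using that by (simp add: r_def dot_square_norm)
  ultimately show ?thesis
    using x by (auto elim: has_derivative_transform[rotated 2])
qed

lemma sphere_deriv_eq:
  fixes f :: "complex ^ 2 \<Rightarrow> 'b::real_normed_vector"
  assumes x: "x \<in> S3" and f: "(f has_derivative L) (at x)"
  shows "sphere_deriv f x = (\<lambda>v. L (tangent_proj x v))"
  unfolding sphere_deriv_def
proof (rule the_equality)
  have "x \<bullet> x = 1" using x by (simp add: dot_square_norm)
  then have "tangent_proj x x = 0" by (simp add: tangent_proj_def)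
  moreover have "L 0 = 0" using f by (simp add: has_derivative_bounded_linear linear_simps)
  ultimately show "(f has_derivative (\<lambda>v. L (tangent_proj x v))) (at x within S3) \<and> L (tangent_proj x x) = 0"
    using has_derivative_sphere_tangential[OF assms] by simp
next
  fix L' assume L': "(f has_derivative L') (at x within S3) \<and> L' x = 0"
  then interpret L': bounded_linear L' using has_derivative_bounded_linear by blast
  show "L' = (\<lambda>v. L (tangent_proj x v))"
  proof
    fix v
    have "v = tangent_proj x v + (v \<bullet> x) *\<^sub>R x" by (simp add: tangent_proj_def)
    then have "L' v = L' (tangent_proj x v)"
      using L' by (metis L'.add L'.scaleR add.right_neutral scaleR_zero_right)
    also have "\<dots> = L (tangent_proj x (tangent_proj x v))"
      using has_derivative_sphere_unique[OF x _ has_derivative_sphere_tangential[OF x f]] L' x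
      by (meson tangent_proj_in)
    finally show "L' v = L (tangent_proj x v)" using x by (simp add: tangent_proj_id)
  qed
qed

lemma sphere_deriv_cong:
  assumes "x \<in> S3" "\<And>y. y \<in> S3 \<Longrightarrow> f y = g y"
  shows "sphere_deriv f x = sphere_deriv g x"
proof -
  have 1: "(g has_derivative L) (at x within S3)" if "(f has_derivative L) (at x within S3)" for L
    by (rule has_derivative_transform[OF assms(1) _ that]) (simp add: assms(2))
  have 2: "(f has_derivative L) (at x within S3)" if "(g has_derivative L) (at x within S3)" for L
    by (rule has_derivative_transform[OF assms(1) _ that]) (simp add: assms(2))
  have "(f has_derivative L) (at x within S3) \<longleftrightarrow> (g has_derivative L) (at x within S3)" for L
    using 1 2 by blast
  then show ?thesis by (simp add: sphere_deriv_def)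
qed

lemma sphere_grad_eq:
  assumes x: "x \<in> S3" and f: "(f has_derivative (\<lambda>v. g \<bullet> v)) (at x)"
  shows "sphere_grad f x = tangent_proj x g"
  unfolding sphere_grad_def
proof (rule the_equality)
  have eq: "g \<bullet> tangent_proj x v = tangent_proj x g \<bullet> v" for v
    by (simp add: tangent_proj_def inner_diff_left inner_diff_right inner_commute)
  show "tangent_proj x g \<in> tangent_space x \<and> (\<forall>v\<in>tangent_space x. tangent_proj x g \<bullet> v = sphere_deriv f x v)"
    using x by (simp add: sphere_deriv_eq[OF x f] eq)
  fix w assume w: "w \<in> tangent_space x \<and> (\<forall>v\<in>tangent_space x. w \<bullet> v = sphere_deriv f x v)"
  define d where "d = w - tangent_proj x g"
  have "d \<in> tangent_space x" using w tangent_proj_in[OF x, of g]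
    by (simp add: d_def tangent_space_def inner_diff_left)
  then have "d \<bullet> d = 0"
    using w by (simp add: d_def inner_diff_left sphere_deriv_eq[OF x f] eq)
  then show "w = tangent_proj x g" by (simp add: d_def)
qed

text \<open>A function on the ambient space together with its first and second derivatives, from which the
intrinsic operators on the sphere are computed. In \<open>D2 x w v\<close> the second differentiation is in
the direction \<open>w\<close>.\<close>
locale twice_differentiable =
  fixes f :: "complex ^ 2 \<Rightarrow> real"
    and D :: "complex ^ 2 \<Rightarrow> complex ^ 2 \<Rightarrow> real"
    and D2 :: "complex ^ 2 \<Rightarrow> complex ^ 2 \<Rightarrow> complex ^ 2 \<Rightarrow> real"
  assumes first: "(f has_derivative D x) (at x)"
    and second: "((\<lambda>y. D y v) has_derivative (\<lambda>w. D2 x w v)) (at x)"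
    and linear_second: "linear (D2 x w)"
begin

definition gradient :: "complex ^ 2 \<Rightarrow> complex ^ 2" where
  "gradient x = (\<Sum>b\<in>Basis. D x b *\<^sub>R b)"

definition hess :: "complex ^ 2 \<Rightarrow> complex ^ 2 \<Rightarrow> complex ^ 2" where
  "hess x v = (\<Sum>b\<in>Basis. D2 x v b *\<^sub>R b)"

lemma gradient_inner: "gradient x \<bullet> v = D x v"
proof -
  have "linear (D x)" using first has_derivative_linear by blast
  then have "D x v = D x (\<Sum>b\<in>Basis. (v \<bullet> b) *\<^sub>R b)" by (simp add: euclidean_representation)
  also have "\<dots> = (\<Sum>b\<in>Basis. (v \<bullet> b) * D x b)"
    using \<open>linear (D x)\<close> by (simp add: linear_sum linear_scale)
  finally show ?thesis by (simp add: gradient_def inner_sum_left inner_sum_right mult.commute inner_commute[of _ v])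
qed

lemma hess_inner: "hess x w \<bullet> v = D2 x w v"
proof -
  have "D2 x w v = D2 x w (\<Sum>b\<in>Basis. (v \<bullet> b) *\<^sub>R b)" by (simp add: euclidean_representation)
  also have "\<dots> = (\<Sum>b\<in>Basis. (v \<bullet> b) * D2 x w b)"
    using linear_second[of x w] by (simp add: linear_sum linear_scale)
  finally show ?thesis by (simp add: hess_def inner_sum_left inner_sum_right mult.commute inner_commute[of _ v])
qed

lemma gradient_has_derivative: "(gradient has_derivative hess x) (at x)"
  unfolding gradient_def hess_def
  by (intro has_derivative_sum has_derivative_scaleR_left second)

lemma linear_hess: "linear (hess x)"
  using gradient_has_derivative has_derivative_linear by blast

lemma sphere_grad: "x \<in> S3 \<Longrightarrow> sphere_grad f x = tangent_proj x (gradient x)"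
  by (rule sphere_grad_eq) (simp_all add: gradient_inner first)

lemma critical_at: "x \<in> S3 \<Longrightarrow> critical_at f x \<longleftrightarrow> (\<forall>v\<in>tangent_space x. D x v = 0)"
  by (simp add: critical_at_def sphere_deriv_eq[OF _ first] tangent_proj_id cong: ball_cong)

text \<open>On the sphere the gradient agrees with the field \<open>y \<mapsto> gradient y - (gradient y \<bullet> y) y\<close>, which is
differentiable in the ambient space. The projection removes all multiples of \<open>x\<close>.\<close>
lemma cov_deriv_sphere_grad:
  assumes x: "x \<in> S3"
  shows "cov_deriv (sphere_grad f) x v =
    tangent_proj x (hess x (tangent_proj x v)) - D x x *\<^sub>R tangent_proj x v"
proof -
  let ?Y = "\<lambda>y. tangent_proj y (gradient y)"
  define u where "u = tangent_proj x v"
  have xx: "x \<bullet> x = 1" using x by (simp add: dot_square_norm)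
  have "(?Y has_derivative (\<lambda>w. hess x w - ((gradient x \<bullet> x) *\<^sub>R w + (gradient x \<bullet> w + hess x w \<bullet> x) *\<^sub>R x))) (at x)"
    unfolding tangent_proj_def
    by (intro has_derivative_diff has_derivative_scaleR has_derivative_inner
        gradient_has_derivative has_derivative_ident)
  from sphere_deriv_eq[OF x this]
  have "sphere_deriv ?Y x v = hess x u - ((gradient x \<bullet> x) *\<^sub>R u + (gradient x \<bullet> u + hess x u \<bullet> x) *\<^sub>R x)"
    by (simp only: u_def)
  moreover have "sphere_deriv (sphere_grad f) x = sphere_deriv ?Y x"
    by (rule sphere_deriv_cong[OF x]) (rule sphere_grad)
  moreover have "u \<bullet> x = 0" using tangent_proj_in[OF x, of v] by (simp add: u_def tangent_space_def)
  ultimately have ux: "u \<bullet> x = 0" and eq: "sphere_deriv (sphere_grad f) x v =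
      hess x u - ((gradient x \<bullet> x) *\<^sub>R u + (gradient x \<bullet> u + hess x u \<bullet> x) *\<^sub>R x)"
    by simp_all
  show ?thesis unfolding u_def[symmetric] cov_deriv_def eq
    by (simp add: ux tangent_proj_def inner_diff_left inner_add_left xx gradient_inner algebra_simps)
qed

lemma sphere_hessian:
  assumes "x \<in> S3" "v \<in> tangent_space x" "w \<in> tangent_space x"
  shows "sphere_hessian f x v w = D2 x v w - D x x * (v \<bullet> w)"
  using assms
  by (simp add: sphere_hessian_def cov_deriv_sphere_grad inner_diff_left inner_tangent_proj
      tangent_proj_id hess_inner)

text \<open>The trace of the projected Hessian is the ambient trace minus the normal entry \<open>D2 x x x\<close>; the radial
derivative enters three times, once for each dimension of the sphere.\<close>
lemma laplace_beltrami:
  assumes x: "x \<in> S3"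
  shows "laplace_beltrami f x = D2 x x x + 3 * D x x - (\<Sum>b\<in>Basis. D2 x b b)"
proof -
  have xx: "x \<bullet> x = 1" using x by (simp add: dot_square_norm)
  have lin: "hess x (v - a *\<^sub>R x) = hess x v - a *\<^sub>R hess x x" for v a
    using linear_hess by (simp add: linear_diff linear_scale)
  have trm: "cov_deriv (sphere_grad f) x b \<bullet> b =
      D2 x b b - (b \<bullet> x) * D2 x x b - (b \<bullet> x) * (hess x b \<bullet> x) + (b \<bullet> x) * (b \<bullet> x) * D2 x x x
      - D x x * (b \<bullet> b - (b \<bullet> x) * (b \<bullet> x))" for b
    by (simp add: cov_deriv_sphere_grad[OF x] tangent_proj_def lin inner_diff_left hess_inner
        inner_commute[of x b] algebra_simps)
  have s1: "(\<Sum>b\<in>Basis. (b \<bullet> x) * D2 x x b) = D2 x x x"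
  proof -
    have "(\<Sum>b\<in>Basis. (b \<bullet> x) * D2 x x b) = (\<Sum>b\<in>Basis. (x \<bullet> b) * (hess x x \<bullet> b))"
      by (simp add: hess_inner inner_commute[of _ x])
    also have "\<dots> = x \<bullet> hess x x" by (rule euclidean_inner[symmetric])
    finally show ?thesis by (metis hess_inner inner_commute)
  qed
  have s2: "(\<Sum>b\<in>Basis. (b \<bullet> x) * (hess x b \<bullet> x)) = D2 x x x"
  proof -
    have "(\<Sum>b\<in>Basis. (b \<bullet> x) * (hess x b \<bullet> x)) = hess x (\<Sum>b\<in>Basis. (x \<bullet> b) *\<^sub>R b) \<bullet> x"
      using linear_hess by (simp add: linear_sum linear_scale inner_sum_left inner_sum_right inner_commute)
    then show ?thesis by (simp add: euclidean_representation hess_inner)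
  qed
  have s3: "(\<Sum>b\<in>Basis. (b \<bullet> x) * (b \<bullet> x)) = 1"
    using euclidean_inner[of x x] xx by (simp add: inner_commute)
  have s4: "(\<Sum>b\<in>(Basis :: (complex ^ 2) set). b \<bullet> b) = 4"
    by simp
  have "sphere_div (sphere_grad f) x =
      (\<Sum>b\<in>Basis. D2 x b b) - D2 x x x - D2 x x x + D2 x x x - D x x * (4 - 1)"
    unfolding sphere_div_def trm
    by (simp add: sum.distrib sum_subtractf s1 s2 s3 s4 flip: sum_distrib_left sum_distrib_right)
  then show ?thesis by (simp add: laplace_beltrami_def)
qed

end

section \<open>The binary icosahedral group\<close>

definition quat :: "real \<Rightarrow> real \<Rightarrow> real \<Rightarrow> real \<Rightarrow> real ^ 4" where
  "quat a b c d = vector [a, b, c, d]"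

lemma quat_nth [simp]:
  "quat a b c d $ 1 = a" "quat a b c d $ 2 = b" "quat a b c d $ 3 = c" "quat a b c d $ 4 = d"
  by (simp_all add: quat_def vector_def)

lemma vec4_eq_iff: "(x :: 'a ^ 4) = y \<longleftrightarrow> x $ 1 = y $ 1 \<and> x $ 2 = y $ 2 \<and> x $ 3 = y $ 3 \<and> x $ 4 = y $ 4"
  by (auto simp: vec_eq_iff forall_4)

definition qmul :: "real ^ 4 \<Rightarrow> real ^ 4 \<Rightarrow> real ^ 4" where
  "qmul p q = quat
     (p $ 1 * q $ 1 - p $ 2 * q $ 2 - p $ 3 * q $ 3 - p $ 4 * q $ 4)
     (p $ 1 * q $ 2 + p $ 2 * q $ 1 + p $ 3 * q $ 4 - p $ 4 * q $ 3)
     (p $ 1 * q $ 3 - p $ 2 * q $ 4 + p $ 3 * q $ 1 + p $ 4 * q $ 2)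
     (p $ 1 * q $ 4 + p $ 2 * q $ 3 - p $ 3 * q $ 2 + p $ 4 * q $ 1)"

lemma quaternion_matrix_qmul:
  "quaternion_matrix (qmul p q) = quaternion_matrix p ** quaternion_matrix q"
  by (simp add: quaternion_matrix_def qmul_def vec_eq_iff forall_2 matrix_matrix_mult_def sum_2
      complex_eq_iff algebra_simps)

text \<open>Codes of quaternions whose coordinates lie in \<open>\<int>[\<surd>5] / 4\<close>: the pair \<open>(a, b)\<close> stands for \<open>(a + b \<surd>5) / 4\<close>. All
icosians are of this form, so that statements about the 120 elements become computations with integers.\<close>
type_synonym icosian_code = "(int \<times> int) \<times> (int \<times> int) \<times> (int \<times> int) \<times> (int \<times> int)"

fun decode1 :: "int \<times> int \<Rightarrow> real" where
  "decode1 (a, b) = (of_int a + of_int b * sqrt 5) / 4"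

fun decode :: "icosian_code \<Rightarrow> real ^ 4" where
  "decode (a, b, c, d) = quat (decode1 a) (decode1 b) (decode1 c) (decode1 d)"

text \<open>The product before reduction: its entries are those of a quaternion with denominator 16, so that a code
\<open>r\<close> of the product satisfies \<open>code_times p q = code_quadruple r\<close>.\<close>
fun code_times :: "icosian_code \<Rightarrow> icosian_code \<Rightarrow> icosian_code" where
  "code_times ((a0,a1),(b0,b1),(c0,c1),(d0,d1)) ((e0,e1),(f0,f1),(g0,g1),(h0,h1)) =
   ((a0*e0+5*a1*e1 - (b0*f0+5*b1*f1) - (c0*g0+5*c1*g1) - (d0*h0+5*d1*h1),
     a0*e1+a1*e0 - (b0*f1+b1*f0) - (c0*g1+c1*g0) - (d0*h1+d1*h0)),
    (a0*f0+5*a1*f1 + (b0*e0+5*b1*e1) + (c0*h0+5*c1*h1) - (d0*g0+5*d1*g1),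
     a0*f1+a1*f0 + (b0*e1+b1*e0) + (c0*h1+c1*h0) - (d0*g1+d1*g0)),
    (a0*g0+5*a1*g1 - (b0*h0+5*b1*h1) + (c0*e0+5*c1*e1) + (d0*f0+5*d1*f1),
     a0*g1+a1*g0 - (b0*h1+b1*h0) + (c0*e1+c1*e0) + (d0*f1+d1*f0)),
    (a0*h0+5*a1*h1 + (b0*g0+5*b1*g1) - (c0*f0+5*c1*f1) + (d0*e0+5*d1*e1),
     a0*h1+a1*h0 + (b0*g1+b1*g0) - (c0*f1+c1*f0) + (d0*e1+d1*e0)))"

fun code_quadruple :: "icosian_code \<Rightarrow> icosian_code" where
  "code_quadruple ((a0,a1),(b0,b1),(c0,c1),(d0,d1)) =
     ((4*a0,4*a1),(4*b0,4*b1),(4*c0,4*c1),(4*d0,4*d1))"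

lemma decode_mult:
  assumes "code_times p q = code_quadruple r"
  shows "qmul (decode p) (decode q) = decode r"
proof -
  obtain a0 a1 b0 b1 c0 c1 d0 d1 where p: "p = ((a0,a1),(b0,b1),(c0,c1),(d0,d1))"
    by (metis surj_pair)
  obtain e0 e1 f0 f1 g0 g1 h0 h1 where q: "q = ((e0,e1),(f0,f1),(g0,g1),(h0,h1))"
    by (metis surj_pair)
  obtain k0 k1 l0 l1 m0 m1 n0 n1 where r: "r = ((k0,k1),(l0,l1),(m0,m1),(n0,n1))"
    by (metis surj_pair)
  define s where "s = sqrt 5"
  have s: "s * s = 5" by (simp add: s_def)
  note eqs = assms[unfolded p q r code_times.simps code_quadruple.simps prod.inject]
  show ?thesis
    using eqs
    apply (simp only: p q r decode.simps decode1.simps qmul_def vec4_eq_iff quat_nth flip: s_def)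
    apply (elim conjE, intro conjI; drule arg_cong[where f=real_of_int]; (drule arg_cong[where f=real_of_int])+; simp; use s in algebra)
    done
qed

definition icosian_codes :: "icosian_code list" where
  "icosian_codes =
     concat (map (\<lambda>s. [((s,0),(0,0),(0,0),(0,0)), ((0,0),(s,0),(0,0),(0,0)),
                       ((0,0),(0,0),(s,0),(0,0)), ((0,0),(0,0),(0,0),(s,0))]) [4,-4])
   @ [((a,0),(b,0),(c,0),(d,0)). a \<leftarrow> [2,-2], b \<leftarrow> [2,-2], c \<leftarrow> [2,-2], d \<leftarrow> [2,-2]]
   @ concat [[(w,x,y,z), (w,y,z,x), (w,z,x,y), (x,w,z,y), (y,w,x,z), (z,w,y,x),
              (x,y,w,z), (y,z,w,x), (z,x,w,y), (x,z,y,w), (y,x,z,w), (z,y,x,w)].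
       w \<leftarrow> [(0,0)], x \<leftarrow> [(2,0),(-2,0)], y \<leftarrow> [(-1,1),(1,-1)], z \<leftarrow> [(1,1),(-1,-1)]]"

text \<open>The quaternions \<open>i\<close>, \<open>j\<close>, \<open>(1 + i + j + k) / 2\<close> and \<open>(\<phi> + i + k / \<phi>) / 2\<close>, of orders 4, 4, 6 and 10. Every icosian
is a product of powers of them, in this order.\<close>
definition generator_codes :: "icosian_code list" where
  "generator_codes = [((0,0),(4,0),(0,0),(0,0)), ((0,0),(0,0),(4,0),(0,0)),
     ((2,0),(2,0),(2,0),(2,0)), ((1,1),(2,0),(0,0),(-1,1))]"

text \<open>Closure under left multiplication by generators is all that is checked directly; closure under
multiplication follows by induction over products of generators.\<close>
lemma gens_closed:
  "list_all (\<lambda>g. list_all (\<lambda>q. code_times g q \<in> set (map code_quadruple icosian_codes)) icosian_codes) generator_codes"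
  by code_simp

fun code_div :: "icosian_code \<Rightarrow> icosian_code" where
  "code_div ((a0,a1),(b0,b1),(c0,c1),(d0,d1)) =
     ((a0 div 4,a1 div 4),(b0 div 4,b1 div 4),(c0 div 4,c1 div 4),(d0 div 4,d1 div 4))"

definition code_mult :: "icosian_code \<Rightarrow> icosian_code \<Rightarrow> icosian_code" where
  "code_mult p q = code_div (code_times p q)"

lemma code_div_quadruple: "code_div (code_quadruple r) = r"
  by (cases r rule: code_quadruple.cases) simp

lemma code_mult_gen:
  assumes "g \<in> set generator_codes" "q \<in> set icosian_codes"
  shows "code_mult g q \<in> set icosian_codes" (is ?A)
    and "decode (code_mult g q) = qmul (decode g) (decode q)" (is ?B)
proof -
  have "code_times g q \<in> set (map code_quadruple icosian_codes)"
    using gens_closed assms by (simp only: list_all_iff)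
  then obtain r where r: "r \<in> set icosian_codes" "code_times g q = code_quadruple r"
    by auto
  then have "code_mult g q = r" by (simp add: code_mult_def code_div_quadruple)
  then show ?A ?B using r decode_mult by auto
qed

definition left_multiples :: "icosian_code \<Rightarrow> nat \<Rightarrow> icosian_code list \<Rightarrow> icosian_code list" where
  "left_multiples g n xs = concat (map (\<lambda>k. map ((code_mult g) ^^ k) xs) [0..<n])"

definition icosian_words :: "icosian_code list" where
  "icosian_words =
     left_multiples ((0,0),(4,0),(0,0),(0,0)) 4 (left_multiples ((0,0),(0,0),(4,0),(0,0)) 2
      (left_multiples ((2,0),(2,0),(2,0),(2,0)) 3 (left_multiples ((1,1),(2,0),(0,0),(-1,1)) 5
        [((4,0),(0,0),(0,0),(0,0))])))"

lemma left_multiples_closed: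
  assumes "\<forall>q. P q \<longrightarrow> P (code_mult g q)" "\<forall>q\<in>set xs. P q"
  shows "\<forall>q\<in>set (left_multiples g n xs). P q"
proof -
  have "P ((code_mult g ^^ k) q)" if "P q" for k q
    using that assms(1) by (induction k) (simp, simp del: split_paired_All)
  then show ?thesis using assms(2) by (auto simp: left_multiples_def)
qed

lemma codes_are_words: "list_all (\<lambda>q. q \<in> set icosian_words) icosian_codes"
  by code_simp

lemma code_one: "((4,0),(0,0),(0,0),(0,0)) \<in> set icosian_codes"
  by (simp add: icosian_codes_def)

text \<open>All codes occur among the products \<open>i\<^sup>a j\<^sup>b \<omega>\<^sup>c \<sigma>\<^sup>d\<close> of powers of the four generators. Since these products are built
by left multiplication, a property that passes from \<open>x\<close> to \<open>g x\<close> reaches all of them.\<close>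
lemma icosian_code_induct:
  assumes "q \<in> set icosian_codes" and one: "P (quat 1 0 0 0)"
    and step: "\<And>g x. g \<in> set generator_codes \<Longrightarrow> P x \<Longrightarrow> P (qmul (decode g) x)"
  shows "P (decode q)"
proof -
  define Q where "Q = (\<lambda>q. q \<in> set icosian_codes \<and> P (decode q))"
  have Q1: "Q ((4,0),(0,0),(0,0),(0,0))" using one code_one by (simp add: Q_def)
  have Qg: "Q (code_mult g q)" if "g \<in> set generator_codes" "Q q" for g q
    using that step code_mult_gen by (simp add: Q_def)
  have "\<forall>q\<in>set icosian_words. Q q"
    unfolding icosian_words_def
    by (intro left_multiples_closed; auto intro!: Qg Q1 simp: generator_codes_def)
  moreover have "q \<in> set icosian_words"
    using assms(1) codes_are_words by (simp only: list_all_iff)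
  ultimately have "Q q" by blast
  then show ?thesis by (simp add: Q_def)
qed

abbreviation swap :: "4 \<Rightarrow> 4 \<Rightarrow> 4 \<Rightarrow> 4" where
  "swap \<equiv> Transposition.transpose"

text \<open>Every permutation of four elements is a product of three transpositions of this shape, which makes its
parity visible.\<close>
lemma permutes_4:
  "p permutes (UNIV :: 4 set) \<longleftrightarrow>
   (\<exists>b\<in>{1,2,3,4}. \<exists>c\<in>{2,3,4}. \<exists>d\<in>{3,4}. p = swap 1 b \<circ> (swap 2 c \<circ> swap 3 d))"
proof
  have step: "p permutes insert a S \<longleftrightarrow> (\<exists>b\<in>insert a S. \<exists>q. q permutes S \<and> p = swap a b \<circ> q)"
    for p a S
  proof -
    have "p \<in> {p. p permutes insert a S} \<longleftrightarrow> (\<exists>b\<in>insert a S. \<exists>q. q permutes S \<and> p = swap a b \<circ> q)"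
      unfolding permutes_insert image_iff by auto
    then show ?thesis by simp
  qed
  assume "p permutes (UNIV :: 4 set)"
  then have "p permutes {1,2,3,4}" using UNIV_4 by metis
  then obtain b q where b: "b \<in> {1,2,3,4}" "p = swap 1 b \<circ> q" "q permutes {2,3,4}"
    unfolding step[of _ 1] by blast
  then obtain c r where c: "c \<in> {2,3,4}" "q = swap 2 c \<circ> r" "r permutes {3,4}"
    unfolding step[of _ 2] by blast
  then obtain d t where d: "d \<in> {3,4}" "r = swap 3 d \<circ> t" "t permutes {4}"
    unfolding step[of _ 3] by blast
  then have "p = swap 1 b \<circ> (swap 2 c \<circ> swap 3 d)" using b(2) c(2) by simp
  then show "\<exists>b\<in>{1,2,3,4}. \<exists>c\<in>{2,3,4}. \<exists>d\<in>{3,4}. p = swap 1 b \<circ> (swap 2 c \<circ> swap 3 d)"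
    using b(1) c(1) d(1) by blast
next
  assume "\<exists>b\<in>{1,2,3,4}. \<exists>c\<in>{2,3,4}. \<exists>d\<in>{3,4}. p = swap 1 b \<circ> (swap 2 c \<circ> swap 3 d)"
  then show "p permutes UNIV"
    by (auto intro!: permutes_compose permutes_swap_id)
qed

lemma evenperm_swaps:
  "evenperm (swap 1 b \<circ> (swap 2 c \<circ> swap 3 d)) \<longleftrightarrow> ((1 = b) \<longleftrightarrow> ((2 = c) \<longleftrightarrow> (3 = d)))"
  by (simp add: evenperm_comp evenperm_swap permutation_compose permutation_swap_id)

text \<open>The alternating group, listed by values, in the order in which the codes are listed.\<close>
lemma evenperm_4:
  "p permutes (UNIV :: 4 set) \<and> evenperm p \<longleftrightarrow>
    (p 1, p 2, p 3, p 4) \<in> {(1,2,3,4), (1,3,4,2), (1,4,2,3), (2,1,4,3), (3,1,2,4), (4,1,3,2),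
       (2,3,1,4), (3,4,1,2), (4,2,1,3), (2,4,3,1), (3,2,4,1), (4,3,2,1)}" (is "_ \<longleftrightarrow> ?R p")
proof
  assume "p permutes UNIV \<and> evenperm p"
  then obtain b c d where "b \<in> {1,2,3,4}" "c \<in> {2,3,4}" "d \<in> {3,4}"
    and p: "p = swap 1 b \<circ> (swap 2 c \<circ> swap 3 d)" and "evenperm p" unfolding permutes_4 by blast
  then show "?R p"
    unfolding p evenperm_swaps
    by (elim insertE emptyE; simp add: Transposition.transpose_def)
next
  assume "?R p"
  have ext4: "p = q \<longleftrightarrow> p 1 = q 1 \<and> p 2 = q 2 \<and> p 3 = q 3 \<and> p 4 = q 4" for q :: "4 \<Rightarrow> 4"
    by (auto simp: fun_eq_iff forall_4)
  have "\<exists>b\<in>{1,2,3,4}. \<exists>c\<in>{2,3,4}. \<exists>d\<in>{3,4}. p = swap 1 b \<circ> (swap 2 c \<circ> swap 3 d)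
      \<and> ((1 = b) \<longleftrightarrow> ((2 = c) \<longleftrightarrow> (3 = d)))"
    using \<open>?R p\<close> unfolding ext4 by (elim insertE emptyE; simp add: Transposition.transpose_def)
  then show "p permutes UNIV \<and> evenperm p"
    unfolding permutes_4 using evenperm_swaps by metis
qed

lemma decode_values:
  "decode1 (4,0) = 1" "decode1 (-4,0) = -1" "decode1 (0,0) = 0"
  "decode1 (2,0) = 1/2" "decode1 (-2,0) = -1/2"
  "decode1 (1,1) = golden_ratio / 2" "decode1 (-1,-1) = - golden_ratio / 2"
  "decode1 (-1,1) = 1 / (2 * golden_ratio)" "decode1 (1,-1) = - 1 / (2 * golden_ratio)"
proof -
  have "(1 + sqrt 5) * (sqrt 5 - 1) = 4" by (simp add: algebra_simps)
  moreover have "1 + sqrt 5 > 0" by (simp add: add_pos_nonneg)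
  ultimately have inv': "1 / (1 + sqrt 5) = (sqrt 5 - 1) / 4" by (simp add: field_simps)
  have two: "2 * golden_ratio = 1 + sqrt 5" by (simp add: golden_ratio_def)
  have inv: "1 / (2 * golden_ratio) = (sqrt 5 - 1) / 4" unfolding two by (rule inv')
  then have inv2: "- 1 / (2 * golden_ratio) = - ((sqrt 5 - 1) / 4)" by (metis minus_divide_left)
  show "decode1 (-1,1) = 1 / (2 * golden_ratio)" "decode1 (1,-1) = - 1 / (2 * golden_ratio)"
    unfolding inv inv2 by (simp_all add: field_simps)
qed (simp_all add: golden_ratio_def field_simps)

text \<open>The codes list the elements of the three families in the definition of the icosians. The third family is
parametrized by even permutations, which are replaced by their twelve lists of values.\<close>
lemma unit_icosians_eq: "unit_icosians = decode ` set icosian_codes"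
proof -
  have 1: "{axis i s | i s. s \<in> {1, -1}} = {quat s 0 0 0 | s. s \<in> {1,-1}} \<union> {quat 0 s 0 0 | s. s \<in> {1,-1}}
     \<union> {quat 0 0 s 0 | s. s \<in> {1,-1}} \<union> {quat 0 0 0 s | s. s \<in> {1,-1 :: real}}" (is "?L = ?R")
  proof -
    have ax: "axis 1 s = quat s 0 0 0" "axis 2 s = quat 0 s 0 0" "axis 3 s = quat 0 0 s 0"
      "axis 4 s = quat 0 0 0 s" for s
      by (simp_all add: vec4_eq_iff axis_def)
    have "?L = (\<Union>i. {axis i s | s. s \<in> {1, -1}})" by auto
    also have "\<dots> = ?R" unfolding UNIV_4 by (simp add: ax Un_assoc)
    finally show ?thesis .
  qed
  have 2: "{q :: real ^ 4. \<forall>i. q $ i \<in> {1/2, -1/2}} =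
     (\<Union>a\<in>{1/2,-1/2}. \<Union>b\<in>{1/2,-1/2}. \<Union>c\<in>{1/2,-1/2}. \<Union>d\<in>{1/2,-1/2}. {quat a b c d})"
    by (auto simp: forall_4 vec4_eq_iff)
  have 3: "{(\<chi> i. vector [0, a / 2, b / (2 * golden_ratio), c * golden_ratio / 2] $ (p i)) | p a b c.
        p permutes (UNIV :: 4 set) \<and> evenperm p \<and> a \<in> {1, -1} \<and> b \<in> {1, -1} \<and> c \<in> {1, -1}} =
     (\<Union>x\<in>{1/2,-1/2}. \<Union>y\<in>{1 / (2 * golden_ratio), - 1 / (2 * golden_ratio)}.
      \<Union>z\<in>{golden_ratio / 2, - golden_ratio / 2}.
        (\<lambda>(i,j,k,l). quat (quat 0 x y z $ i) (quat 0 x y z $ j) (quat 0 x y z $ k) (quat 0 x y z $ l)) `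
        {(1,2,3,4), (1,3,4,2), (1,4,2,3), (2,1,4,3), (3,1,2,4), (4,1,3,2),
       (2,3,1,4), (3,4,1,2), (4,2,1,3), (2,4,3,1), (3,2,4,1), (4,3,2,1)})" (is "?L = ?R")
  proof
    show "?L \<subseteq> ?R"
    proof
      fix q assume "q \<in> ?L"
      then obtain p a b c where p: "p permutes (UNIV :: 4 set) \<and> evenperm p"
        and abc: "a \<in> {1, -1}" "b \<in> {1, -1}" "c \<in> {1, -1 :: real}"
        and q: "q = (\<chi> i. vector [0, a / 2, b / (2 * golden_ratio), c * golden_ratio / 2] $ (p i))"
        by blast
      have "q = quat (quat 0 (a / 2) (b / (2 * golden_ratio)) (c * golden_ratio / 2) $ (p 1))
          (quat 0 (a / 2) (b / (2 * golden_ratio)) (c * golden_ratio / 2) $ (p 2))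
          (quat 0 (a / 2) (b / (2 * golden_ratio)) (c * golden_ratio / 2) $ (p 3))
          (quat 0 (a / 2) (b / (2 * golden_ratio)) (c * golden_ratio / 2) $ (p 4))"
        unfolding q vec4_eq_iff quat_def[symmetric] by simp
      moreover have "a / 2 \<in> {1/2,-1/2}" "b / (2 * golden_ratio) \<in> {1 / (2 * golden_ratio), - 1 / (2 * golden_ratio)}"
        "c * golden_ratio / 2 \<in> {golden_ratio / 2, - golden_ratio / 2}" using abc by auto
      ultimately show "q \<in> ?R"
        using p unfolding evenperm_4 
        by (intro UN_I image_eqI[where x = "(p 1, p 2, p 3, p 4)"]) (assumption | simp only: prod.case)+
    qed
    show "?R \<subseteq> ?L"
    proof
      fix q assume "q \<in> ?R"
      then obtain x y z i j k l where q: "q = quat (quat 0 x y z $ i) (quat 0 x y z $ j) (quat 0 x y z $ k) (quat 0 x y z $ l)"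
        and ijkl: "(i,j,k,l) \<in> {(1,2,3,4), (1,3,4,2), (1,4,2,3), (2,1,4,3), (3,1,2,4), (4,1,3,2),
       (2,3,1,4), (3,4,1,2), (4,2,1,3), (2,4,3,1), (3,2,4,1), (4,3,2,1)}"
        and xyz: "x \<in> {1/2,-1/2}" "y \<in> {1 / (2 * golden_ratio), - 1 / (2 * golden_ratio)}"
        "z \<in> {golden_ratio / 2, - golden_ratio / 2}"
        
        unfolding UN_iff image_iff Bex_def split_paired_Ex prod.case by (elim exE conjE) (rule that)
      define p :: "4 \<Rightarrow> 4" where "p = id(1 := i, 2 := j, 3 := k, 4 := l)"
      have pv: "p 1 = i" "p 2 = j" "p 3 = k" "p 4 = l" by (simp_all add: p_def)
      have p: "p permutes UNIV \<and> evenperm p" unfolding evenperm_4 pv by (rule ijkl)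
      obtain a where a: "x = a / 2" "a \<in> {1,-1}" using xyz(1) by force
      obtain b where b: "y = b / (2 * golden_ratio)" "b \<in> {1,-1}" using xyz(2) by force
      obtain c where c: "z = c * golden_ratio / 2" "c \<in> {1,-1}" using xyz(3) by force
      have "q = (\<chi> i. vector [0, a / 2, b / (2 * golden_ratio), c * golden_ratio / 2] $ (p i))"
        unfolding q vec4_eq_iff quat_def[symmetric] a(1) b(1) c(1) by (simp add: pv)
      then show "q \<in> ?L" using p a(2) b(2) c(2) by blast
    qed
  qed
  have c2: "decode ` set [((a,0),(b,0),(c,0),(d,0)). a \<leftarrow> [2,-2], b \<leftarrow> [2,-2], c \<leftarrow> [2,-2], d \<leftarrow> [2,-2]]
     = (\<Union>a\<in>{1/2,-1/2}. \<Union>b\<in>{1/2,-1/2}. \<Union>c\<in>{1/2,-1/2}. \<Union>d\<in>{1/2,-1/2}. {quat a b c d})"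
    apply (simp add: decode_values del: decode1.simps)
    apply (intro subset_antisym; simp)
    done
  have c1: "decode ` set (concat (map (\<lambda>s. [((s,0),(0,0),(0,0),(0,0)), ((0,0),(s,0),(0,0),(0,0)),
                       ((0,0),(0,0),(s,0),(0,0)), ((0,0),(0,0),(0,0),(s,0))]) [4,-4])) =
      {quat s 0 0 0 | s. s \<in> {1,-1}} \<union> {quat 0 s 0 0 | s. s \<in> {1,-1}}
     \<union> {quat 0 0 s 0 | s. s \<in> {1,-1}} \<union> {quat 0 0 0 s | s. s \<in> {1,-1 :: real}}"
    by (auto simp: decode_values)
  have c3: "decode ` set (concat [[(w,x,y,z), (w,y,z,x), (w,z,x,y), (x,w,z,y), (y,w,x,z), (z,w,y,x),
              (x,y,w,z), (y,z,w,x), (z,x,w,y), (x,z,y,w), (y,x,z,w), (z,y,x,w)].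
       w \<leftarrow> [(0,0)], x \<leftarrow> [(2,0),(-2,0)], y \<leftarrow> [(-1,1),(1,-1)], z \<leftarrow> [(1,1),(-1,-1)]]) =
     (\<Union>x\<in>{1/2,-1/2}. \<Union>y\<in>{1 / (2 * golden_ratio), - 1 / (2 * golden_ratio)}.
      \<Union>z\<in>{golden_ratio / 2, - golden_ratio / 2}.
        (\<lambda>(i,j,k,l). quat (quat 0 x y z $ i) (quat 0 x y z $ j) (quat 0 x y z $ k) (quat 0 x y z $ l)) `
        {(1,2,3,4), (1,3,4,2), (1,4,2,3), (2,1,4,3), (3,1,2,4), (4,1,3,2),
       (2,3,1,4), (3,4,1,2), (4,2,1,3), (2,4,3,1), (3,2,4,1), (4,3,2,1)})"
    apply (simp add: decode_values del: decode1.simps)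
    apply (intro subset_antisym; simp)
    done
  show ?thesis
    unfolding unit_icosians_def icosian_codes_def set_append image_Un c1 c2 c3 1 2 3
    by (simp add: Un_assoc)
qed

text \<open>Right multiplication by a unit quaternion orthogonal to 1, in complex coordinates. It is antilinear, \<open>J z\<close> is
orthogonal to \<open>z\<close> in the Hermitian sense, and it commutes with the quaternion matrices, which act from the left.\<close>
definition J :: "complex ^ 2 \<Rightarrow> complex ^ 2" where
  "J z = vector [- cnj (z $ 2), cnj (z $ 1)]"

lemma vec2_nth [simp]: "(vector [a, b] :: 'a::zero ^ 2) $ 1 = a" "(vector [a, b] :: 'a ^ 2) $ 2 = b"
  by (simp_all add: vector_def)

lemma J_nth [simp]: "J z $ 1 = - cnj (z $ 2)" "J z $ 2 = cnj (z $ 1)"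
  by (simp_all add: J_def)

lemma vec2_eq_iff: "(x :: 'a ^ 2) = y \<longleftrightarrow> x $ 1 = y $ 1 \<and> x $ 2 = y $ 2"
  by (simp add: vec_eq_iff forall_2)

lemma quaternion_matrix_nth:
  "(quaternion_matrix q *v z) $ 1 = Complex (q $ 1) (q $ 2) * z $ 1 + Complex (q $ 3) (q $ 4) * z $ 2"
  "(quaternion_matrix q *v z) $ 2 = - cnj (Complex (q $ 3) (q $ 4)) * z $ 1 + cnj (Complex (q $ 1) (q $ 2)) * z $ 2"
  by (simp_all add: quaternion_matrix_def matrix_vector_mult_def sum_2 complex_eq_iff)

text \<open>Left and right multiplications commute.\<close>
lemma quaternion_matrix_J: "quaternion_matrix q *v J z = J (quaternion_matrix q *v z)"
  by (simp add: vec2_eq_iff quaternion_matrix_nth algebra_simps)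

lemma quaternion_matrix_one: "quaternion_matrix (quat 1 0 0 0) = mat 1"
  by (simp add: quaternion_matrix_def mat_def vec_eq_iff forall_2 complex_eq_iff)

lemma norm_complex2: "norm (z :: complex ^ 2) ^ 2 = norm (z $ 1) ^ 2 + norm (z $ 2) ^ 2"
  by (simp add: norm_vec_def L2_set_def sum_2)

lemma norm_quaternion_matrix: "norm (quaternion_matrix q *v z) ^ 2 = norm q ^ 2 * norm z ^ 2"
proof -
  have n: "norm q ^ 2 = (q $ 1)\<^sup>2 + (q $ 2)\<^sup>2 + (q $ 3)\<^sup>2 + (q $ 4)\<^sup>2"
    by (simp add: norm_vec_def L2_set_def sum_4)
  show ?thesis
    unfolding norm_complex2 quaternion_matrix_nth cmod_power2 n
    by simp algebra
qed

definition icosian_generators :: "(real ^ 4) set" where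
  "icosian_generators = {quat 0 1 0 0, quat 0 0 1 0, quat (1/2) (1/2) (1/2) (1/2),
     quat (golden_ratio / 2) (1/2) 0 (1 / (2 * golden_ratio))}"

lemma icosian_generators_decode: "icosian_generators = decode ` set generator_codes"
  by (simp add: icosian_generators_def generator_codes_def decode_values del: decode1.simps)

lemma unit_icosian_induct [consumes 1, case_names one step]:
  assumes "q \<in> unit_icosians" "P (quat 1 0 0 0)"
    and "\<And>g x. g \<in> icosian_generators \<Longrightarrow> P x \<Longrightarrow> P (qmul g x)"
  shows "P q"
  using assms icosian_code_induct[of _ P] unfolding unit_icosians_eq icosian_generators_decode by blast

lemma one_unit_icosian: "quat 1 0 0 0 \<in> unit_icosians"
proof -
  have "quat 1 0 0 0 = decode ((4,0),(0,0),(0,0),(0,0))" by (simp add: decode_values)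
  then show ?thesis unfolding unit_icosians_eq using code_one by (metis imageI)
qed

lemma icosian_generators_mult: "g \<in> icosian_generators \<Longrightarrow> x \<in> unit_icosians \<Longrightarrow> qmul g x \<in> unit_icosians"
  unfolding icosian_generators_decode unit_icosians_eq using code_mult_gen by (auto simp: image_iff) metis

lemma qmul_assoc: "qmul (qmul p q) r = qmul p (qmul q r)"
  by (simp add: vec4_eq_iff qmul_def algebra_simps)

lemma qmul_one [simp]: "qmul (quat 1 0 0 0) q = q" "qmul q (quat 1 0 0 0) = q"
  by (simp_all add: vec4_eq_iff qmul_def)

lemma unit_icosians_mult:
  assumes "p \<in> unit_icosians" "q \<in> unit_icosians"
  shows "qmul p q \<in> unit_icosians"
  using assms(1)
proof (induction rule: unit_icosian_induct)
  case one
  then show ?case using assms(2) by simp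
next
  case (step g x)
  then show ?case by (simp add: qmul_assoc icosian_generators_mult)
qed

lemma norm_icosian_generators: "g \<in> icosian_generators \<Longrightarrow> norm g = 1"
proof -
  assume g: "g \<in> icosian_generators"
  have "golden_ratio ^ 2 = golden_ratio + 1"
    by (simp add: golden_ratio_def power2_eq_square field_simps)
  moreover have "golden_ratio > 0" by (simp add: golden_ratio_def add_pos_nonneg)
  ultimately have inv: "1 / (2 * golden_ratio) = (golden_ratio - 1) / 2"
    by (simp add: field_simps power2_eq_square)
  have "norm g ^ 2 = (g $ 1)\<^sup>2 + (g $ 2)\<^sup>2 + (g $ 3)\<^sup>2 + (g $ 4)\<^sup>2"
    by (simp add: norm_vec_def L2_set_def sum_4)
  moreover have "(golden_ratio / 2)\<^sup>2 + (1/2)\<^sup>2 + 0\<^sup>2 + (1 / (2 * golden_ratio))\<^sup>2 = 1"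
    unfolding inv using \<open>golden_ratio ^ 2 = golden_ratio + 1\<close>
    by (simp add: power2_eq_square field_simps)
  ultimately have "norm g ^ 2 = 1"
    using g unfolding icosian_generators_def by (auto simp: power2_eq_square)
  then show "norm g = 1" by (simp add: abs_square_eq_1)
qed

lemma norm_qmul: "norm (qmul p q) = norm p * norm q"
proof -
  have n: "norm (x :: real ^ 4) ^ 2 = (x $ 1)\<^sup>2 + (x $ 2)\<^sup>2 + (x $ 3)\<^sup>2 + (x $ 4)\<^sup>2" for x
    by (simp add: norm_vec_def L2_set_def sum_4)
  have "norm (qmul p q) ^ 2 = (norm p * norm q) ^ 2"
    unfolding power_mult_distrib n qmul_def quat_nth by algebra
  then show ?thesis by (simp add: power2_eq_iff_nonneg)
qed

lemma norm_unit_icosian: "q \<in> unit_icosians \<Longrightarrow> norm q = 1"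
proof (induction rule: unit_icosian_induct)
  case one
  have "norm (quat 1 0 0 0) ^ 2 = 1" by (simp add: norm_vec_def L2_set_def sum_4)
  then show ?case by (simp add: abs_square_eq_1)
qed (simp add: norm_qmul norm_icosian_generators)

lemma one_binary_icosahedral: "mat 1 \<in> binary_icosahedral"
  using one_unit_icosian quaternion_matrix_one unfolding binary_icosahedral_def by (metis imageI)

lemma binary_icosahedral_mult:
  "A \<in> binary_icosahedral \<Longrightarrow> B \<in> binary_icosahedral \<Longrightarrow> A ** B \<in> binary_icosahedral"
  unfolding binary_icosahedral_def
  using unit_icosians_mult by (auto simp flip: quaternion_matrix_qmul)

lemma finite_unit_icosians: "finite unit_icosians"
  by (simp add: unit_icosians_eq)

lemma norm_binary_icosahedral: "A \<in> binary_icosahedral \<Longrightarrow> norm (A *v z) = norm z"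
proof -
  assume "A \<in> binary_icosahedral"
  then obtain q where "A = quaternion_matrix q" "q \<in> unit_icosians"
    unfolding binary_icosahedral_def by blast
  then have "norm (A *v z) ^ 2 = norm z ^ 2"
    using norm_quaternion_matrix[of q z] norm_unit_icosian[of q] by simp
  then show ?thesis by (simp add: power2_eq_iff_nonneg)
qed

lemma binary_icosahedral_J: "A \<in> binary_icosahedral \<Longrightarrow> A *v J z = J (A *v z)"
  unfolding binary_icosahedral_def using quaternion_matrix_J by blast

text \<open>A finite set of invertible matrices that is closed under multiplication is a group.\<close>
lemma binary_icosahedral_inverse:
  assumes A: "A \<in> binary_icosahedral"
  shows "\<exists>B\<in>binary_icosahedral. B ** A = mat 1"
proof -
  have inj: "inj_on (\<lambda>B. A ** B) binary_icosahedral"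
  proof (rule inj_onI)
    fix B C assume "B \<in> binary_icosahedral" "C \<in> binary_icosahedral" "A ** B = A ** C"
    have "A *v z = 0 \<longrightarrow> z = 0" for z using norm_binary_icosahedral[OF A, of z] by auto
    then obtain A' where "A' ** A = mat 1" using matrix_left_invertible_ker by blast
    then show "B = C" using \<open>A ** B = A ** C\<close> by (metis matrix_mul_assoc matrix_mul_lid)
  qed
  have fin: "finite binary_icosahedral" by (simp add: binary_icosahedral_def finite_unit_icosians)
  have "(\<lambda>B. A ** B) ` binary_icosahedral = binary_icosahedral"
    by (rule endo_inj_surj[OF fin _ inj]) (use A binary_icosahedral_mult in auto)
  then obtain B where "B \<in> binary_icosahedral" "A ** B = mat 1"
    using one_binary_icosahedral by (metis imageE)
  then show ?thesis using matrix_left_right_inverse by blast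
qed

lemma orbit_refl: "x \<in> orbit x"
  unfolding orbit_def using one_binary_icosahedral by (metis imageI matrix_vector_mul_lid)

lemma orbit_mult: "A \<in> binary_icosahedral \<Longrightarrow> orbit (A *v x) = orbit x"
proof -
  have sub: "orbit (A *v x) \<subseteq> orbit x" if "A \<in> binary_icosahedral" for A x
    using that binary_icosahedral_mult by (auto simp: orbit_def matrix_vector_mul_assoc)
  assume A: "A \<in> binary_icosahedral"
  then obtain B where B: "B \<in> binary_icosahedral" "B ** A = mat 1"
    using binary_icosahedral_inverse by blast
  then have "B *v (A *v x) = x" by (simp add: matrix_vector_mul_assoc)
  then show ?thesis using sub[OF A, of x] sub[OF B(1), of "A *v x"] by simp
qed

section \<open>The icosahedral form of degree 12\<close>

text \<open>The \<open>i\<close>-th derivative of the \<open>k\<close>-th power. For \<open>i > k\<close> the product contains a factor 0, so that the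
truncated exponent does not matter.\<close>
definition power_deriv :: "nat \<Rightarrow> nat \<Rightarrow> complex \<Rightarrow> complex" where
  "power_deriv i k a = of_nat (\<Prod>l<i. k - l) * a ^ (k - i)"

lemma power_deriv_has_derivative:
  "(power_deriv i k has_field_derivative power_deriv (Suc i) k a) (at a)"
  unfolding power_deriv_def
  by (auto intro!: derivative_eq_intros simp: mult_ac)

lemma power_deriv_euler: "a * power_deriv (Suc i) k a = (of_nat k - of_nat i) * power_deriv i k a"
proof (cases "i \<le> k")
  case True
  then consider "k = i" | m where "k = Suc (i + m)"
    by (metis le_neq_implies_less less_imp_Suc_add)
  then show ?thesis
    by cases (simp_all add: power_deriv_def Suc_diff_le algebra_simps)
next
  case False
  then have 0: "(\<Prod>l<i. k - l) = 0" "(\<Prod>l<Suc i. k - l) = 0"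
    by (auto intro!: prod_zero bexI[of _ k] simp del: prod.lessThan_Suc)
  show ?thesis unfolding power_deriv_def 0 by simp
qed

text \<open>With the axes of the icosahedron placed such that the coordinate axes have order two, the invariant form is
\<open>x\<^sup>1\<^sup>2 - 33 x\<^sup>8 y\<^sup>4 - 33 x\<^sup>4 y\<^sup>8 + y\<^sup>1\<^sup>2 - (22 / \<surd>5) (x y (x\<^sup>4 - y\<^sup>4))\<^sup>2\<close>. Both parts are invariant under the binary tetrahedral
group; the coefficient \<open>- 22 / \<surd>5\<close> (rather than \<open>22 / \<surd>5\<close>) selects the icosahedral group given by even
permutations.\<close>
definition form_coeff :: "nat \<Rightarrow> complex" where
  "form_coeff = (\<lambda>_. 0)(12 := 1, 10 := - 22 / sqrt 5, 8 := -33, 6 := 44 / sqrt 5,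
      4 := -33, 2 := - 22 / sqrt 5, 0 := 1)"

text \<open>The partial derivative of the icosahedral form, \<open>i\<close> times by the first and \<open>j\<close> times by the second variable.\<close>
definition form :: "nat \<Rightarrow> nat \<Rightarrow> complex \<Rightarrow> complex \<Rightarrow> complex" where
  "form i j a b = (\<Sum>k\<le>12. form_coeff k * power_deriv i k a * power_deriv j (12 - k) b)"

lemma form_euler:
  "a * form (Suc i) j a b + b * form i (Suc j) a b = (12 - of_nat i - of_nat j) * form i j a b"
proof -
  have "a * (form_coeff k * power_deriv (Suc i) k a * power_deriv j (12 - k) b) +
        b * (form_coeff k * power_deriv i k a * power_deriv (Suc j) (12 - k) b) =
      (12 - of_nat i - of_nat j) * (form_coeff k * power_deriv i k a * power_deriv j (12 - k) b)"
    if "k \<le> 12" for k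
    using power_deriv_euler[of a i k] power_deriv_euler[of b j "12 - k"] that
    by (simp add: of_nat_diff) algebra
  then show ?thesis
    by (simp add: form_def sum_distrib_left flip: sum.distrib)
qed

lemma form_has_derivative [derivative_intros]:
  assumes "(p has_derivative p') (at x within S)" "(q has_derivative q') (at x within S)"
  shows "((\<lambda>x. form i j (p x) (q x)) has_derivative
     (\<lambda>h. p' h * form (Suc i) j (p x) (q x) + q' h * form i (Suc j) (p x) (q x))) (at x within S)"
proof -
  have P: "((\<lambda>x. power_deriv i k (p x)) has_derivative (\<lambda>h. power_deriv (Suc i) k (p x) * p' h)) (at x within S)"
    for i k by (rule has_derivative_compose[OF assms(1) power_deriv_has_derivative[unfolded has_field_derivative_def]])
  have Q: "((\<lambda>x. power_deriv i k (q x)) has_derivative (\<lambda>h. power_deriv (Suc i) k (q x) * q' h)) (at x within S)"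
    for i k by (rule has_derivative_compose[OF assms(2) power_deriv_has_derivative[unfolded has_field_derivative_def]])
  show ?thesis
    unfolding form_def
    by (auto intro!: derivative_eq_intros P Q simp: sum_distrib_left algebra_simps sum.distrib)
qed

lemma form_0_0:
  fixes a b :: complex
  shows "form 0 0 a b = a^12 - 33 * a^8 * b^4 - 33 * a^4 * b^8 + b^12
    - 22 / sqrt 5 * (a^10 * b^2 - 2 * a^6 * b^6 + a^2 * b^10)"
  by (simp add: form_def form_coeff_def power_deriv_def eval_nat_numeral algebra_simps)

lemma form_1_0:
  fixes a b :: complex
  shows "form 1 0 a b = 12 * a^11 - 264 * a^7 * b^4 - 132 * a^3 * b^8
    - 22 / sqrt 5 * (10 * a^9 * b^2 - 12 * a^5 * b^6 + 2 * a * b^10)"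
  by (simp add: form_def form_coeff_def power_deriv_def eval_nat_numeral algebra_simps)

lemma form_0_1:
  fixes a b :: complex
  shows "form 0 1 a b = 12 * b^11 - 264 * a^4 * b^7 - 132 * a^8 * b^3
    - 22 / sqrt 5 * (10 * a^2 * b^9 - 12 * a^6 * b^5 + 2 * a^10 * b)"
  by (simp add: form_def form_coeff_def power_deriv_def eval_nat_numeral algebra_simps)

lemma has_derivative_vec_nth' [derivative_intros]:
  assumes "(f has_derivative f') F" shows "((\<lambda>x. f x $ i) has_derivative (\<lambda>h. f' h $ i)) F"
  by (rule bounded_linear.has_derivative[OF bounded_linear_vec_nth assms])

text \<open>Iterated directional derivatives of \<^term>\<open>form i j\<close> in the directions of the list.\<close>
fun dform :: "(complex ^ 2) list \<Rightarrow> nat \<Rightarrow> nat \<Rightarrow> complex ^ 2 \<Rightarrow> complex" where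
  "dform [] i j z = form i j (z $ 1) (z $ 2)"
| "dform (v # vs) i j z = v $ 1 * dform vs (Suc i) j z + v $ 2 * dform vs i (Suc j) z"

lemma dform_has_derivative:
  "(dform vs i j has_derivative (\<lambda>v. dform (v # vs) i j z)) (at z)"
proof (induction vs arbitrary: i j)
  case Nil
  have "((\<lambda>z. form i j (z $ 1) (z $ 2)) has_derivative
      (\<lambda>v. v $ 1 * form (Suc i) j (z $ 1) (z $ 2) + v $ 2 * form i (Suc j) (z $ 1) (z $ 2))) (at z)"
    by (intro form_has_derivative has_derivative_vec_nth' has_derivative_ident)
  then show ?case by (simp only: dform.simps[abs_def])
next
  case (Cons u us)
  have "((\<lambda>z. u $ 1 * dform us (Suc i) j z + u $ 2 * dform us i (Suc j) z) has_derivative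
      (\<lambda>v. u $ 1 * dform (v # us) (Suc i) j z + u $ 2 * dform (v # us) i (Suc j) z)) (at z)"
    by (intro has_derivative_add has_derivative_mult_right Cons.IH)
  then show ?case
    by (simp add: algebra_simps)
qed

lemma dform_swap: "dform (u # v # vs) i j z = dform (v # u # vs) i j z"
  by (simp add: algebra_simps)

lemma dform_add: "dform ((u + v) # vs) i j z = dform (u # vs) i j z + dform (v # vs) i j z"
  by (simp add: algebra_simps)

lemma dform_scale: "dform ((c *s v) # vs) i j z = c * dform (v # vs) i j z"
  by (simp add: algebra_simps)

lemma dform_minus: "dform ((- v) # vs) i j z = - dform (v # vs) i j z"
  by simp

text \<open>Euler's identity: each directional derivative lowers the degree of homogeneity by one.\<close>
lemma dform_euler:
  "dform (z # vs) i j z = (12 - of_nat i - of_nat j - of_nat (length vs)) * dform vs i j z"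
proof (induction vs arbitrary: i j)
  case Nil
  show ?case using form_euler by simp
next
  case (Cons u us)
  have "dform (z # u # us) i j z = u $ 1 * dform (z # us) (Suc i) j z + u $ 2 * dform (z # us) i (Suc j) z"
    by (simp add: algebra_simps)
  also have "\<dots> = (12 - of_nat i - of_nat j - of_nat (length (u # us))) * dform (u # us) i j z"
    unfolding Cons.IH by (simp add: algebra_simps)
  finally show ?case .
qed

text \<open>The twelve zeros of the form are the vertices of the icosahedron. Pairing opposite vertices gives one quadratic
factor for each of the six axes.\<close>
lemma form_factorization:
  fixes a b :: complex
  defines "\<phi> \<equiv> complex_of_real golden_ratio"
  shows "form 0 0 a b = (1 - 2 * sqrt 5 / 5) *
     ((a\<^sup>2 - b\<^sup>2 + 2 * \<phi> * a * b) * (a\<^sup>2 - b\<^sup>2 - 2 * \<phi> * a * b)) *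
     ((a\<^sup>2 + b\<^sup>2 + \<i> * \<phi> * (a\<^sup>2 - b\<^sup>2)) * (a\<^sup>2 + b\<^sup>2 - \<i> * \<phi> * (a\<^sup>2 - b\<^sup>2))) *
     ((2 * a * b + \<i> * \<phi> * (a\<^sup>2 + b\<^sup>2)) * (2 * a * b - \<i> * \<phi> * (a\<^sup>2 + b\<^sup>2)))"
proof -
  define s where "s = complex_of_real (sqrt 5)"
  have s: "s * s = 5" unfolding s_def by (simp flip: of_real_mult)
  have "s \<noteq> 0" using s by auto
  have ds: "1 / s = s / 5" using s \<open>s \<noteq> 0\<close> by (simp add: field_simps)
  have f: "form 0 0 a b = a^12 - 33 * a^8 * b^4 - 33 * a^4 * b^8 + b^12
    - 22 * (1 / s) * (a^10 * b^2 - 2 * a^6 * b^6 + a^2 * b^10)"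
    unfolding form_0_0 s_def by simp
  have p: "2 * \<phi> - (1 + s) = 0" by (simp add: \<phi>_def s_def golden_ratio_def)
  have k: "complex_of_real (1 - 2 * sqrt 5 / 5) = (5 - 2 * s) / 5" by (simp add: s_def field_simps)
  have i: "\<i> * \<i> + 1 = 0" by simp
  have s0: "s * s - 5 = 0" using s by simp
  have pp: "2 * (\<phi> * \<phi>) - (3 + s) = 0"
  proof -
    have "2 * (2 * (\<phi> * \<phi>) - (3 + s)) = 0" using s0 p by algebra
    then show ?thesis by (simp only: mult_eq_0_iff) simp
  qed
  have 1: "(a\<^sup>2 - b\<^sup>2 + 2 * \<phi> * a * b) * (a\<^sup>2 - b\<^sup>2 - 2 * \<phi> * a * b)
      = (a\<^sup>2 - b\<^sup>2)\<^sup>2 - 2 * (3 + s) * a\<^sup>2 * b\<^sup>2" (is "?Q1 = ?R1")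
    using pp by algebra
  have 2: "2 * ((a\<^sup>2 + b\<^sup>2 + \<i> * \<phi> * (a\<^sup>2 - b\<^sup>2)) * (a\<^sup>2 + b\<^sup>2 - \<i> * \<phi> * (a\<^sup>2 - b\<^sup>2)))
      = 2 * (a\<^sup>2 + b\<^sup>2)\<^sup>2 + (3 + s) * (a\<^sup>2 - b\<^sup>2)\<^sup>2" (is "2 * ?Q2 = ?R2")
    using pp i by algebra
  have 3: "2 * ((2 * a * b + \<i> * \<phi> * (a\<^sup>2 + b\<^sup>2)) * (2 * a * b - \<i> * \<phi> * (a\<^sup>2 + b\<^sup>2)))
      = 8 * a\<^sup>2 * b\<^sup>2 + (3 + s) * (a\<^sup>2 + b\<^sup>2)\<^sup>2" (is "2 * ?Q3 = ?R3")
    using pp i by algebra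
  have "20 * form 0 0 a b = 20 * (a^12 - 33 * a^8 * b^4 - 33 * a^4 * b^8 + b^12)
      - 88 * s * (a^10 * b\<^sup>2 - 2 * a^6 * b^6 + a\<^sup>2 * b^10)"
    unfolding f ds by (simp add: algebra_simps)
  also have "\<dots> = (5 - 2 * s) * ?R1 * ?R2 * ?R3"
    using s0 by algebra
  also have "\<dots> = 20 * ((5 - 2 * s) / 5 * ?Q1 * ?Q2 * ?Q3)"
    unfolding 1[symmetric] 2[symmetric] 3[symmetric] by simp
  finally show ?thesis unfolding k by (simp only: mult_cancel_left) simp
qed

text \<open>For \<open>i\<close> and \<open>j\<close> the invariance is visible on the monomials. The other two generators permute the six quadratic
factors up to units whose product is 1.\<close>
lemma form_0_0_icosian:
  assumes "q \<in> unit_icosians"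
  shows "form 0 0 ((quaternion_matrix q *v z) $ 1) ((quaternion_matrix q *v z) $ 2) = form 0 0 (z $ 1) (z $ 2)"
  using assms
proof (induction arbitrary: z rule: unit_icosian_induct)
  case one
  show ?case by (simp add: quaternion_matrix_one)
next
  case (step g x)
  define \<phi> where "\<phi> = complex_of_real golden_ratio"
  have p: "\<phi> * \<phi> - (\<phi> + 1) = 0"
  proof -
    have "golden_ratio * golden_ratio = golden_ratio + 1"
      by (simp add: golden_ratio_def field_simps)
    then show ?thesis unfolding \<phi>_def by (metis of_real_1 of_real_add of_real_mult diff_self)
  qed
  have inv: "1 / (2 * golden_ratio) = (golden_ratio - 1) / 2"
  proof -
    have "golden_ratio * golden_ratio = golden_ratio + 1" "golden_ratio > 0"
      by (simp_all add: golden_ratio_def field_simps add_pos_nonneg)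
    then show ?thesis by (simp add: field_simps)
  qed
  have i: "\<i> * \<i> + 1 = 0" by simp
  have gen: "form 0 0 ((quaternion_matrix g *v y) $ 1) ((quaternion_matrix g *v y) $ 2) = form 0 0 (y $ 1) (y $ 2)" for y
  proof -
    define a b where "a = y $ 1" and "b = y $ 2"
    from \<open>g \<in> icosian_generators\<close> consider "g = quat 0 1 0 0" | "g = quat 0 0 1 0"
      | "g = quat (1/2) (1/2) (1/2) (1/2)" | "g = quat (golden_ratio / 2) (1/2) 0 (1 / (2 * golden_ratio))"
      unfolding icosian_generators_def by blast
    then show ?thesis
    proof cases
      case 1
      have I: "Complex 0 1 = \<i>" "Complex 0 0 = 0" by (simp_all add: complex_eq_iff)
      have pow: "\<i> ^ 12 = 1" "\<i> ^ 8 = 1" "\<i> ^ 4 = 1" "\<i> ^ 10 = -1" "\<i> ^ 6 = -1" "\<i>\<^sup>2 = -1"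
        by (simp_all add: eval_nat_numeral)
      show ?thesis
        unfolding 1 quaternion_matrix_nth form_0_0 by (simp add: I power_mult_distrib pow)
    next
      case 2
      have I: "Complex 0 0 = 0" "Complex 1 0 = 1" by (simp_all add: complex_eq_iff)
      show ?thesis
        unfolding 2 quaternion_matrix_nth form_0_0 by (simp add: I algebra_simps)
    next
      case 3
      define c where "c = (a + b + \<i> * (a + b)) / 2"
      define d where "d = (- (a - b) + \<i> * (a - b)) / 2"
      have cd: "(quaternion_matrix g *v y) $ 1 = c" "(quaternion_matrix g *v y) $ 2 = d"
        unfolding 3 quaternion_matrix_nth a_def b_def c_def d_def
        by (simp_all add: complex_eq_iff field_simps)
      have c2: "2 * c - (a + b + \<i> * (a + b)) = 0" and d2: "2 * d - (- (a - b) + \<i> * (a - b)) = 0"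
        by (simp_all add: c_def d_def)
      have "4 * (c\<^sup>2 - d\<^sup>2) = 4 * (\<i> * (a\<^sup>2 + b\<^sup>2))" "4 * (c\<^sup>2 + d\<^sup>2) = 4 * (2 * \<i> * a * b)"
        "4 * (2 * (c * d)) = 4 * (- (a\<^sup>2 - b\<^sup>2))"
        using c2 d2 i by algebra+
      then have e: "c\<^sup>2 - d\<^sup>2 = \<i> * (a\<^sup>2 + b\<^sup>2)" "c\<^sup>2 + d\<^sup>2 = 2 * \<i> * a * b" "2 * (c * d) = - (a\<^sup>2 - b\<^sup>2)"
        by (simp_all only: mult_cancel_left) simp_all
      have "2 * \<phi> * c * d = \<phi> * (2 * (c * d))" "2 * c * d = 2 * (c * d)" by simp_all
      then have e': "2 * \<phi> * c * d = \<phi> * (- (a\<^sup>2 - b\<^sup>2))" "2 * c * d = - (a\<^sup>2 - b\<^sup>2)" unfolding e(3) .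
      show ?thesis
        unfolding cd a_def[symmetric] b_def[symmetric] form_factorization \<phi>_def[symmetric] e e'
        using i by algebra
    next
      case 4
      define c where "c = (\<phi> * a + \<i> * (a + (\<phi> - 1) * b)) / 2"
      define d where "d = (\<phi> * b + \<i> * ((\<phi> - 1) * a - b)) / 2"
      have cd: "(quaternion_matrix g *v y) $ 1 = c" "(quaternion_matrix g *v y) $ 2 = d"
        unfolding 4 quaternion_matrix_nth a_def b_def c_def d_def inv \<phi>_def
        by (simp_all add: complex_eq_iff field_simps)
      have c2: "2 * c - (\<phi> * a + \<i> * (a + (\<phi> - 1) * b)) = 0" and d2: "2 * d - (\<phi> * b + \<i> * ((\<phi> - 1) * a - b)) = 0"
        by (simp_all add: c_def d_def)
      have "4 * (c\<^sup>2 - d\<^sup>2 + 2 * \<phi> * c * d) = 4 * (2 * a * b + \<i> * \<phi> * (a\<^sup>2 + b\<^sup>2))"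
        "4 * (c\<^sup>2 - d\<^sup>2 - 2 * \<phi> * c * d) = 4 * (a\<^sup>2 - b\<^sup>2 - 2 * \<phi> * a * b)"
        "4 * (c\<^sup>2 + d\<^sup>2 + \<i> * \<phi> * (c\<^sup>2 - d\<^sup>2)) = 4 * (- (a\<^sup>2 + b\<^sup>2 - \<i> * \<phi> * (a\<^sup>2 - b\<^sup>2)))"
        "4 * (c\<^sup>2 + d\<^sup>2 - \<i> * \<phi> * (c\<^sup>2 - d\<^sup>2)) = 4 * (\<i> * (2 * a * b - \<i> * \<phi> * (a\<^sup>2 + b\<^sup>2)))"
        "4 * (2 * c * d + \<i> * \<phi> * (c\<^sup>2 + d\<^sup>2)) = 4 * (\<i> * (a\<^sup>2 + b\<^sup>2 + \<i> * \<phi> * (a\<^sup>2 - b\<^sup>2)))"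
        "4 * (2 * c * d - \<i> * \<phi> * (c\<^sup>2 + d\<^sup>2)) = 4 * (a\<^sup>2 - b\<^sup>2 + 2 * \<phi> * a * b)"
        using c2 d2 i p by algebra+
      then have e: "c\<^sup>2 - d\<^sup>2 + 2 * \<phi> * c * d = 2 * a * b + \<i> * \<phi> * (a\<^sup>2 + b\<^sup>2)"
        "c\<^sup>2 - d\<^sup>2 - 2 * \<phi> * c * d = a\<^sup>2 - b\<^sup>2 - 2 * \<phi> * a * b"
        "c\<^sup>2 + d\<^sup>2 + \<i> * \<phi> * (c\<^sup>2 - d\<^sup>2) = - (a\<^sup>2 + b\<^sup>2 - \<i> * \<phi> * (a\<^sup>2 - b\<^sup>2))"
        "c\<^sup>2 + d\<^sup>2 - \<i> * \<phi> * (c\<^sup>2 - d\<^sup>2) = \<i> * (2 * a * b - \<i> * \<phi> * (a\<^sup>2 + b\<^sup>2))"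
        "2 * c * d + \<i> * \<phi> * (c\<^sup>2 + d\<^sup>2) = \<i> * (a\<^sup>2 + b\<^sup>2 + \<i> * \<phi> * (a\<^sup>2 - b\<^sup>2))"
        "2 * c * d - \<i> * \<phi> * (c\<^sup>2 + d\<^sup>2) = a\<^sup>2 - b\<^sup>2 + 2 * \<phi> * a * b"
        by (simp_all only: mult_cancel_left) simp_all
      show ?thesis
        unfolding cd a_def[symmetric] b_def[symmetric] form_factorization \<phi>_def[symmetric] e
        using i by algebra
    qed
  qed
  show ?case
    unfolding quaternion_matrix_qmul matrix_vector_mul_assoc[symmetric] gen step.IH ..
qed

text \<open>Differentiate the invariance of the form; the chain rule moves the group element to the directions.\<close>
lemma dform_binary_icosahedral:
  assumes A: "A \<in> binary_icosahedral"
  shows "dform (map ((*v) A) vs) 0 0 (A *v z) = dform vs 0 0 z"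
proof (induction vs arbitrary: z)
  case Nil
  then show ?case using A form_0_0_icosian unfolding binary_icosahedral_def by auto
next
  case (Cons u us)
  let ?L = "\<lambda>z. dform (map ((*v) A) us) 0 0 (A *v z)"
  have "(?L has_derivative (\<lambda>v. dform ((A *v v) # map ((*v) A) us) 0 0 (A *v z))) (at z)"
    by (rule has_derivative_compose[OF bounded_linear_imp_has_derivative dform_has_derivative])
      (rule matrix_vector_mul_bounded_linear)
  moreover have "(?L has_derivative (\<lambda>v. dform (v # us) 0 0 z)) (at z)"
    unfolding Cons.IH by (rule dform_has_derivative)
  ultimately have "(\<lambda>v. dform ((A *v v) # map ((*v) A) us) 0 0 (A *v z)) = (\<lambda>v. dform (v # us) 0 0 z)"
    by (rule has_derivative_unique)
  then show ?case by (metis list.simps(9))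
qed

section \<open>The function and its critical points\<close>

lemma J_add: "J (u + v) = J u + J v" by (simp add: vec2_eq_iff)

lemma J_scale: "J (c *s v) = cnj c *s J v" by (simp add: vec2_eq_iff)

lemma J_scaleR: "J (r *\<^sub>R v) = r *\<^sub>R J v" by (simp add: vec2_eq_iff)

lemma J_J: "J (J v) = - v" by (simp add: vec2_eq_iff)

lemma has_derivative_J [derivative_intros]:
  assumes "(f has_derivative f') F" shows "((\<lambda>x. J (f x)) has_derivative (\<lambda>h. J (f' h))) F"
proof -
  have "linear J" by (rule linearI) (simp_all add: J_add J_scaleR)
  then have "bounded_linear J" by (simp add: linear_conv_bounded_linear)
  then show ?thesis using assms by (rule bounded_linear.has_derivative)
qed

text \<open>Under \<open>z \<mapsto> l z\<close> with \<open>|l| = 1\<close> this function is multiplied by \<open>l\<^sup>1\<^sup>2\<^sup>-\<^sup>2\<^sup>m\<close>; see \<open>phi_scale\<close>.\<close>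
definition phi :: "nat \<Rightarrow> complex ^ 2 \<Rightarrow> complex" where
  "phi m z = dform (replicate m (J z)) 0 0 z"

lemma phi_simps: "phi 0 z = dform [] 0 0 z" "phi 1 z = dform [J z] 0 0 z" "phi (Suc 0) z = dform [J z] 0 0 z"
  "phi 2 z = dform [J z, J z] 0 0 z" "phi 3 z = dform [J z, J z, J z] 0 0 z"
  by (simp_all add: phi_def numeral_2_eq_2 numeral_3_eq_3 del: dform.simps)

lemma phi_binary_icosahedral:
  assumes "A \<in> binary_icosahedral" shows "phi m (A *v z) = phi m z"
  using dform_binary_icosahedral[OF assms, of "replicate m (J z)" z]
  by (simp add: phi_def binary_icosahedral_J[OF assms])

definition morse_lift :: "complex ^ 2 \<Rightarrow> real" where
  "morse_lift z = Re (phi 1 z)"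

definition dphi1 :: "complex ^ 2 \<Rightarrow> complex ^ 2 \<Rightarrow> complex" where
  "dphi1 z v = dform [v, J z] 0 0 z + dform [J v] 0 0 z"

definition ddphi1 :: "complex ^ 2 \<Rightarrow> complex ^ 2 \<Rightarrow> complex ^ 2 \<Rightarrow> complex" where
  "ddphi1 z w v = dform [w, v, J z] 0 0 z + dform [v, J w] 0 0 z + dform [w, J v] 0 0 z"

lemma phi1_has_derivative: "(phi 1 has_derivative dphi1 z) (at z)"
proof -
  have "((\<lambda>z. J z $ 1 * dform [] 1 0 z + J z $ 2 * dform [] 0 1 z) has_derivative
      (\<lambda>v. (J z $ 1 * dform [v] 1 0 z + J v $ 1 * dform [] 1 0 z) +
           (J z $ 2 * dform [v] 0 1 z + J v $ 2 * dform [] 0 1 z))) (at z)"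
    by (intro has_derivative_add has_derivative_mult has_derivative_vec_nth' has_derivative_J
        has_derivative_ident dform_has_derivative)
  then show ?thesis
    by (simp add: phi_simps[abs_def] fun_eq_iff dphi1_def[abs_def] algebra_simps)
qed

lemma dphi1_has_derivative: "((\<lambda>z. dphi1 z v) has_derivative (\<lambda>w. ddphi1 z w v)) (at z)"
proof -
  have "((\<lambda>z. (J z $ 1 * dform [v] 1 0 z + J z $ 2 * dform [v] 0 1 z) + dform [J v] 0 0 z) has_derivative
      (\<lambda>w. ((J z $ 1 * dform [w, v] 1 0 z + J w $ 1 * dform [v] 1 0 z) +
           (J z $ 2 * dform [w, v] 0 1 z + J w $ 2 * dform [v] 0 1 z)) + dform [w, J v] 0 0 z)) (at z)"
    by (intro has_derivative_add has_derivative_mult has_derivative_vec_nth' has_derivative_J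
        has_derivative_ident dform_has_derivative)
  then show ?thesis
    by (simp add: fun_eq_iff dphi1_def[abs_def] ddphi1_def[abs_def] algebra_simps)
qed

lemma linear_Re_ddphi1: "linear (\<lambda>v. Re (ddphi1 z w v))"
  by (rule linearI) (simp_all add: ddphi1_def J_add J_scaleR algebra_simps)

interpretation morse_lift: twice_differentiable morse_lift "\<lambda>z v. Re (dphi1 z v)" "\<lambda>z w v. Re (ddphi1 z w v)"
proof (rule twice_differentiable.intro)
  show "(morse_lift has_derivative (\<lambda>v. Re (dphi1 x v))) (at x)" for x
    unfolding morse_lift_def[abs_def] by (rule has_derivative_Re[OF phi1_has_derivative])
  show "((\<lambda>y. Re (dphi1 y v)) has_derivative (\<lambda>w. Re (ddphi1 x w v))) (at x)" for x v
    by (rule has_derivative_Re[OF dphi1_has_derivative])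
  show "linear (\<lambda>v. Re (ddphi1 x w v))" for x w by (rule linear_Re_ddphi1)
qed

lemma dphi1_scale_self: "dphi1 z (c *s z) = (11 * c + cnj c) * phi 1 z"
  by (simp add: dphi1_def dform_scale dform_euler J_scale phi_simps algebra_simps del: dform.simps)

lemma dphi1_J: "dphi1 z (t *s J z) = t * phi 2 z - 12 * cnj t * phi 0 z"
  by (simp add: dphi1_def dform_scale dform_euler J_scale J_J dform_minus phi_simps del: dform.simps)

lemma dphi1_add: "dphi1 z (u + v) = dphi1 z u + dphi1 z v"
  by (simp add: dphi1_def dform_add J_add del: dform.simps)

lemma dphi1_self: "dphi1 z z = 12 * phi 1 z"
  using dphi1_scale_self[of z 1] by simp

lemma ddphi1_self: "ddphi1 z z z = 132 * phi 1 z"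
  by (simp add: ddphi1_def dform_euler phi_simps del: dform.simps)

text \<open>In complex coordinates the Laplacian is four times the sum, over the two variables, of the second derivative by the
variable and its conjugate. For \<open>phi 1\<close> the two summands are the mixed partial derivatives of the form, with opposite signs.\<close>
lemma laplacian_morse_lift: "(\<Sum>b\<in>Basis. Re (ddphi1 z b b)) = 0"
proof -
  have B: "(Basis :: (complex ^ 2) set) = {axis 1 1, axis 1 \<i>, axis 2 1, axis 2 \<i>}"
    by (auto simp: Basis_vec_def UNIV_2 Basis_complex_def)
  have ne: "axis 1 1 \<noteq> (axis 1 \<i> :: complex ^ 2)" "axis 1 1 \<noteq> (axis 2 1 :: complex ^ 2)"
    "axis 1 1 \<noteq> (axis 2 \<i> :: complex ^ 2)" "axis 1 \<i> \<noteq> (axis 2 1 :: complex ^ 2)"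
    "axis 1 \<i> \<noteq> (axis 2 \<i> :: complex ^ 2)" "axis 2 1 \<noteq> (axis 2 \<i> :: complex ^ 2)"
    by (simp_all add: axis_eq_axis complex_eq_iff)
  have nth: "(axis 1 c :: complex ^ 2) $ 1 = c" "(axis 1 c :: complex ^ 2) $ 2 = 0"
     "(axis 2 c :: complex ^ 2) $ 1 = 0" "(axis 2 c :: complex ^ 2) $ 2 = c" for c
    by (simp_all add: axis_def)
  show ?thesis unfolding B using ne by (simp add: ddphi1_def nth)
qed

lemma laplace_beltrami_morse_lift: "z \<in> S3 \<Longrightarrow> laplace_beltrami morse_lift z = 168 * morse_lift z"
  by (simp add: morse_lift.laplace_beltrami laplacian_morse_lift ddphi1_self dphi1_self morse_lift_def)

lemma inner_complex2: "(v :: complex ^ 2) \<bullet> w = Re (v $ 1 * cnj (w $ 1)) + Re (v $ 2 * cnj (w $ 2))"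
  by (simp add: inner_vec_def sum_2 inner_complex_def)

lemma S3_iff: "z \<in> S3 \<longleftrightarrow> z $ 1 * cnj (z $ 1) + z $ 2 * cnj (z $ 2) = 1"
proof -
  have "complex_of_real (norm z ^ 2) = z $ 1 * cnj (z $ 1) + z $ 2 * cnj (z $ 2)"
    unfolding norm_complex2 by (simp only: of_real_add complex_norm_square)
  moreover have "z \<in> S3 \<longleftrightarrow> complex_of_real (norm z ^ 2) = 1"
    by (simp add: abs_square_eq_1 flip: of_real_power)
  ultimately show ?thesis by simp
qed

text \<open>The vectors \<open>i z\<close>, \<open>J z\<close> and \<open>i J z\<close> are an orthonormal basis of the tangent space; \<open>i z\<close> points along the Hopf fibre.\<close>
lemma tangent_space_eq:
  assumes "z \<in> S3"
  shows "tangent_space z = {(\<i> * of_real a) *s z + t *s J z | a t. True}"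
proof (intro set_eqI iffI)
  have n: "z $ 1 * cnj (z $ 1) + z $ 2 * cnj (z $ 2) - 1 = 0" using assms unfolding S3_iff by simp
  fix v assume "v \<in> tangent_space z"
  define c where "c = v $ 1 * cnj (z $ 1) + v $ 2 * cnj (z $ 2)"
  define t where "t = v $ 2 * z $ 1 - v $ 1 * z $ 2"
  have "Re c = 0" using \<open>v \<in> tangent_space z\<close> by (simp add: c_def tangent_space_def inner_complex2)
  then have c: "c = \<i> * of_real (Im c)" by (simp add: complex_eq_iff)
  have "v $ 1 = c * z $ 1 + t * - cnj (z $ 2)" "v $ 2 = c * z $ 2 + t * cnj (z $ 1)"
    unfolding c_def t_def using n by algebra+
  then have "v = (\<i> * of_real (Im c)) *s z + t *s J z" using c by (simp add: vec2_eq_iff)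
  then show "v \<in> {(\<i> * of_real a) *s z + t *s J z | a t. True}" by blast
next
  fix v assume "v \<in> {(\<i> * of_real a) *s z + t *s J z | a t. True}"
  then show "v \<in> tangent_space z"
    by (auto simp: tangent_space_def inner_complex2 algebra_simps)
qed

text \<open>The derivative along the fibre is \<open>Re (10 i a phi 1)\<close>, which gives the first condition, and the derivative in the direction
\<open>t J z\<close> vanishes for all complex \<open>t\<close> iff the second one holds.\<close>
lemma critical_morse_lift:
  assumes z: "z \<in> S3"
  shows "critical_at morse_lift z \<longleftrightarrow> Im (phi 1 z) = 0 \<and> phi 2 z = 12 * cnj (phi 0 z)"
proof -
  have d: "dphi1 z ((\<i> * of_real a) *s z + t *s J z) =
      10 * \<i> * of_real a * phi 1 z + t * phi 2 z - 12 * cnj t * phi 0 z" for a t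
    by (simp add: dphi1_add dphi1_scale_self dphi1_J algebra_simps)
  have "critical_at morse_lift z \<longleftrightarrow> (\<forall>a t. Re (10 * \<i> * of_real a * phi 1 z + t * phi 2 z - 12 * cnj t * phi 0 z) = 0)"
    unfolding morse_lift.critical_at[OF z] tangent_space_eq[OF z] d[symmetric] by blast
  also have "\<dots> \<longleftrightarrow> Im (phi 1 z) = 0 \<and> phi 2 z = 12 * cnj (phi 0 z)"
  proof
    assume *: "\<forall>a t. Re (10 * \<i> * of_real a * phi 1 z + t * phi 2 z - 12 * cnj t * phi 0 z) = 0"
    show "Im (phi 1 z) = 0 \<and> phi 2 z = 12 * cnj (phi 0 z)"
      using *[rule_format, of 1 0] *[rule_format, of 0 1] *[rule_format, of 0 \<i>]
      by (simp add: complex_eq_iff)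
  next
    assume "Im (phi 1 z) = 0 \<and> phi 2 z = 12 * cnj (phi 0 z)"
    then show "\<forall>a t. Re (10 * \<i> * of_real a * phi 1 z + t * phi 2 z - 12 * cnj t * phi 0 z) = 0"
      by (simp add: algebra_simps)
  qed
  finally show ?thesis .
qed

lemma dform_diff: "dform ((u - v) # vs) i j z = dform (u # vs) i j z - dform (v # vs) i j z"
  by (simp add: algebra_simps)

lemma dform_second:
  "dform (u # (v + w) # vs) i j z = dform (u # v # vs) i j z + dform (u # w # vs) i j z"
  "dform (u # (v - w) # vs) i j z = dform (u # v # vs) i j z - dform (u # w # vs) i j z"
  "dform (u # (c *s v) # vs) i j z = c * dform (u # v # vs) i j z"
  "dform (u # (- v) # vs) i j z = - dform (u # v # vs) i j z"
  by (simp_all add: algebra_simps)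

text \<open>Let \<open>i a z + t J z\<close> lie in the kernel of the Hessian. Pairing with \<open>i z\<close> determines \<open>a\<close> by \<open>t\<close>. Pairing with \<open>s J z\<close> for all
complex \<open>s\<close> and eliminating \<open>a\<close> leaves an equation \<open>t A = cnj t B\<close>, where \<open>A\<close> and \<open>B\<close> are the two expressions in the last
assumption. If their absolute values differ, then \<open>t = 0\<close>.\<close>
lemma nondegenerate_morse_lift:
  assumes z: "z \<in> S3" and crit: "critical_at morse_lift z" and ne: "phi 1 z \<noteq> 0"
    and disc: "cmod (phi 1 z * phi 3 z - 288 * (cnj (phi 0 z))\<^sup>2)
        \<noteq> cmod (34 * (phi 1 z)\<^sup>2 - 288 * (phi 0 z * cnj (phi 0 z)))"
  shows "nondegenerate_at morse_lift z"
  unfolding nondegenerate_at_def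
proof (intro ballI impI)
  fix v assume v: "v \<in> tangent_space z"
    and ker: "\<forall>w\<in>tangent_space z. sphere_hessian morse_lift z v w = 0"
  obtain a t where vat: "v = (\<i> * of_real a) *s z + t *s J z"
    using v unfolding tangent_space_eq[OF z] by blast
  define f where "f = phi 0 z"
  define r where "r = Re (phi 1 z)"
  have p1: "phi 1 z = of_real r" and p2: "phi 2 z = 12 * cnj f"
    using crit unfolding critical_morse_lift[OF z] by (simp_all add: r_def f_def complex_eq_iff)
  have r: "r \<noteq> 0" using ne p1 by auto
  have n: "z $ 1 * cnj (z $ 1) + z $ 2 * cnj (z $ 2) = 1" using z unfolding S3_iff by simp
  note ds = ddphi1_def dform_add dform_scale J_add J_scale J_J dform_minus dform_euler
    dform_swap[of _ z "[]"] dform_swap[of _ z "[_]"] dform_second dform_diff p1 p1[unfolded One_nat_def] p2[unfolded f_def]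
  have hess: "Re (ddphi1 z v w) - 12 * r * (v \<bullet> w) = 0" if "w \<in> tangent_space z" for w
    using ker that morse_lift.sphere_hessian[OF z v that] by (simp add: dphi1_self p1[unfolded One_nat_def])
  have w1: "\<i> *s z \<in> tangent_space z"
    unfolding tangent_space_eq[OF z] by (rule CollectI, rule exI[of _ 1], rule exI[of _ 0]) (simp add: vec2_eq_iff)
  have w2: "s *s J z \<in> tangent_space z" for s
    unfolding tangent_space_eq[OF z] by (rule CollectI, rule exI[of _ 0], rule exI[of _ s]) (simp add: vec2_eq_iff)
  have q1: "ddphi1 z v (\<i> *s z) = - 88 * a * r + \<i> * (9 * t * phi 2 z - 132 * cnj t * f)"
    unfolding vat phi_simps f_def
    by (simp add: ds phi_simps[symmetric] algebra_simps del: dform.simps)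
  have q2: "v \<bullet> (\<i> *s z) = a"
  proof -
    have "v \<bullet> (\<i> *s z) = Re (a * (z $ 1 * cnj (z $ 1) + z $ 2 * cnj (z $ 2)))"
      unfolding vat inner_complex2 by (simp add: algebra_simps)
    then show ?thesis unfolding n by simp
  qed
  \<comment> \<open>the equation that determines \<open>a\<close>\<close>
  have e1: "100 * r * a = - 240 * Im (t * cnj f)"
    using hess[OF w1, unfolded q1 q2 p2] by (simp add: algebra_simps)
  \<comment> \<open>the pairing with \<open>s J z\<close> is \<open>Re (s E)\<close>\<close>
  define E where "E = 240 * \<i> * a * cnj f + t * phi 3 z - 34 * r * cnj t"
  have "Re (s * E) = 0" for s
  proof -
    have q3: "ddphi1 z v (s *s J z) = s * (108 * \<i> * a * cnj f + t * phi 3 z - 11 * cnj t * r)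
        - 11 * cnj s * (12 * \<i> * a * f + t * r)"
      unfolding vat phi_simps f_def
      by (simp add: ds phi_simps[symmetric] algebra_simps del: dform.simps)
    have q4: "v \<bullet> (s *s J z) = Re (t * cnj s)"
    proof -
      have "v \<bullet> (s *s J z) = Re (t * cnj s * (z $ 1 * cnj (z $ 1) + z $ 2 * cnj (z $ 2)))"
        unfolding vat inner_complex2 by (simp add: algebra_simps)
      then show ?thesis unfolding n by simp
    qed
    show ?thesis using hess[OF w2[of s], unfolded q3 q4] by (simp add: E_def algebra_simps)
  qed
  from this[of 1] this[of \<i>] have "E = 0" by (simp add: complex_eq_iff)
  have "complex_of_real (100 * r * a) = of_real (- 240 * Im (t * cnj f))" using e1 by simp
  also have "\<dots> = 120 * \<i> * (t * cnj f - cnj t * f)" by (simp add: complex_eq_iff)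
  finally have ra: "100 * (of_real r * of_real a) = 120 * \<i> * (t * cnj f - cnj t * f)" by simp
  define R A f' t' p3 where "R = complex_of_real r" and "A = complex_of_real a" and "f' = cnj f" and "t' = cnj t"
    and "p3 = phi 3 z"
  have h1: "100 * (R * A) - 120 * \<i> * (t * f' - t' * f) = 0" using ra by (simp add: R_def A_def f'_def t'_def)
  have h2: "240 * \<i> * A * f' + t * p3 - 34 * R * t' = 0"
    using \<open>E = 0\<close> by (simp add: E_def R_def A_def f'_def t'_def p3_def)
  have h3: "\<i> * \<i> + 1 = 0" by simp
  have "100 * (t * (R * p3 - 288 * f'\<^sup>2) - t' * (34 * R\<^sup>2 - 288 * (f * f'))) = 0"
    using h1 h2 h3 by algebra
  then have "t * (phi 1 z * phi 3 z - 288 * (cnj (phi 0 z))\<^sup>2)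
      = cnj t * (34 * (phi 1 z)\<^sup>2 - 288 * (phi 0 z * cnj (phi 0 z)))"
    unfolding p1 by (simp add: R_def f'_def t'_def p3_def f_def)
  then have "cmod t * cmod (phi 1 z * phi 3 z - 288 * (cnj (phi 0 z))\<^sup>2)
      = cmod t * cmod (34 * (phi 1 z)\<^sup>2 - 288 * (phi 0 z * cnj (phi 0 z)))"
    by (metis complex_mod_cnj norm_mult)
  then have "t = 0" using disc by simp
  then have "a = 0" using e1 r by simp
  then show "v = 0" using \<open>t = 0\<close> vat by (simp add: vec2_eq_iff)
qed

section \<open>Smoothness\<close>

text \<open>Polynomial functions are closed under directional derivatives, which makes them smooth in every order at once.\<close>
lemma real_polynomial_function_derivative:
  fixes p :: "'a::euclidean_space \<Rightarrow> real"
  assumes "real_polynomial_function p"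
  shows "\<exists>p'. \<forall>x. (p has_derivative p' x) (at x) \<and> (\<forall>v. real_polynomial_function (\<lambda>x. p' x v))"
  using assms
proof induction
  case (linear f)
  then show ?case
    by (intro exI[of _ "\<lambda>_. f"]) (auto intro: bounded_linear_imp_has_derivative real_polynomial_function.intros(2))
next
  case (const c)
  show ?case
    by (intro exI[of _ "\<lambda>_ _. 0"]) (auto intro: real_polynomial_function.intros(2))
next
  case (add f g)
  then obtain f' g' where "\<And>x. (f has_derivative f' x) (at x)" "\<And>v. real_polynomial_function (\<lambda>x. f' x v)"
    "\<And>x. (g has_derivative g' x) (at x)" "\<And>v. real_polynomial_function (\<lambda>x. g' x v)" by metis
  then show ?case
    by (intro exI[of _ "\<lambda>x v. f' x v + g' x v"]) (auto intro: has_derivative_add real_polynomial_function.intros(3))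
next
  case (mult f g)
  then obtain f' g' where "\<And>x. (f has_derivative f' x) (at x)" "\<And>v. real_polynomial_function (\<lambda>x. f' x v)"
    "\<And>x. (g has_derivative g' x) (at x)" "\<And>v. real_polynomial_function (\<lambda>x. g' x v)" by metis
  then show ?case
    by (intro exI[of _ "\<lambda>x v. f x * g' x v + f' x v * g x"])
      (auto intro!: has_derivative_mult real_polynomial_function.intros(3) real_polynomial_function.intros(4) mult.hyps)
qed

lemma real_polynomial_function_C_k:
  "real_polynomial_function p \<Longrightarrow> C_k_on k UNIV p"
proof (induction k arbitrary: p)
  case 0
  then show ?case
    by (auto intro!: continuous_at_imp_continuous_on continuous_real_polymonial_function)
next
  case (Suc k)
  obtain p' where p': "\<And>x. (p has_derivative p' x) (at x)" "\<And>v. real_polynomial_function (\<lambda>x. p' x v)"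
    using real_polynomial_function_derivative[OF Suc.prems] by metis
  have "frechet_derivative p (at x) = p' x" for x
    using frechet_derivative_at[OF p'(1)] by simp
  then show ?case
    using p' Suc.IH by (auto simp: differentiable_on_def differentiable_def)
qed

definition complex_polynomial :: "(complex ^ 2 \<Rightarrow> complex) \<Rightarrow> bool" where
  "complex_polynomial h \<longleftrightarrow>
     real_polynomial_function (\<lambda>z. Re (h z)) \<and> real_polynomial_function (\<lambda>z. Im (h z))"

lemma complex_polynomial_const: "complex_polynomial (\<lambda>_. c)"
  by (simp add: complex_polynomial_def real_polynomial_function.intros(2))

lemma complex_polynomial_add:
  "complex_polynomial f \<Longrightarrow> complex_polynomial g \<Longrightarrow> complex_polynomial (\<lambda>z. f z + g z)"
  by (simp add: complex_polynomial_def real_polynomial_function.intros(3))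

lemma complex_polynomial_mult:
  "complex_polynomial f \<Longrightarrow> complex_polynomial g \<Longrightarrow> complex_polynomial (\<lambda>z. f z * g z)"
  by (simp add: complex_polynomial_def real_polynomial_function.intros(3) real_polynomial_function.intros(4)
      real_polynomial_function_diff)

lemma complex_polynomial_power: "complex_polynomial f \<Longrightarrow> complex_polynomial (\<lambda>z. f z ^ n)"
  by (induction n) (simp_all add: complex_polynomial_const complex_polynomial_mult)

lemma complex_polynomial_sum:
  "(\<And>k. k \<in> I \<Longrightarrow> complex_polynomial (f k)) \<Longrightarrow> complex_polynomial (\<lambda>z. \<Sum>k\<in>I. f k z)"
  by (induction I rule: infinite_finite_induct)
    (auto intro: complex_polynomial_const complex_polynomial_add)

lemma complex_polynomial_nth: "complex_polynomial (\<lambda>z. z $ i)"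
  unfolding complex_polynomial_def
  by (intro conjI real_polynomial_function.intros(1) bounded_linear_compose[OF bounded_linear_Re]
      bounded_linear_compose[OF bounded_linear_Im] bounded_linear_vec_nth)

lemma complex_polynomial_J: "complex_polynomial (\<lambda>z. J z $ i)"
proof -
  have "complex_polynomial (\<lambda>z. cnj (z $ j))" for j
    using complex_polynomial_nth[of j]
    by (auto simp: complex_polynomial_def intro: real_polynomial_function_minus)
  moreover from this have "complex_polynomial (\<lambda>z. (-1) * cnj (z $ j))" for j
    by (intro complex_polynomial_mult complex_polynomial_const)
  ultimately show ?thesis using exhaust_2[of i] by auto
qed

lemma complex_polynomial_form: "complex_polynomial (\<lambda>z. form i j (z $ 1) (z $ 2))"
  unfolding form_def power_deriv_def
  by (intro complex_polynomial_sum complex_polynomial_mult complex_polynomial_const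
      complex_polynomial_power complex_polynomial_nth)

lemma smooth_morse_lift: "smooth_S3 morse_lift"
proof -
  have "complex_polynomial (\<lambda>z. J z $ 1 * form (Suc 0) 0 (z $ 1) (z $ 2) + J z $ 2 * form 0 (Suc 0) (z $ 1) (z $ 2))"
    by (intro complex_polynomial_add complex_polynomial_mult complex_polynomial_J complex_polynomial_form)
  then have "real_polynomial_function morse_lift"
    unfolding complex_polynomial_def morse_lift_def[abs_def] phi_simps dform.simps by blast
  then have "C_k_on k UNIV morse_lift" for k by (rule real_polynomial_function_C_k)
  then show ?thesis unfolding smooth_S3_def by blast
qed

section \<open>Critical points lie on mirrors\<close>

text \<open>The coordinates \<open>hopf_x\<close>, \<open>hopf_y\<close>, \<open>hopf_w\<close> are those of the Hopf map onto the two-sphere. Two points of the three-sphere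
have the same image iff they differ by a unit complex factor.\<close>
definition hopf_x :: "complex ^ 2 \<Rightarrow> real" where "hopf_x z = 2 * Re (z $ 1 * cnj (z $ 2))"

definition hopf_y :: "complex ^ 2 \<Rightarrow> real" where "hopf_y z = 2 * Im (z $ 1 * cnj (z $ 2))"

definition hopf_w :: "complex ^ 2 \<Rightarrow> real" where "hopf_w z = (cmod (z $ 1))\<^sup>2 - (cmod (z $ 2))\<^sup>2"

text \<open>In terms of the squares \<open>X, Y, Z\<close> of the Hopf coordinates, \<open>5 |phi 1|\<^sup>2\<close> is a form of degree 6 that is invariant under
cyclic permutations; \<open>mod_sq_A\<close> and \<open>mod_sq_B\<close> contain representatives of its rational part and of its
part with \<open>\<surd>5\<close>. (The symmetric monomial \<open>X\<^sup>2 Y\<^sup>2 Z\<^sup>2\<close> carries a third of its coefficient.)\<close>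
definition mod_sq_A :: "'a \<Rightarrow> 'a \<Rightarrow> 'a \<Rightarrow> 'a::comm_ring_1" where
  "mod_sq_A X Y Z = 664 * (Y * Z^5 + Y^5 * Z) + 1440 * (Y^2 * Z^4 + Y^4 * Z^2) + 2272 * Y^3 * Z^3
     - 5040 * X * Y * Z^4 - 2160 * (X * Y^2 * Z^3 + X * Y^3 * Z^2) + 2880 * X^2 * Y^2 * Z^2"

definition mod_sq_B :: "'a \<Rightarrow> 'a \<Rightarrow> 'a \<Rightarrow> 'a::comm_ring_1" where
  "mod_sq_B X Y Z = 12 * (Y * Z^5 - Y^5 * Z) + 48 * (Y^2 * Z^4 - Y^4 * Z^2) + 72 * (X * Y^2 * Z^3 - X * Y^3 * Z^2)"

definition mod_sq :: "real \<Rightarrow> real \<Rightarrow> real \<Rightarrow> real" where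
  "mod_sq X Y Z = mod_sq_A X Y Z + mod_sq_A Y Z X + mod_sq_A Z X Y
     - 22 * sqrt 5 * (mod_sq_B X Y Z + mod_sq_B Y Z X + mod_sq_B Z X Y)"

text \<open>The partial derivative of \<^const>\<open>mod_sq\<close> by its first argument; by cyclic symmetry the other two arise from it
by rotating the arguments.\<close>
definition mod_sq_partial :: "real \<Rightarrow> real \<Rightarrow> real \<Rightarrow> real" where
  "mod_sq_partial X Y Z = 3320 * X^4 * Y + 3320 * X^4 * Z + 5760 * X^3 * Y^2 - 20160 * X^3 * Y * Z
     + 5760 * X^3 * Z^2 + 6816 * X^2 * Y^3 - 6480 * X^2 * Y^2 * Z - 6480 * X^2 * Y * Z^2
     + 6816 * X^2 * Z^3 + 2880 * X * Y^4 - 4320 * X * Y^3 * Z + 17280 * X * Y^2 * Z^2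
     - 4320 * X * Y * Z^3 + 2880 * X * Z^4 + 664 * Y^5 - 5040 * Y^4 * Z - 2160 * Y^3 * Z^2
     - 2160 * Y^2 * Z^3 - 5040 * Y * Z^4 + 664 * Z^5
     - 22 * sqrt 5 * (- 60 * X^4 * Y + 60 * X^4 * Z - 192 * X^3 * Y^2 + 192 * X^3 * Z^2
     - 216 * X^2 * Y^2 * Z + 216 * X^2 * Y * Z^2 + 96 * X * Y^4 + 144 * X * Y^3 * Z
     - 144 * X * Y * Z^3 - 96 * X * Z^4 + 12 * Y^5 - 72 * Y^3 * Z^2 + 72 * Y^2 * Z^3
     - 12 * Z^5)"

lemma mod_sq_has_derivative:
  assumes "(p has_derivative p') (at x)" "(q has_derivative q') (at x)" "(r has_derivative r') (at x)"
  shows "((\<lambda>x. mod_sq (p x) (q x) (r x)) has_derivative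
    (\<lambda>h. p' h * mod_sq_partial (p x) (q x) (r x) + q' h * mod_sq_partial (q x) (r x) (p x) + r' h * mod_sq_partial (r x) (p x) (q x))) (at x)"
  unfolding mod_sq_def mod_sq_A_def mod_sq_B_def
  by (rule derivative_eq_intros assms refl | rule ext)+ (simp add: mod_sq_partial_def; algebra)

text \<open>Treat \<open>z\<^sub>1, z\<^sub>2\<close> and their conjugates as four independent variables. Splitting \<open>phi 1 = g - (22 / \<surd>5) h\<close>
with rational \<open>g\<close> and \<open>h\<close> turns the claim into two polynomial identities with rational coefficients.\<close>
lemma phi1_mod_sq:
  "5 * (phi 1 z * cnj (phi 1 z)) = of_real (mod_sq ((hopf_x z)\<^sup>2) ((hopf_y z)\<^sup>2) ((hopf_w z)\<^sup>2))"
proof -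
  define a b c d where "a = z $ 1" and "b = z $ 2" and "c = cnj (z $ 1)" and "d = cnj (z $ 2)"
  define s where "s = complex_of_real (sqrt 5)"
  have s: "s * s = 5" unfolding s_def by (simp flip: of_real_mult)
  have "s \<noteq> 0" using s by auto
  have ds: "1 / s = s / 5" using s \<open>s \<noteq> 0\<close> by (simp add: field_simps)
  define g where "g = (\<lambda>a b c d :: complex. c * (12 * b^11 - 264 * a^4 * b^7 - 132 * a^8 * b^3)
      - d * (12 * a^11 - 264 * a^7 * b^4 - 132 * a^3 * b^8))"
  define h where "h = (\<lambda>a b c d :: complex. c * (10 * a^2 * b^9 - 12 * a^6 * b^5 + 2 * a^10 * b)
      - d * (10 * a^9 * b^2 - 12 * a^5 * b^6 + 2 * a * b^10))"
  have p: "phi 1 z = g a b c d - 22 * (1 / s) * h a b c d"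
    unfolding phi_simps dform.simps J_nth One_nat_def[symmetric] form_1_0 form_0_1 g_def h_def a_def b_def c_def d_def s_def
    by (simp add: algebra_simps)
  have q: "cnj (phi 1 z) = g c d a b - 22 * (1 / s) * h c d a b"
  proof -
    have "cnj (g a b c d) = g c d a b" "cnj (h a b c d) = h c d a b" "cnj s = s"
      unfolding g_def h_def a_def b_def c_def d_def s_def by simp_all
    moreover have "cnj (phi 1 z) = cnj (g a b c d) - 22 * (1 / cnj s) * cnj (h a b c d)"
      unfolding p by simp
    ultimately show ?thesis by (simp only:)
  qed
  have "5 * (phi 1 z * cnj (phi 1 z)) = 5 * (g a b c d * g c d a b) + 484 * (h a b c d * h c d a b)
      - 22 * s * (g a b c d * h c d a b + h a b c d * g c d a b)"
  proof -
    have s0: "s * s - 5 = 0" using s by simp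
    have "5 * (5 * (phi 1 z * cnj (phi 1 z))) = 5 * (5 * (g a b c d * g c d a b) + 484 * (h a b c d * h c d a b)
      - 22 * s * (g a b c d * h c d a b + h a b c d * g c d a b))"
    proof -
      have e1: "5 * phi 1 z = 5 * g a b c d - 22 * s * h a b c d"
        unfolding p ds by (simp add: field_simps)
      have e2: "5 * cnj (phi 1 z) = 5 * g c d a b - 22 * s * h c d a b"
        unfolding q ds by (simp add: field_simps)
      have "25 * (phi 1 z * cnj (phi 1 z)) = (5 * phi 1 z) * (5 * cnj (phi 1 z))" by simp
      also have "\<dots> = (5 * g a b c d - 22 * s * h a b c d) * (5 * g c d a b - 22 * s * h c d a b)"
        unfolding e1 e2 ..
      also have "\<dots> = 5 * (5 * (g a b c d * g c d a b) + 484 * (h a b c d * h c d a b)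
        - 22 * s * (g a b c d * h c d a b + h a b c d * g c d a b))" using s0 by algebra
      finally show ?thesis by simp
    qed
    then show ?thesis by (simp only: mult_cancel_left) simp
  qed
  moreover have "5 * (g a b c d * g c d a b) + 484 * (h a b c d * h c d a b) =
     mod_sq_A ((a*d+b*c)^2) (-((a*d-b*c)^2)) ((a*c-b*d)^2) + mod_sq_A (-((a*d-b*c)^2)) ((a*c-b*d)^2) ((a*d+b*c)^2)
     + mod_sq_A ((a*c-b*d)^2) ((a*d+b*c)^2) (-((a*d-b*c)^2))"
    unfolding g_def h_def mod_sq_A_def by algebra
  moreover have "g a b c d * h c d a b + h a b c d * g c d a b =
     mod_sq_B ((a*d+b*c)^2) (-((a*d-b*c)^2)) ((a*c-b*d)^2) + mod_sq_B (-((a*d-b*c)^2)) ((a*c-b*d)^2) ((a*d+b*c)^2)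
     + mod_sq_B ((a*c-b*d)^2) ((a*d+b*c)^2) (-((a*d-b*c)^2))"
    unfolding g_def h_def mod_sq_B_def by algebra
  moreover have "complex_of_real (hopf_x z) = a * d + b * c" "complex_of_real (hopf_y z) = - \<i> * (a * d - b * c)"
    "complex_of_real (hopf_w z) = a * c - b * d"
    unfolding hopf_x_def hopf_y_def hopf_w_def cmod_power2 a_def b_def c_def d_def
    by (simp_all add: complex_eq_iff power2_eq_square algebra_simps)
  then have "of_real ((hopf_x z)\<^sup>2) = (a*d+b*c)^2" "of_real ((hopf_y z)\<^sup>2) = -((a*d-b*c)^2)"
     "of_real ((hopf_w z)\<^sup>2) = (a*c-b*d)^2" by (simp_all add: power_mult_distrib)
  moreover have "complex_of_real (mod_sq_A X Y Z) = mod_sq_A (of_real X) (of_real Y) (of_real Z)"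
     "complex_of_real (mod_sq_B X Y Z) = mod_sq_B (of_real X) (of_real Y) (of_real Z)" for X Y Z
    by (simp_all add: mod_sq_A_def mod_sq_B_def)
  ultimately show ?thesis
    by (simp add: mod_sq_def s_def)
qed

lemma hopf_x_has_derivative: "(hopf_x has_derivative (\<lambda>v. 2 * Re (v $ 1 * cnj (z $ 2) + z $ 1 * cnj (v $ 2)))) (at z)"
  unfolding hopf_x_def[abs_def] by (auto intro!: derivative_eq_intros)

lemma hopf_y_has_derivative: "(hopf_y has_derivative (\<lambda>v. 2 * Im (v $ 1 * cnj (z $ 2) + z $ 1 * cnj (v $ 2)))) (at z)"
  unfolding hopf_y_def[abs_def] by (auto intro!: derivative_eq_intros)

lemma hopf_w_has_derivative: "(hopf_w has_derivative (\<lambda>v. 2 * Re (v $ 1 * cnj (z $ 1)) - 2 * Re (v $ 2 * cnj (z $ 2)))) (at z)"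
  unfolding hopf_w_def[abs_def] cmod_power2 by (auto intro!: derivative_eq_intros ext simp: algebra_simps)

lemma hopf_sum: "z \<in> S3 \<Longrightarrow> (hopf_x z)\<^sup>2 + (hopf_y z)\<^sup>2 + (hopf_w z)\<^sup>2 = 1"
proof -
  assume "z \<in> S3"
  then have "norm z ^ 2 = 1" by simp
  then have 1: "(cmod (z $ 1))\<^sup>2 + (cmod (z $ 2))\<^sup>2 - 1 = 0" unfolding norm_complex2 by simp
  have "(hopf_x z)\<^sup>2 + (hopf_y z)\<^sup>2 = 4 * (cmod (z $ 1 * cnj (z $ 2)))\<^sup>2"
    unfolding hopf_x_def hopf_y_def cmod_power2 by algebra
  also have "\<dots> = 4 * ((cmod (z $ 1))\<^sup>2 * (cmod (z $ 2))\<^sup>2)" by (simp add: norm_mult power_mult_distrib)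
  finally show ?thesis using 1 unfolding hopf_w_def by algebra
qed

text \<open>The three tangent fields obtained from left multiplication by \<open>i\<close>, \<open>j\<close> and \<open>k\<close> induce the rotations of the two-sphere about the
coordinate axes. At a critical point the derivative of \<open>|phi 1|\<^sup>2\<close> along each of them vanishes, as \<open>phi 1\<close> is
real there. In the squared coordinates this says that the partial derivatives agree where the coordinates
do not vanish.\<close>
lemma critical_mod_sq:
  assumes z: "z \<in> S3" and crit: "critical_at morse_lift z"
  defines "x \<equiv> hopf_x z" and "y \<equiv> hopf_y z" and "w \<equiv> hopf_w z"
  defines "GX \<equiv> mod_sq_partial (x\<^sup>2) (y\<^sup>2) (w\<^sup>2)" and "GY \<equiv> mod_sq_partial (y\<^sup>2) (w\<^sup>2) (x\<^sup>2)" and "GZ \<equiv> mod_sq_partial (w\<^sup>2) (x\<^sup>2) (y\<^sup>2)"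
  shows "x * y * (GX - GY) = 0" "x * w * (GX - GZ) = 0" "y * w * (GY - GZ) = 0"
proof -
  define M where "M = (\<lambda>z. mod_sq ((hopf_x z)\<^sup>2) ((hopf_y z)\<^sup>2) ((hopf_w z)\<^sup>2))"
  have M: "M u = 5 * ((Re (phi 1 u))\<^sup>2 + (Im (phi 1 u))\<^sup>2)" for u
  proof -
    have "complex_of_real (M u) = 5 * (phi 1 u * cnj (phi 1 u))"
      unfolding M_def phi1_mod_sq ..
    also have "\<dots> = of_real (5 * ((Re (phi 1 u))\<^sup>2 + (Im (phi 1 u))\<^sup>2))"
      by (simp add: complex_mult_cnj)
    finally show ?thesis using of_real_eq_iff by blast
  qed
  have d1: "(M has_derivative (\<lambda>v. 5 * (2 * Re (phi 1 z) * Re (dphi1 z v) + 2 * Im (phi 1 z) * Im (dphi1 z v)))) (at z)"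
    unfolding M[abs_def] by (auto intro!: derivative_eq_intros phi1_has_derivative[unfolded One_nat_def])
  have d2: "(M has_derivative (\<lambda>v. 2 * x * (2 * Re (v $ 1 * cnj (z $ 2) + z $ 1 * cnj (v $ 2))) * GX
      + 2 * y * (2 * Im (v $ 1 * cnj (z $ 2) + z $ 1 * cnj (v $ 2))) * GY
      + 2 * w * (2 * Re (v $ 1 * cnj (z $ 1)) - 2 * Re (v $ 2 * cnj (z $ 2))) * GZ)) (at z)"
    unfolding M_def GX_def GY_def GZ_def x_def y_def w_def
    by (rule has_derivative_eq_rhs, rule mod_sq_has_derivative,
      (rule derivative_eq_intros hopf_x_has_derivative hopf_y_has_derivative hopf_w_has_derivative refl)+)
      (simp add: fun_eq_iff algebra_simps)
  have key: "2 * x * (2 * Re (v $ 1 * cnj (z $ 2) + z $ 1 * cnj (v $ 2))) * GX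
      + 2 * y * (2 * Im (v $ 1 * cnj (z $ 2) + z $ 1 * cnj (v $ 2))) * GY
      + 2 * w * (2 * Re (v $ 1 * cnj (z $ 1)) - 2 * Re (v $ 2 * cnj (z $ 2))) * GZ = 0"
    if v: "v \<in> tangent_space z" for v
  proof -
    have "Re (dphi1 z v) = 0" using crit v unfolding morse_lift.critical_at[OF z] by blast
    moreover have "Im (phi 1 z) = 0" using crit unfolding critical_morse_lift[OF z] by blast
    ultimately show ?thesis using fun_cong[OF has_derivative_unique[OF d2 d1], of v] by simp
  qed
  have t: "vector [\<i> * z $ 1, - \<i> * z $ 2] \<in> tangent_space z" "vector [z $ 2, - z $ 1] \<in> tangent_space z"
    "vector [\<i> * z $ 2, \<i> * z $ 1] \<in> tangent_space z"
    by (simp_all add: tangent_space_def inner_complex2 algebra_simps)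
  have dx: "2 * Re (\<i> * z $ 1 * cnj (z $ 2) + z $ 1 * cnj (- \<i> * z $ 2)) = - 2 * y"
    "2 * Re (z $ 2 * cnj (z $ 2) + z $ 1 * cnj (- z $ 1)) = - 2 * w"
    "2 * Re (\<i> * z $ 2 * cnj (z $ 2) + z $ 1 * cnj (\<i> * z $ 1)) = 0"
    unfolding x_def y_def w_def hopf_x_def hopf_y_def hopf_w_def cmod_power2
    by (simp_all add: power2_eq_square algebra_simps)
  have dy: "2 * Im (\<i> * z $ 1 * cnj (z $ 2) + z $ 1 * cnj (- \<i> * z $ 2)) = 2 * x"
    "2 * Im (z $ 2 * cnj (z $ 2) + z $ 1 * cnj (- z $ 1)) = 0"
    "2 * Im (\<i> * z $ 2 * cnj (z $ 2) + z $ 1 * cnj (\<i> * z $ 1)) = - 2 * w"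
    unfolding x_def y_def w_def hopf_x_def hopf_y_def hopf_w_def cmod_power2
    by (simp_all add: power2_eq_square algebra_simps)
  have dw: "2 * Re (\<i> * z $ 1 * cnj (z $ 1)) - 2 * Re (- \<i> * z $ 2 * cnj (z $ 2)) = 0"
    "2 * Re (z $ 2 * cnj (z $ 1)) - 2 * Re (- z $ 1 * cnj (z $ 2)) = 2 * x"
    "2 * Re (\<i> * z $ 2 * cnj (z $ 1)) - 2 * Re (\<i> * z $ 1 * cnj (z $ 2)) = 2 * y"
    unfolding x_def y_def w_def hopf_x_def hopf_y_def hopf_w_def cmod_power2
    by (simp_all add: power2_eq_square algebra_simps)
  show "x * y * (GX - GY) = 0"
    using key[OF t(1)] unfolding vec2_nth dx dy dw by (auto simp: algebra_simps)
  show "x * w * (GX - GZ) = 0"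
    using key[OF t(2)] unfolding vec2_nth dx dy dw by (auto simp: algebra_simps)
  show "y * w * (GY - GZ) = 0"
    using key[OF t(3)] unfolding vec2_nth dx dy dw by (auto simp: algebra_simps)
qed

text \<open>Four times \<open>a\<^sup>4 + b\<^sup>4 + c\<^sup>4 - 2 a\<^sup>2 b\<^sup>2 - 2 b\<^sup>2 c\<^sup>2 - 2 c\<^sup>2 a\<^sup>2\<close> for \<open>a = x / \<phi>\<close>, \<open>b = y\<close>, \<open>c = \<phi> w\<close> and \<open>X, Y, Z\<close> the squares of \<open>x, y, w\<close>: up to sign,
Heron's product of the four linear forms \<open>a \<plusminus> b \<plusminus> c\<close>. Its three cyclic versions account for the twelve mirrors other
than the coordinate planes.\<close>
definition mirror_quad :: "real \<Rightarrow> real \<Rightarrow> real \<Rightarrow> real" where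
  "mirror_quad X Y Z = ((3 - sqrt 5) * X - 2 * Y - (3 + sqrt 5) * Z)\<^sup>2 - 8 * (3 + sqrt 5) * Y * Z"

text \<open>The product \<open>P Q R\<close> is a constant times the invariant of degree 6 that vanishes on the planes orthogonal to the six axes through
vertices, and \<open>UX, UY, UZ\<close> are its partial derivatives by the squared coordinates. The differences of such derivatives are,
up to products of two coordinates, the derivatives along the rotations about the axes, so that the left-hand side is, up to the
product of all three coordinates, the Jacobian of this invariant and \<^const>\<open>mod_sq\<close> on the sphere. It vanishes on the twelve oblique
mirrors, where both gradients are tangent to the mirror, and comparing degrees leaves a constant and the factor
\<open>X + Y + Z\<close>, which is 1 on the sphere.\<close>
lemma jacobian:
  fixes X Y Z :: real
  defines "s \<equiv> sqrt 5"
  defines "P \<equiv> 2 * X - (3 + s) * Z" and "Q \<equiv> 2 * Y - (3 + s) * X" and "R \<equiv> 2 * Z - (3 + s) * Y"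
  defines "UX \<equiv> 2 * Q * R - (3 + s) * P * R" and "UY \<equiv> 2 * P * R - (3 + s) * P * Q" and "UZ \<equiv> 2 * P * Q - (3 + s) * Q * R"
  shows "(UX - UY) * (mod_sq_partial Y Z X - mod_sq_partial Z X Y) - (UY - UZ) * (mod_sq_partial X Y Z - mod_sq_partial Y Z X) =
     (250 + 100 * s) * (X + Y + Z) * (mirror_quad X Y Z * mirror_quad Y Z X * mirror_quad Z X Y)"
proof -
  have s: "s * s - 5 = 0" by (simp add: s_def)
  show ?thesis
    unfolding mod_sq_partial_def mirror_quad_def UX_def UY_def UZ_def P_def Q_def R_def s_def[symmetric]
    using s by algebra
qed

text \<open>Heron's factorization, with the linear forms multiplied by the golden ratio.\<close>
lemma mirror_quad_zero:
  assumes "mirror_quad (x\<^sup>2) (y\<^sup>2) (w\<^sup>2) = 0"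
  defines "g \<equiv> golden_ratio"
  shows "x + g * y + g\<^sup>2 * w = 0 \<or> - x + g * y + g\<^sup>2 * w = 0 \<or> x - g * y + g\<^sup>2 * w = 0 \<or> x + g * y - g\<^sup>2 * w = 0"
proof -
  define s where "s = sqrt 5"
  have s: "s * s - 5 = 0" by (simp add: s_def)
  have s2: "2 * g = 1 + s" by (simp add: g_def s_def golden_ratio_def)
  have g2: "2 * g\<^sup>2 = 3 + s"
  proof -
    have "2 * (2 * g\<^sup>2) = (2 * g) * (2 * g)" by (simp add: power2_eq_square)
    also have "\<dots> = 2 * (3 + s)" unfolding s2 using s by algebra
    finally show ?thesis by simp
  qed
  have g1: "g\<^sup>2 - (g + 1) = 0" using g2 s2 by simp
  have s': "s - (2 * g - 1) = 0" using s2 by simp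
  have "g\<^sup>2 * g\<^sup>2 * mirror_quad (x\<^sup>2) (y\<^sup>2) (w\<^sup>2) =
     - 4 * ((x + g * y + g\<^sup>2 * w) * (- x + g * y + g\<^sup>2 * w) * (x - g * y + g\<^sup>2 * w) * (x + g * y - g\<^sup>2 * w))"
    unfolding mirror_quad_def s_def[symmetric] using g1 s' by algebra
  then show ?thesis using assms(1) by simp
qed

lemma quat_unit_icosian:
  "quat 0 1 0 0 \<in> unit_icosians" "quat 0 0 1 0 \<in> unit_icosians" "quat 0 0 0 1 \<in> unit_icosians"
  "quat (1/2) (1/2) (1/2) (1/2) \<in> unit_icosians" "quat (- 1) 0 0 0 \<in> unit_icosians"
  "quat 0 (1/2) (1 / (2 * golden_ratio)) (golden_ratio / 2) \<in> unit_icosians"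
  "quat (golden_ratio / 2) (1/2) 0 (1 / (2 * golden_ratio)) \<in> unit_icosians"
proof -
  let ?L = "[((0,0),(4,0),(0,0),(0,0)), ((0,0),(0,0),(4,0),(0,0)), ((0,0),(0,0),(0,0),(4,0)),
    ((2,0),(2,0),(2,0),(2,0)), ((-4,0),(0,0),(0,0),(0,0)),
    ((0,0),(2,0),(-1,1),(1,1)), ((1,1),(2,0),(0,0),(-1,1))]"
  have "list_all (\<lambda>q. q \<in> set icosian_codes) ?L" by code_simp
  then have "decode ` set ?L \<subseteq> unit_icosians" unfolding unit_icosians_eq list_all_iff by blast
  then show "quat 0 1 0 0 \<in> unit_icosians" "quat 0 0 1 0 \<in> unit_icosians" "quat 0 0 0 1 \<in> unit_icosians"
    "quat (1/2) (1/2) (1/2) (1/2) \<in> unit_icosians" "quat (- 1) 0 0 0 \<in> unit_icosians"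
    "quat 0 (1/2) (1 / (2 * golden_ratio)) (golden_ratio / 2) \<in> unit_icosians"
    "quat (golden_ratio / 2) (1/2) 0 (1 / (2 * golden_ratio)) \<in> unit_icosians"
    by (simp_all add: decode_values del: decode1.simps)
qed

lemma hopf_quaternion_matrix:
  "hopf_x (quaternion_matrix (quat 0 1 0 0) *v z) = - hopf_x z"
  "hopf_y (quaternion_matrix (quat 0 1 0 0) *v z) = - hopf_y z"
  "hopf_w (quaternion_matrix (quat 0 1 0 0) *v z) = hopf_w z"
  "hopf_x (quaternion_matrix (quat 0 0 1 0) *v z) = - hopf_x z"
  "hopf_y (quaternion_matrix (quat 0 0 1 0) *v z) = hopf_y z"
  "hopf_w (quaternion_matrix (quat 0 0 1 0) *v z) = - hopf_w z"
  "hopf_x (quaternion_matrix (quat 0 0 0 1) *v z) = hopf_x z"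
  "hopf_y (quaternion_matrix (quat 0 0 0 1) *v z) = - hopf_y z"
  "hopf_w (quaternion_matrix (quat 0 0 0 1) *v z) = - hopf_w z"
  "hopf_x (quaternion_matrix (quat (1/2) (1/2) (1/2) (1/2)) *v z) = - hopf_y z"
  "hopf_y (quaternion_matrix (quat (1/2) (1/2) (1/2) (1/2)) *v z) = - hopf_w z"
  "hopf_w (quaternion_matrix (quat (1/2) (1/2) (1/2) (1/2)) *v z) = hopf_x z"
  unfolding hopf_x_def hopf_y_def hopf_w_def cmod_power2 quaternion_matrix_nth
  by (simp_all add: power2_eq_square field_simps)

text \<open>This element of the group carries one of the twelve oblique mirrors to the plane \<open>hopf_y = 0\<close>.\<close>
lemma hopf_y_mirror:
  "hopf_y (quaternion_matrix (quat 0 (1/2) (1 / (2 * golden_ratio)) (golden_ratio / 2)) *v z)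
    = - (hopf_w z + golden_ratio * hopf_x z + golden_ratio\<^sup>2 * hopf_y z) / (2 * golden_ratio)"
proof -
  define g where "g = golden_ratio"
  have g1: "g\<^sup>2 - (g + 1) = 0" by (simp add: g_def golden_ratio_def power2_eq_square field_simps)
  have "g > 0" by (simp add: g_def golden_ratio_def add_pos_nonneg)
  have inv: "1 / (2 * g) = (g - 1) / 2" using g1 \<open>g > 0\<close> by (simp add: field_simps power2_eq_square)
  define u v where "u = (quaternion_matrix (quat 0 (1/2) ((g - 1) / 2) (g / 2)) *v z) $ 1"
    and "v = (quaternion_matrix (quat 0 (1/2) ((g - 1) / 2) (g / 2)) *v z) $ 2"
  have uv: "2 * Re u = - Im (z $ 1) + (g - 1) * Re (z $ 2) - g * Im (z $ 2)"
    "2 * Im u = Re (z $ 1) + (g - 1) * Im (z $ 2) + g * Re (z $ 2)"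
    "2 * Re v = - (g - 1) * Re (z $ 1) - g * Im (z $ 1) + Im (z $ 2)"
    "2 * Im v = - (g - 1) * Im (z $ 1) + g * Re (z $ 1) - Re (z $ 2)"
    unfolding u_def v_def quaternion_matrix_nth by (simp_all add: field_simps)
  have "4 * (Im u * Re v - Re u * Im v) = (2 * Im u) * (2 * Re v) - (2 * Re u) * (2 * Im v)" by simp
  also have "\<dots> * g = - (((Re (z $ 1))\<^sup>2 + (Im (z $ 1))\<^sup>2 - ((Re (z $ 2))\<^sup>2 + (Im (z $ 2))\<^sup>2))
      + g * (2 * (Re (z $ 1) * Re (z $ 2) + Im (z $ 1) * Im (z $ 2)))
      + g\<^sup>2 * (2 * (Im (z $ 1) * Re (z $ 2) - Re (z $ 1) * Im (z $ 2))))"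
    unfolding uv using g1 by algebra
  finally have "hopf_y (quaternion_matrix (quat 0 (1/2) ((g - 1) / 2) (g / 2)) *v z) * (2 * g)
     = - (hopf_w z + g * hopf_x z + g\<^sup>2 * hopf_y z)"
    unfolding hopf_x_def hopf_y_def hopf_w_def cmod_power2 u_def[symmetric] v_def[symmetric]
    by (simp add: algebra_simps)
  then show ?thesis unfolding g_def[symmetric] inv using \<open>g > 0\<close> by (simp add: field_simps)
qed

text \<open>The group acts transitively on the 15 mirrors. The quaternions \<open>i, j, k\<close> change signs of Hopf coordinates,
\<open>(1 + i + j + k) / 2\<close> permutes them cyclically, and one further element suffices for the oblique mirrors.\<close>
lemma critical_equivalent_to_mirror:
  assumes z: "z \<in> S3" and crit: "critical_at morse_lift z"
  shows "\<exists>A\<in>binary_icosahedral. hopf_y (A *v z) = 0"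
proof -
  define Q where "Q = (\<lambda>z. \<exists>A\<in>binary_icosahedral. hopf_y (A *v z) = 0)"
  have Q_self: "Q z" if "hopf_y z = 0" for z
    unfolding Q_def using that one_binary_icosahedral by (metis matrix_vector_mul_lid)
  have Q_step: "Q z" if "Q (quaternion_matrix q *v z)" "q \<in> unit_icosians" for q z
  proof -
    obtain A where "A \<in> binary_icosahedral" "hopf_y ((A ** quaternion_matrix q) *v z) = 0"
      using \<open>Q (quaternion_matrix q *v z)\<close> unfolding Q_def matrix_vector_mul_assoc by blast
    moreover have "quaternion_matrix q \<in> binary_icosahedral"
      using that(2) by (simp add: binary_icosahedral_def)
    ultimately show ?thesis unfolding Q_def using binary_icosahedral_mult by blast
  qed
  note qi = quat_unit_icosian
  note hq = hopf_quaternion_matrix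
  have Q_w: "Q z" if "hopf_w z = 0" for z
    by (rule Q_step[OF Q_self qi(4)]) (simp add: hq that)
  have Q_x: "Q z" if "hopf_x z = 0" for z
    by (rule Q_step[OF Q_w qi(4)]) (simp add: hq that)
  have Q_form: "Q z" if "hopf_w z + golden_ratio * hopf_x z + golden_ratio\<^sup>2 * hopf_y z = 0" for z
    by (rule Q_step[OF Q_self qi(6)]) (simp add: hopf_y_mirror that)
  have Q_1: "Q z" if "mirror_quad ((hopf_w z)\<^sup>2) ((hopf_x z)\<^sup>2) ((hopf_y z)\<^sup>2) = 0" for z
    using mirror_quad_zero[OF that]
  proof (elim disjE)
    assume "hopf_w z + golden_ratio * hopf_x z + golden_ratio\<^sup>2 * hopf_y z = 0"
    then show ?thesis by (rule Q_form)
  next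
    assume "- hopf_w z + golden_ratio * hopf_x z + golden_ratio\<^sup>2 * hopf_y z = 0"
    then show ?thesis by (intro Q_step[OF Q_form qi(1)]) (simp add: hq)
  next
    assume "hopf_w z - golden_ratio * hopf_x z + golden_ratio\<^sup>2 * hopf_y z = 0"
    then show ?thesis by (intro Q_step[OF Q_form qi(3)]) (simp add: hq)
  next
    assume "hopf_w z + golden_ratio * hopf_x z - golden_ratio\<^sup>2 * hopf_y z = 0"
    then show ?thesis by (intro Q_step[OF Q_form qi(2)]) (simp add: hq)
  qed
  have Q_2: "Q z" if "mirror_quad ((hopf_x z)\<^sup>2) ((hopf_y z)\<^sup>2) ((hopf_w z)\<^sup>2) = 0" for z
    by (rule Q_step[OF Q_1 qi(4)]) (simp add: hq that)
  have Q_3: "Q z" if "mirror_quad ((hopf_y z)\<^sup>2) ((hopf_w z)\<^sup>2) ((hopf_x z)\<^sup>2) = 0" for z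
    by (rule Q_step[OF Q_2 qi(4)]) (simp add: hq that)
  show ?thesis
  proof (cases "hopf_x z = 0 \<or> hopf_y z = 0 \<or> hopf_w z = 0")
    case True
    then show ?thesis using Q_x Q_self Q_w unfolding Q_def by blast
  next
    case False
    define X Y Z where "X = (hopf_x z)\<^sup>2" and "Y = (hopf_y z)\<^sup>2" and "Z = (hopf_w z)\<^sup>2"
    have eq: "mod_sq_partial X Y Z = mod_sq_partial Y Z X" "mod_sq_partial Y Z X = mod_sq_partial Z X Y"
      using critical_mod_sq[OF z crit] False by (simp_all add: X_def Y_def Z_def)
    have "X + Y + Z = 1" using hopf_sum[OF z] by (simp add: X_def Y_def Z_def)
    then have "(250 + 100 * sqrt 5) * (mirror_quad X Y Z * mirror_quad Y Z X * mirror_quad Z X Y) = 0"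
      using jacobian[where X = X and Y = Y and Z = Z, unfolded eq diff_self mult_zero_right] by simp
    moreover have "250 + 100 * sqrt 5 > 0" by (simp add: add_pos_nonneg)
    ultimately have "mirror_quad X Y Z = 0 \<or> mirror_quad Y Z X = 0 \<or> mirror_quad Z X Y = 0"
      by simp
    then have "Q z" using Q_1[of z] Q_2[of z] Q_3[of z] unfolding X_def Y_def Z_def by blast
    then show ?thesis unfolding Q_def .
  qed
qed

section \<open>Values on a mirror\<close>

lemma form_second:
  fixes a b :: complex
  shows "form 2 0 a b = 132 * a^10 - 1848 * a^6 * b^4 - 396 * a^2 * b^8
      - 22 / sqrt 5 * (90 * a^8 * b^2 - 60 * a^4 * b^6 + 2 * b^10)"
    "form 1 1 a b = - 1056 * a^7 * b^3 - 1056 * a^3 * b^7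
      - 22 / sqrt 5 * (20 * a^9 * b - 72 * a^5 * b^5 + 20 * a * b^9)"
    "form 0 2 a b = 132 * b^10 - 1848 * a^4 * b^6 - 396 * a^8 * b^2
      - 22 / sqrt 5 * (90 * a^2 * b^8 - 60 * a^6 * b^4 + 2 * a^10)"
  by (simp_all add: form_def form_coeff_def power_deriv_def atMost_nat_numeral lessThan_nat_numeral algebra_simps)

lemma form_third:
  fixes a b :: complex
  shows "form 3 0 a b = 1320 * a^9 - 11088 * a^5 * b^4 - 792 * a * b^8
      - 22 / sqrt 5 * (720 * a^7 * b^2 - 240 * a^3 * b^6)"
    "form 2 1 a b = - 7392 * a^6 * b^3 - 3168 * a^2 * b^7
      - 22 / sqrt 5 * (180 * a^8 * b - 360 * a^4 * b^5 + 20 * b^9)"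
    "form 1 2 a b = - 7392 * a^3 * b^6 - 3168 * a^7 * b^2
      - 22 / sqrt 5 * (180 * a * b^8 - 360 * a^5 * b^4 + 20 * a^9)"
    "form 0 3 a b = 1320 * b^9 - 11088 * a^4 * b^5 - 792 * a^8 * b
      - 22 / sqrt 5 * (720 * a^2 * b^7 - 240 * a^6 * b^3)"
  by (simp_all add: form_def form_coeff_def power_deriv_def atMost_nat_numeral lessThan_nat_numeral algebra_simps)

text \<open>The value of the icosahedral form at \<open>(cos t, sin t)\<close>, as a polynomial in \<open>u = sin\<^sup>2 (2 t)\<close>.\<close>
definition profile :: "real \<Rightarrow> real" where
  "profile u = (10 - (15 + 11 * sqrt 5) * u + (11 * sqrt 5 - 15) * u\<^sup>2 + 10 * u^3) / 10"

text \<open>The derivative of \<^const>\<open>profile\<close> by \<open>u\<close>.\<close>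
definition slope :: "real \<Rightarrow> real" where
  "slope u = (- (15 + 11 * sqrt 5) + (22 * sqrt 5 - 30) * u + 30 * u\<^sup>2) / 10"

text \<open>The second derivative of \<open>t \<mapsto> profile (sin\<^sup>2 (2 t))\<close>, again as a polynomial in \<open>u\<close>; \<open>bend_slope\<close> below is its derivative by \<open>u\<close>.\<close>
definition bend :: "real \<Rightarrow> real" where
  "bend u = (- (120 + 88 * sqrt 5) + (704 * sqrt 5 - 480) * u + (2160 - 704 * sqrt 5) * u\<^sup>2 - 1440 * u^3) / 10"

definition bend_slope :: "real \<Rightarrow> real" where
  "bend_slope u = (704 * sqrt 5 - 480 + 2 * (2160 - 704 * sqrt 5) * u - 4320 * u\<^sup>2) / 10"

definition real_point :: "real \<Rightarrow> real \<Rightarrow> complex ^ 2" where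
  "real_point a b = vector [of_real a, of_real b]"

text \<open>At \<open>(a, b) = (cos t, sin t)\<close> the vector \<open>J z\<close> is \<open>(- b, a)\<close>, the velocity of the circle, and the acceleration is \<open>- z\<close>. So the
\<open>t\<close>-derivatives of \<open>f (cos t, sin t)\<close> are \<open>phi 1\<close>, \<open>phi 2 - 12 phi 0\<close> and \<open>phi 3 - 34 phi 1\<close>; and \<open>e\<close> is the derivative of
\<open>u = sin\<^sup>2 (2 t)\<close>. The proof compares homogeneous forms, with powers of \<open>a\<^sup>2 + b\<^sup>2\<close> inserted.\<close>
lemma phi_real_point:
  fixes a b :: real
  assumes ab: "a\<^sup>2 + b\<^sup>2 = 1"
  defines "u \<equiv> 4 * a\<^sup>2 * b\<^sup>2" and "e \<equiv> 8 * a * b * (a\<^sup>2 - b\<^sup>2)"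
  shows "phi 0 (real_point a b) = of_real (profile u)"
    and "phi 1 (real_point a b) = of_real (e * slope u)"
    and "phi 2 (real_point a b) = of_real (bend u + 12 * profile u)"
    and "phi 3 (real_point a b) = of_real (34 * e * slope u + e * bend_slope u)"
proof -
  define A B where "A = complex_of_real a" and "B = complex_of_real b"
  define s where "s = complex_of_real (sqrt 5)"
  define r U E where "r = A\<^sup>2 + B\<^sup>2" and "U = 4 * A\<^sup>2 * B\<^sup>2" and "E = 8 * A * B * (A\<^sup>2 - B\<^sup>2)"
  have "22 / sqrt 5 = 22 * sqrt 5 / 5" by (simp add: field_simps)
  then have "complex_of_real (22 / sqrt 5) = complex_of_real (22 * sqrt 5 / 5)" by (simp only:)
  then have ds: "complex_of_real (22 / sqrt 5) = 22 * s / 5" unfolding s_def by (simp only: of_real_divide of_real_mult of_real_numeral)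
  have "complex_of_real (a\<^sup>2 + b\<^sup>2) = 1" using ab by simp
  then have r1: "r = 1" by (simp add: r_def A_def B_def)
  have Uu: "of_real u = U" and Ee: "of_real e = E" by (simp_all add: u_def e_def U_def E_def A_def B_def)
  have nth: "real_point a b $ 1 = A" "real_point a b $ 2 = B"
    "J (real_point a b) $ 1 = - B" "J (real_point a b) $ 2 = A"
    by (simp_all add: real_point_def A_def B_def)
  have n: "Suc 0 = 1" "Suc 1 = 2" "Suc 2 = 3" by simp_all
  note forms = form_0_0 form_1_0 form_0_1 form_second form_third
  have "10 * phi 0 (real_point a b) = 10 * r^6 - (15 + 11 * s) * U * r^4 + (11 * s - 15) * U\<^sup>2 * r\<^sup>2 + 10 * U^3"
    unfolding phi_simps dform.simps nth n forms ds unfolding r_def U_def E_def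
    by (simp add: field_simps; algebra)
  then show "phi 0 (real_point a b) = of_real (profile u)"
    unfolding r1 by (simp add: profile_def Uu s_def field_simps)
  have "10 * phi 1 (real_point a b) = E * (- (15 + 11 * s) * r^4 + (22 * s - 30) * U * r\<^sup>2 + 30 * U\<^sup>2)"
    unfolding phi_simps dform.simps nth n forms ds unfolding r_def U_def E_def
    by (simp add: field_simps; algebra)
  then show "phi 1 (real_point a b) = of_real (e * slope u)"
    unfolding r1 by (simp add: slope_def Uu Ee s_def field_simps)
  have "10 * phi 2 (real_point a b) = 8 * (- (15 + 11 * s) * r^6 + (88 * s - 60) * U * r^4 + (270 - 88 * s) * U\<^sup>2 * r\<^sup>2 - 180 * U^3)
     + 12 * (10 * r^6 - (15 + 11 * s) * U * r^4 + (11 * s - 15) * U\<^sup>2 * r\<^sup>2 + 10 * U^3)"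
    unfolding phi_simps dform.simps nth n forms ds unfolding r_def U_def E_def
    by (simp add: field_simps; algebra)
  also have "\<dots> = of_real (10 * bend u) + 12 * of_real (10 * profile u)"
    unfolding r1 by (simp add: bend_def profile_def Uu s_def field_simps)
  also have "\<dots> = 10 * of_real (bend u + 12 * profile u)" by simp
  finally show "phi 2 (real_point a b) = of_real (bend u + 12 * profile u)"
    by (simp only: mult_cancel_left) simp
  have "10 * phi 3 (real_point a b) = 34 * E * (- (15 + 11 * s) * r^4 + (22 * s - 30) * U * r\<^sup>2 + 30 * U\<^sup>2)
     + 8 * E * ((88 * s - 60) * r^4 + 2 * (270 - 88 * s) * U * r\<^sup>2 - 540 * U\<^sup>2)"
    unfolding phi_simps dform.simps nth n forms ds unfolding r_def U_def E_def
    by (simp add: field_simps; algebra)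
  also have "\<dots> = 34 * of_real e * of_real (10 * slope u) + of_real e * of_real (10 * bend_slope u)"
    unfolding r1 by (simp add: bend_slope_def slope_def Uu Ee s_def field_simps)
  also have "\<dots> = 10 * of_real (34 * e * slope u + e * bend_slope u)" by simp
  finally show "phi 3 (real_point a b) = of_real (34 * e * slope u + e * bend_slope u)"
    by (simp only: mult_cancel_left) simp
qed

lemma form_scale:
  "form i j (l * a) (l * b) = l ^ (12 - i - j) * form i j a b"
proof -
  have "form_coeff k * power_deriv i k (l * a) * power_deriv j (12 - k) (l * b) =
      l ^ (12 - i - j) * (form_coeff k * power_deriv i k a * power_deriv j (12 - k) b)" if "k \<le> 12" for k
  proof (cases "i \<le> k \<and> j \<le> 12 - k")
    case True
    then have "12 - i - j = (k - i) + (12 - k - j)" using that by arith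
    then show ?thesis by (simp add: power_deriv_def power_mult_distrib power_add)
  next
    case False
    then consider "k < i" | "12 - k < j" by linarith
    then have "(\<Prod>t<i. k - t) = 0 \<or> (\<Prod>t<j. 12 - k - t) = 0"
    proof cases
      case 1
      then have "(\<Prod>t<i. k - t) = 0" by (intro prod_zero bexI[of _ k]) auto
      then show ?thesis ..
    next
      case 2
      then have "(\<Prod>t<j. 12 - k - t) = 0" by (intro prod_zero bexI[of _ "12 - k"]) auto
      then show ?thesis ..
    qed
    then show ?thesis unfolding power_deriv_def by (elim disjE) simp_all
  qed
  then show ?thesis
    unfolding form_def sum_distrib_left by (intro sum.cong) auto
qed

lemma dform_scale_point:
  "dform vs i j (l *s z) = l ^ (12 - i - j - length vs) * dform vs i j z"
  by (induction vs arbitrary: i j) (simp_all add: form_scale algebra_simps)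

lemma dform_scale_all: "dform (map ((*s) c) vs) i j z = c ^ length vs * dform vs i j z"
  by (induction vs arbitrary: i j) (simp_all add: algebra_simps)

lemma phi_scale: "phi m (l *s z) = l ^ (12 - m) * cnj l ^ m * phi m z"
proof -
  have "replicate m (J (l *s z)) = map ((*s) (cnj l)) (replicate m (J z))"
    by (simp only: J_scale map_replicate)
  then show ?thesis unfolding phi_def by (simp only: dform_scale_point dform_scale_all length_replicate) simp
qed

lemma real_point_in_S3: "a\<^sup>2 + b\<^sup>2 = 1 \<Longrightarrow> cmod l = 1 \<Longrightarrow> l *s real_point a b \<in> S3"
proof -
  assume "a\<^sup>2 + b\<^sup>2 = 1" "cmod l = 1"
  then have "norm (l *s real_point a b) ^ 2 = 1"
    unfolding norm_complex2 by (simp add: real_point_def norm_mult power_mult_distrib flip: distrib_left)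
  then show ?thesis by (simp add: abs_square_eq_1)
qed

text \<open>If \<open>z\<^sub>1 cnj z\<^sub>2\<close> is real, then both coordinates are real multiples of one unit complex number.\<close>
lemma mirror_point:
  assumes z: "z \<in> S3" and y: "hopf_y z = 0"
  obtains l a b where "cmod l = 1" "a\<^sup>2 + b\<^sup>2 = 1" "z = l *s real_point a b"
proof (cases "z $ 2 = 0")
  case True
  then have "cmod (z $ 1) = 1" using z norm_complex2[of z] by (simp add: abs_square_eq_1)
  moreover have "z = (z $ 1) *s real_point 1 0" using True by (simp add: vec2_eq_iff real_point_def)
  ultimately show ?thesis using that[of "z $ 1" 1 0] by simp
next
  case False
  define n where "n = cmod (z $ 2)"
  have n: "n \<noteq> 0" using False by (simp add: n_def)
  define l where "l = z $ 2 / of_real n"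
  define a where "a = Re (z $ 1 * cnj (z $ 2)) / n"
  have l: "cmod l = 1" using n by (simp add: l_def norm_divide n_def)
  have "z $ 1 * cnj (z $ 2) = of_real (Re (z $ 1 * cnj (z $ 2)))"
    using y by (simp add: hopf_y_def complex_eq_iff)
  then have "l * of_real a = z $ 2 * (z $ 1 * cnj (z $ 2)) / (of_real n * of_real n)"
    by (simp add: l_def a_def)
  also have "\<dots> = z $ 1 * (z $ 2 * cnj (z $ 2)) / (of_real n * of_real n)" by (simp add: algebra_simps)
  also have "z $ 2 * cnj (z $ 2) = of_real n * of_real n"
    by (simp add: n_def complex_norm_square[symmetric] power2_eq_square)
  finally have z1: "l * of_real a = z $ 1" using n by simp
  have z2: "l * of_real n = z $ 2" using n by (simp add: l_def)
  have eq: "z = l *s real_point a n" using z1 z2 by (simp add: vec2_eq_iff real_point_def)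
  have "norm z ^ 2 = a\<^sup>2 + n\<^sup>2"
    unfolding norm_complex2 z1[symmetric] z2[symmetric] using l by (simp add: norm_mult power_mult_distrib)
  then show ?thesis using that[OF l _ eq] z by simp
qed

text \<open>The value of \<open>u\<close> at the vertices on the mirror.\<close>
definition vertex_param :: real where "vertex_param = (5 - sqrt 5) / 10"

text \<open>The value of \<open>u\<close> at the second root of \<^const>\<open>bend\<close> in the unit interval, where \<open>|phi 1|\<^sup>2\<close> has saddle points.\<close>
definition saddle_param :: real where "saddle_param = (18 - 7 * sqrt 5 + sqrt 1037) / 36"

lemma sqrt_bounds: "2236/1000 < sqrt 5" "sqrt 5 < 22361/10000" "322/10 < sqrt 1037" "sqrt 1037 < 3221/100"
proof -
  show "2236/1000 < sqrt 5" "322/10 < sqrt 1037"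
    by (rule real_less_rsqrt; simp add: power2_eq_square)+
  show "sqrt 5 < 22361/10000" "sqrt 1037 < 3221/100"
    by (rule real_less_lsqrt; simp add: power2_eq_square)+
qed

lemma bend_factor:
  "bend u = - 144 * (u - vertex_param) * (u - saddle_param) * (u - (18 - 7 * sqrt 5 - sqrt 1037) / 36)"
proof -
  define s R where "s = sqrt 5" and "R = sqrt 1037"
  have s: "s * s - 5 = 0" and R: "R * R - 1037 = 0" by (simp_all add: s_def R_def)
  define A B C where "A = 10 * u - (5 - s)" and "B = 36 * u - (18 - 7 * s + R)"
    and "C = 36 * u - (18 - 7 * s - R)"
  have prod: "A * B * C = - 9 * (- (120 + 88 * s) + (704 * s - 480) * u + (2160 - 704 * s) * u\<^sup>2 - 1440 * u^3)"
    unfolding A_def B_def C_def using s R by algebra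
  have eqs: "u - (5 - s) / 10 = A / 10" "u - (18 - 7 * s + R) / 36 = B / 36" "u - (18 - 7 * s - R) / 36 = C / 36"
    by (simp_all add: A_def B_def C_def diff_divide_distrib add_divide_distrib)
  have "- 144 * (A / 10) * (B / 36) * (C / 36) = - (A * B * C) / 90" by simp
  then show ?thesis
    unfolding bend_def vertex_param_def saddle_param_def s_def[symmetric] R_def[symmetric] eqs prod by simp
qed

text \<open>The third root of the cubic is negative.\<close>
lemma bend_zero:
  assumes "bend u = 0" "0 \<le> u"
  shows "u = vertex_param \<or> u = saddle_param"
proof -
  have "18 - 7 * sqrt 5 - sqrt 1037 < 0" using sqrt_bounds by linarith
  then have "u - (18 - 7 * sqrt 5 - sqrt 1037) / 36 \<noteq> 0" using assms(2) by simp
  then show ?thesis using assms(1) unfolding bend_factor by auto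
qed

text \<open>The only root of the derivative that is not negative; it belongs to the centres of the faces on the mirror.\<close>
lemma slope_zero:
  assumes "slope u = 0" "0 \<le> u"
  shows "u = (3 + sqrt 5) / 6"
proof -
  define s where "s = sqrt 5"
  have s: "s * s - 5 = 0" by (simp add: s_def)
  have "10 * slope u = - (15 + 11 * s) + (22 * s - 30) * u + 30 * u\<^sup>2" by (simp add: slope_def s_def)
  also have "2 * \<dots> = (6 * u - (3 + s)) * (10 * u - (5 - 9 * s))" using s by algebra
  finally have "(6 * u - (3 + s)) * (10 * u - (5 - 9 * s)) = 0" using assms(1) by simp
  moreover have "10 * u - (5 - 9 * s) > 0" using assms(2) sqrt_bounds unfolding s_def by linarith
  ultimately show ?thesis by (simp add: s_def)
qed

text \<open>At the centre of a face \<open>phi 2\<close> vanishes but \<open>phi 0\<close> does not, so that it is not below a critical point.\<close>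
lemma face_values:
  "bend ((3 + sqrt 5) / 6) + 12 * profile ((3 + sqrt 5) / 6) = 0" "profile ((3 + sqrt 5) / 6) \<noteq> 0"
proof -
  define s u where "s = sqrt 5" and "u = (3 + s) / 6"
  have s: "s * s = 5" by (simp add: s_def)
  have u2: "u\<^sup>2 = (7 + 3 * s) / 18" using s by (simp add: u_def power2_eq_square field_simps)
  have u3: "u^3 = (9 + 4 * s) / 27"
  proof -
    have "u^3 = u\<^sup>2 * u" by (simp add: power3_eq_cube power2_eq_square)
    then show ?thesis unfolding u2 using s by (simp add: u_def field_simps)
  qed
  have p: "profile u = - 64 * s / 135"
    unfolding profile_def s_def[symmetric] u2 u3 using s by (simp add: u_def field_simps)
  have "bend u = 768 * s / 135"
    unfolding bend_def s_def[symmetric] u2 u3 using s by (simp add: u_def field_simps)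
  then show "bend ((3 + sqrt 5) / 6) + 12 * profile ((3 + sqrt 5) / 6) = 0"
    using p unfolding u_def s_def by simp
  show "profile ((3 + sqrt 5) / 6) \<noteq> 0" using p unfolding u_def s_def by simp
qed

text \<open>At a vertex the five-fold symmetry forces \<open>phi 0\<close> and \<open>phi 3\<close> to vanish; the second equation says the latter.\<close>
lemma vertex_values:
  "profile vertex_param = 0" "bend_slope vertex_param = - 34 * slope vertex_param" "slope vertex_param \<noteq> 0"
proof -
  define s u where "s = sqrt 5" and "u = (5 - s) / 10"
  have s: "s * s = 5" by (simp add: s_def)
  have u2: "u\<^sup>2 = (3 - s) / 10" using s by (simp add: u_def power2_eq_square field_simps)
  have u3: "u^3 = (5 - 2 * s) / 25"
  proof -
    have "u^3 = u\<^sup>2 * u" by (simp add: power3_eq_cube power2_eq_square)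
    then show ?thesis unfolding u2 using s by (simp add: u_def field_simps)
  qed
  have "profile u = 0"
    unfolding profile_def s_def[symmetric] u2 u3 using s by (simp add: u_def field_simps)
  then show "profile vertex_param = 0" by (simp add: u_def s_def vertex_param_def)
  have "bend_slope u = - 34 * slope u"
    unfolding bend_slope_def slope_def s_def[symmetric] u2 using s by (simp add: u_def field_simps)
  then show "bend_slope vertex_param = - 34 * slope vertex_param" by (simp add: u_def s_def vertex_param_def)
  have "slope vertex_param = 0 \<Longrightarrow> False"
    using slope_zero[of vertex_param] sqrt_bounds unfolding vertex_param_def by simp
  then show "slope vertex_param \<noteq> 0" by blast
qed

text \<open>Numerical bounds suffice, as the parameter lies between 0.959 and 0.96; the products of bounded quantities are bounded first, so that the
remaining estimates are linear.\<close>
lemma saddle_values: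
  "slope saddle_param > 0" "bend_slope saddle_param < - 68 * slope saddle_param" "profile saddle_param \<noteq> 0"
proof -
  define s u where "s = sqrt 5" and "u = saddle_param"
  define R where "R = sqrt 1037"
  have "2236/1000 < s" "s < 22361/10000" "322/10 < R" "R < 3221/100"
    unfolding s_def R_def by (rule sqrt_bounds)+
  moreover have "36 * u = 18 - 7 * s + R" by (simp add: u_def saddle_param_def s_def R_def)
  ultimately have "959/1000 < u \<and> u < 96/100" by linarith
  then have u: "959/1000 < u" "u < 96/100" by auto
  have s: "2236/1000 < s" "s < 22361/10000" using sqrt_bounds by (simp_all add: s_def)
  have uu: "919/1000 < u\<^sup>2" "u\<^sup>2 < 922/1000"
    using u mult_strict_mono[of "959/1000" u "959/1000" u] mult_strict_mono[of u "96/100" u "96/100"]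
    by (simp_all add: power2_eq_square)
  have su: "2236/1000 * (959/1000) < s * u" "s * u < 22361/10000 * (96/100)"
    using u s by (intro mult_strict_mono; simp)+
  have p: "10 * slope u = - 15 - 11 * s + 22 * (s * u) - 30 * u + 30 * u\<^sup>2"
    unfolding slope_def s_def[symmetric] by simp (simp add: algebra_simps)
  have h: "10 * bend_slope u = 704 * s - 480 + 4320 * u - 1408 * (s * u) - 4320 * u\<^sup>2"
    unfolding bend_slope_def s_def[symmetric] by simp (simp add: algebra_simps)
  show "slope saddle_param > 0" using p u s uu su unfolding u_def[symmetric] by linarith
  show "bend_slope saddle_param < - 68 * slope saddle_param"
    using p h u s uu su unfolding u_def[symmetric] by linarith
  have "u^3 < 922/1000"
    using mult_strict_mono[of u 1 "u\<^sup>2" "922/1000"] u uu by (simp add: power3_eq_cube power2_eq_square)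
  moreover have "10 * profile u = 10 - 15 * u - 11 * (s * u) + (11 * s - 15) * u\<^sup>2 + 10 * u^3"
    unfolding profile_def s_def[symmetric] by simp (simp add: algebra_simps)
  moreover have "(11 * s - 15) * u\<^sup>2 < 10 * (922/1000)"
    using s uu by (intro mult_strict_mono) auto
  ultimately show "profile saddle_param \<noteq> 0" using u s su unfolding u_def[symmetric] by linarith
qed

section \<open>Critical points on a mirror\<close>

lemma unit_cnj: "cmod l = 1 \<Longrightarrow> l * cnj l - 1 = 0"
  by (simp add: complex_norm_square[symmetric])

text \<open>The values \<open>u = 0\<close> and \<open>u = 1\<close> belong to the midpoints of the edges on the mirror, where \<open>phi 1 = 0\<close>.\<close>
lemma extremal_values:
  "\<bar>bend 0 + 12 * profile 0\<bar> \<noteq> 12 * \<bar>profile 0\<bar>" "\<bar>bend 1 + 12 * profile 1\<bar> \<noteq> 12 * \<bar>profile 1\<bar>"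
proof -
  have "bend 0 + 12 * profile 0 = - 88 * sqrt 5 / 10" "profile 0 = 1"
    "bend 1 + 12 * profile 1 = - 88 * sqrt 5 / 10" "profile 1 = - 1"
    by (simp_all add: bend_def profile_def field_simps)
  then show "\<bar>bend 0 + 12 * profile 0\<bar> \<noteq> 12 * \<bar>profile 0\<bar>" "\<bar>bend 1 + 12 * profile 1\<bar> \<noteq> 12 * \<bar>profile 1\<bar>"
    using sqrt_bounds by simp_all
qed

text \<open>The second condition for criticality reads \<open>l\<^sup>2\<^sup>0 (bend u + 12 profile u) = 12 profile u\<close>. Comparing absolute values
excludes the zeros of \<open>phi 1\<close>, namely midpoints of edges and centres of faces. So \<open>l\<^sup>1\<^sup>0\<close> is real, hence \<open>\<plusminus> 1\<close>, and
what remains is \<open>bend u = 0\<close>.\<close>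
lemma critical_real_pointD:
  fixes a b :: real
  assumes ab: "a\<^sup>2 + b\<^sup>2 = 1" and l: "cmod l = 1" and crit: "critical_at morse_lift (l *s real_point a b)"
  shows "l ^ 20 = 1" and "4 * a\<^sup>2 * b\<^sup>2 = vertex_param \<or> 4 * a\<^sup>2 * b\<^sup>2 = saddle_param"
proof -
  define u e where "u = 4 * a\<^sup>2 * b\<^sup>2" and "e = 8 * a * b * (a\<^sup>2 - b\<^sup>2)"
  define P H q C where "P = complex_of_real (profile u)" and "H = complex_of_real (bend u)"
    and "q = complex_of_real (e * slope u)" and "C = cnj l"
  have lC: "l * C - 1 = 0" using unit_cnj[OF l] by (simp add: C_def)
  note v = phi_real_point[OF ab, folded u_def e_def]
  have Im: "Im (phi 1 (l *s real_point a b)) = 0"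
    and eq: "phi 2 (l *s real_point a b) = 12 * cnj (phi 0 (l *s real_point a b))"
    using crit unfolding critical_morse_lift[OF real_point_in_S3[OF ab l]] by blast+
  have eq': "l ^ 10 * C ^ 2 * (H + 12 * P) = 12 * (C ^ 12 * P)"
    using eq unfolding phi_scale v by (simp add: H_def P_def C_def)
  have lC2: "l ^ 12 * C ^ 12 = 1" "l ^ 12 * (l ^ 10 * C ^ 2) = l ^ 20"
  proof -
    have "l * C = 1" using lC by simp
    then show "l ^ 12 * C ^ 12 = 1" by (simp flip: power_mult_distrib)
    have "l ^ 12 * (l ^ 10 * C ^ 2) = l ^ 20 * (l * C) ^ 2"
      by (simp add: power_mult_distrib flip: power_add)
    then show "l ^ 12 * (l ^ 10 * C ^ 2) = l ^ 20" using \<open>l * C = 1\<close> by simp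
  qed
  have "l ^ 12 * (l ^ 10 * C ^ 2) * (H + 12 * P) = l ^ 12 * (l ^ 10 * C ^ 2 * (H + 12 * P))"
    by (simp only: mult.assoc)
  also have "\<dots> = 12 * (l ^ 12 * C ^ 12) * P" unfolding eq' by (simp add: mult_ac)
  finally have "l ^ 12 * (l ^ 10 * C ^ 2) * (H + 12 * P) = 12 * (l ^ 12 * C ^ 12) * P" .
  then have key: "l ^ 20 * (H + 12 * P) = 12 * P" unfolding lC2 by simp
  then have "cmod (l ^ 20 * (H + 12 * P)) = cmod (12 * P)" by simp
  then have "cmod (H + 12 * P) = 12 * cmod P" using l by (simp add: norm_mult norm_power)
  moreover have "H + 12 * P = of_real (bend u + 12 * profile u)" by (simp add: H_def P_def)
  ultimately have norms: "\<bar>bend u + 12 * profile u\<bar> = 12 * \<bar>profile u\<bar>" by (simp only: norm_of_real P_def)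
  have u0: "0 \<le> u" by (simp add: u_def)
  have "e * slope u \<noteq> 0"
  proof
    assume "e * slope u = 0"
    then consider "a = 0 \<or> b = 0" | "a\<^sup>2 = b\<^sup>2" | "slope u = 0" by (auto simp: e_def)
    then show False
    proof cases
      case 1
      then have "u = 0" by (auto simp: u_def)
      then show ?thesis using norms extremal_values by simp
    next
      case 2
      then have "a\<^sup>2 = 1 / 2" "b\<^sup>2 = 1 / 2" using ab by simp_all
      then have "u = 4 * (1 / 2) * (1 / 2)" unfolding u_def by (simp only:)
      then have "u = 1" by simp
      then show ?thesis using norms extremal_values by simp
    next
      case 3
      then show ?thesis using norms face_values slope_zero[OF 3 u0] by simp
    qed
  qed
  then have q0: "e * slope u \<noteq> 0" .
  have "phi 1 (l *s real_point a b) = l ^ 10 * of_real (e * slope u)"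
  proof -
    have "l * C = 1" using lC by simp
    moreover have "l ^ 11 * C = l ^ 10 * (l * C)" by (simp add: eval_nat_numeral)
    ultimately have "l ^ 11 * C = l ^ 10" by (simp only:) simp
    then show ?thesis using phi_scale[of 1 l "real_point a b"] v(2) by (simp add: C_def)
  qed
  then have "Im (l ^ 10) = 0" using Im q0 by simp
  moreover have "cmod (l ^ 10) = 1" using l by (simp add: norm_power)
  ultimately have r: "l ^ 10 = of_real (Re (l ^ 10))" and "\<bar>Re (l ^ 10)\<bar> = 1"
    by (simp_all add: complex_eq_iff cmod_eq_Re)
  then have "(Re (l ^ 10))\<^sup>2 = 1" by (metis power2_abs power_one)
  then have "(l ^ 10)\<^sup>2 = 1" using r by (metis of_real_1 of_real_power)
  then show l20: "l ^ 20 = 1" by (simp flip: power_mult)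
  have "H = 0" using key unfolding l20 by simp
  then have "bend u = 0" by (simp add: H_def)
  then show "4 * a\<^sup>2 * b\<^sup>2 = vertex_param \<or> 4 * a\<^sup>2 * b\<^sup>2 = saddle_param"
    using bend_zero[OF _ u0] unfolding u_def by blast
qed

definition critical_params :: "real set" where
  "critical_params = {vertex_param, saddle_param}"

lemma critical_params_bounds: "u \<in> critical_params \<Longrightarrow> 0 < u \<and> u < 1"
  using sqrt_bounds unfolding critical_params_def vertex_param_def saddle_param_def by auto

lemma bend_critical_params: "u \<in> critical_params \<Longrightarrow> bend u = 0"
  unfolding critical_params_def bend_factor by auto

lemma slope_critical_params: "u \<in> critical_params \<Longrightarrow> slope u \<noteq> 0"
  unfolding critical_params_def using vertex_values saddle_values by auto

text \<open>For \<open>0 \<le> u \<le> 1\<close>, the real point of the sphere with \<open>4 a\<^sup>2 b\<^sup>2 = u\<close> and \<open>a \<ge> b \<ge> 0\<close>.\<close>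
definition mirror_base :: "real \<Rightarrow> complex ^ 2" where
  "mirror_base u = real_point (sqrt ((1 + sqrt (1 - u)) / 2)) (sqrt ((1 - sqrt (1 - u)) / 2))"

lemma mirror_base:
  assumes "0 < u" "u < 1"
  obtains a b where "mirror_base u = real_point a b" "a\<^sup>2 + b\<^sup>2 = 1" "4 * a\<^sup>2 * b\<^sup>2 = u" "0 < b" "b < a"
proof -
  define c where "c = sqrt (1 - u)"
  have c: "c\<^sup>2 = 1 - u" "0 < c" "c < 1" using assms by (simp_all add: c_def)
  define a b where "a = sqrt ((1 + c) / 2)" and "b = sqrt ((1 - c) / 2)"
  have a2: "a\<^sup>2 = (1 + c) / 2" and b2: "b\<^sup>2 = (1 - c) / 2" using c by (simp_all add: a_def b_def)
  have "4 * a\<^sup>2 * b\<^sup>2 = 1 - c\<^sup>2" unfolding a2 b2 by (simp add: power2_eq_square field_simps)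
  then have u: "4 * a\<^sup>2 * b\<^sup>2 = u" using c by simp
  have "a\<^sup>2 + b\<^sup>2 = 1" unfolding a2 b2 by (simp add: field_simps)
  moreover have "0 < b" "b < a" using c by (simp_all add: a_def b_def)
  ultimately show ?thesis using that[of a b] u unfolding mirror_base_def a_def b_def c_def by blast
qed

lemma mirror_base_in_S3:
  "u \<in> critical_params \<Longrightarrow> cmod l = 1 \<Longrightarrow> l *s mirror_base u \<in> S3"
  by (metis critical_params_bounds mirror_base real_point_in_S3)

text \<open>Converse to \<open>critical_real_pointD\<close>, together with the discriminant condition of \<open>nondegenerate_morse_lift\<close>. With \<open>q\<close> the
value of \<open>phi 1\<close> at the real point and \<open>D = e\<^sup>2 slope u bend_slope u\<close>, that condition reads \<open>D \<noteq> 0\<close> and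
\<open>68 q\<^sup>2 + D \<noteq> 576 (profile u)\<^sup>2\<close>. At a vertex \<open>D = - 34 q\<^sup>2\<close> and the right-hand side vanishes; at the other point the left-hand
side is negative.\<close>
lemma mirror_base_critical:
  assumes u: "u \<in> critical_params" and l20: "l ^ 20 = 1"
  obtains p where "p \<noteq> 0" "phi 0 (l *s mirror_base u) = l ^ 12 * of_real (profile u)"
    "phi 1 (l *s mirror_base u) = l ^ 10 * of_real p"
    "critical_at morse_lift (l *s mirror_base u)"
    "cmod (phi 1 (l *s mirror_base u) * phi 3 (l *s mirror_base u) - 288 * (cnj (phi 0 (l *s mirror_base u)))\<^sup>2)
      \<noteq> cmod (34 * (phi 1 (l *s mirror_base u))\<^sup>2 - 288 * (phi 0 (l *s mirror_base u) * cnj (phi 0 (l *s mirror_base u))))"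
proof -
  obtain a b where ab: "mirror_base u = real_point a b" "a\<^sup>2 + b\<^sup>2 = 1" "4 * a\<^sup>2 * b\<^sup>2 = u" "0 < b" "b < a"
    using critical_params_bounds[OF u] mirror_base by metis
  define e where "e = 8 * a * b * (a\<^sup>2 - b\<^sup>2)"
  define P q C where "P = complex_of_real (profile u)" and "q = e * slope u" and "C = cnj l"
  note v = phi_real_point[OF ab(2), unfolded ab(3), folded e_def]
  have l: "cmod l = 1"
  proof -
    have "cmod l ^ 20 = 1" using l20 by (metis norm_one norm_power)
    then show ?thesis using power_eq_imp_eq_base[of "cmod l" 20 1] by simp
  qed
  have lC: "l * C = 1" using unit_cnj[OF l] by (simp add: C_def)
  have S3: "l *s mirror_base u \<in> S3" by (rule mirror_base_in_S3[OF u l])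
  have "b\<^sup>2 < a\<^sup>2" using ab(4,5) by (simp add: power_strict_mono)
  then have e: "e \<noteq> 0" using ab(4,5) by (simp add: e_def)
  then have q: "q \<noteq> 0" using slope_critical_params[OF u] by (simp add: q_def)
  have C20: "C ^ 20 = 1" using l20 unfolding C_def by (metis complex_cnj_one complex_cnj_power)
  have p0: "phi 0 (l *s mirror_base u) = l ^ 12 * P"
    unfolding ab(1) phi_scale v P_def by simp
  have p1: "phi 1 (l *s mirror_base u) = l ^ 10 * of_real q"
  proof -
    have "l ^ 11 * C = l ^ 10 * (l * C)" by (simp add: eval_nat_numeral)
    then show ?thesis unfolding ab(1) phi_scale v q_def lC by (simp add: C_def)
  qed
  have p2: "phi 2 (l *s mirror_base u) = l ^ 10 * C\<^sup>2 * (12 * P)"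
    unfolding ab(1) phi_scale v P_def C_def bend_critical_params[OF u] by simp
  have p3: "phi 3 (l *s mirror_base u) = l ^ 9 * C ^ 3 * of_real (34 * q + e * bend_slope u)"
    unfolding ab(1) phi_scale v C_def q_def by simp
  have real10: "cnj (l ^ 10) = l ^ 10"
  proof -
    have "C ^ 10 = C ^ 10 * l ^ 20" using l20 by simp
    also have "\<dots> = (l * C) ^ 10 * l ^ 10" by (simp add: power_mult_distrib flip: power_add)
    finally show ?thesis unfolding lC by (simp add: C_def)
  qed
  then have "Im (l ^ 10) = 0" by (metis Reals_cnj_iff complex_is_Real_iff)
  moreover have "l ^ 10 * C\<^sup>2 = C ^ 12"
  proof -
    have "C ^ 12 = C ^ 10 * C\<^sup>2" by (simp flip: power_add)
    also have "C ^ 10 = l ^ 10" using real10 by (simp add: C_def)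
    finally show ?thesis by simp
  qed
  ultimately have crit: "critical_at morse_lift (l *s mirror_base u)"
    unfolding critical_morse_lift[OF S3] p0 p1 p2 by (simp add: C_def P_def)
  have "cmod (phi 1 (l *s mirror_base u) * phi 3 (l *s mirror_base u) - 288 * (cnj (phi 0 (l *s mirror_base u)))\<^sup>2)
      \<noteq> cmod (34 * (phi 1 (l *s mirror_base u))\<^sup>2 - 288 * (phi 0 (l *s mirror_base u) * cnj (phi 0 (l *s mirror_base u))))"
  proof -
    define D where "D = e\<^sup>2 * slope u * bend_slope u"
    have "phi 1 (l *s mirror_base u) * phi 3 (l *s mirror_base u) - 288 * (cnj (phi 0 (l *s mirror_base u)))\<^sup>2
        = C ^ 4 * of_real (34 * q\<^sup>2 + D - 288 * (profile u)\<^sup>2)"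
    proof -
      have "l ^ 10 * (l ^ 9 * C ^ 3) = C ^ 4"
      proof -
        have "l ^ 10 * (l ^ 9 * C ^ 3) = (l * C) * (l ^ 10 * (l ^ 9 * C ^ 3))" using lC by simp
        also have "\<dots> = l ^ 20 * C ^ 4" by (simp add: eval_nat_numeral mult_ac)
        finally show ?thesis using l20 by simp
      qed
      moreover have "(cnj (l ^ 12))\<^sup>2 = C ^ 4"
      proof -
        have "(cnj (l ^ 12))\<^sup>2 = C ^ 20 * C ^ 4" by (simp add: C_def flip: power_mult power_add)
        then show ?thesis using C20 by simp
      qed
      moreover have "q * (34 * q + e * bend_slope u) = 34 * q\<^sup>2 + D"
        by (simp add: q_def D_def power2_eq_square algebra_simps)
      moreover have "phi 1 (l *s mirror_base u) * phi 3 (l *s mirror_base u) - 288 * (cnj (phi 0 (l *s mirror_base u)))\<^sup>2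
          = (l ^ 10 * (l ^ 9 * C ^ 3)) * of_real (q * (34 * q + e * bend_slope u))
            - 288 * (cnj (l ^ 12))\<^sup>2 * of_real ((profile u)\<^sup>2)"
        unfolding p0 p1 p3 P_def complex_cnj_mult complex_cnj_complex_of_real power_mult_distrib
          of_real_mult of_real_power by (simp only: mult_ac)
      ultimately show ?thesis by (simp add: right_diff_distrib)
    qed
    then have c1: "cmod (phi 1 (l *s mirror_base u) * phi 3 (l *s mirror_base u) - 288 * (cnj (phi 0 (l *s mirror_base u)))\<^sup>2)
        = \<bar>34 * q\<^sup>2 + D - 288 * (profile u)\<^sup>2\<bar>"
      using l by (simp only: norm_mult norm_power norm_of_real C_def complex_mod_cnj) simp
    have "34 * (phi 1 (l *s mirror_base u))\<^sup>2 - 288 * (phi 0 (l *s mirror_base u) * cnj (phi 0 (l *s mirror_base u)))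
        = of_real (34 * q\<^sup>2 - 288 * (profile u)\<^sup>2)"
    proof -
      have "(l ^ 10)\<^sup>2 = 1" using l20 by (simp flip: power_mult)
      moreover have "l ^ 12 * cnj (l ^ 12) = 1"
      proof -
        have "l ^ 12 * cnj (l ^ 12) = (l * C) ^ 12" by (simp add: C_def power_mult_distrib)
        then show ?thesis by (simp add: lC)
      qed
      moreover have "phi 0 (l *s mirror_base u) * cnj (phi 0 (l *s mirror_base u)) = (l ^ 12 * cnj (l ^ 12)) * P\<^sup>2"
        unfolding p0 by (simp add: P_def power2_eq_square)
      ultimately show ?thesis unfolding p1 by (simp add: power_mult_distrib P_def)
    qed
    then have c2: "cmod (34 * (phi 1 (l *s mirror_base u))\<^sup>2 - 288 * (phi 0 (l *s mirror_base u) * cnj (phi 0 (l *s mirror_base u))))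
        = \<bar>34 * q\<^sup>2 - 288 * (profile u)\<^sup>2\<bar>"
      by (simp only: norm_of_real)
    have e2: "e\<^sup>2 > 0" using e by simp
    have q2: "q\<^sup>2 = e\<^sup>2 * (slope u)\<^sup>2" by (simp add: q_def power_mult_distrib)
    have "D \<noteq> 0 \<and> 68 * q\<^sup>2 + D - 576 * (profile u)\<^sup>2 \<noteq> 0"
    proof (cases "u = vertex_param")
      case True
      then have "D = - 34 * q\<^sup>2" "profile u = 0"
        using vertex_values by (simp_all add: D_def q_def power2_eq_square)
      then show ?thesis using q by simp
    next
      case False
      then have "u = saddle_param" using u by (simp add: critical_params_def)
      then have s: "slope u > 0" "bend_slope u < - 68 * slope u" using saddle_values by simp_all
      have "bend_slope u < 0" using s by simp
      then have "D < 0" unfolding D_def using e2 s(1) by (simp add: mult_pos_neg)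
      moreover have "68 * q\<^sup>2 + D = e\<^sup>2 * slope u * (68 * slope u + bend_slope u)"
        unfolding q2 D_def by (simp add: power2_eq_square algebra_simps)
      moreover have "e\<^sup>2 * slope u * (68 * slope u + bend_slope u) < 0"
        using e2 s by (intro mult_pos_neg) auto
      ultimately have "D < 0" "68 * q\<^sup>2 + D < 0" by simp_all
      moreover have "0 \<le> (profile u)\<^sup>2" by simp
      ultimately show ?thesis by linarith
    qed
    then show "cmod (phi 1 (l *s mirror_base u) * phi 3 (l *s mirror_base u) - 288 * (cnj (phi 0 (l *s mirror_base u)))\<^sup>2)
        \<noteq> cmod (34 * (phi 1 (l *s mirror_base u))\<^sup>2 - 288 * (phi 0 (l *s mirror_base u) * cnj (phi 0 (l *s mirror_base u))))"
      unfolding c1 c2 by linarith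
  qed
  then show ?thesis using that[of q] q p0 p1 crit unfolding P_def by blast
qed

section \<open>Orbits of the critical points\<close>

text \<open>The phases for which \<open>l\<^sup>1\<^sup>0\<close> is real.\<close>
definition root20 :: "nat \<Rightarrow> complex" where
  "root20 k = exp (2 * of_real pi * \<i> * of_nat k / of_nat 20)"

lemma root20_eq_iff: "root20 j = root20 k \<longleftrightarrow> j mod 20 = k mod 20"
  unfolding root20_def by (rule complex_root_unity_eq) simp

lemma root20_add: "root20 (j + k) = root20 j * root20 k"
  by (simp add: root20_def exp_add[symmetric] add_divide_distrib algebra_simps)

lemma root20_0: "root20 0 = 1"
  by (simp add: root20_def)

lemma root20_power: "root20 k ^ n = root20 (n * k)"
  by (induction n) (simp_all add: root20_0 root20_add)

lemma root20_root: "root20 k ^ 20 = 1"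
  unfolding root20_power root20_0[symmetric] root20_eq_iff by simp

lemma root20_10: "root20 10 = - 1"
proof -
  have "(root20 10)\<^sup>2 = 1" unfolding root20_power root20_0[symmetric] root20_eq_iff by simp
  moreover have "root20 10 \<noteq> 1" unfolding root20_0[symmetric] root20_eq_iff by simp
  ultimately show ?thesis by (simp add: power2_eq_1_iff)
qed

lemma norm_root20: "cmod (root20 k) = 1"
  using power_eq_imp_eq_base[of "cmod (root20 k)" 20 1] root20_root[of k] by (simp flip: norm_power)

lemma root20_exhaust:
  assumes "l ^ 20 = 1" obtains k where "k < 20" "l = root20 k"
proof -
  have "l \<in> {z. z ^ 20 = 1}" using assms by simp
  also have "\<dots> = {exp (2 * of_real pi * \<i> * of_nat j / of_nat 20) | j. j < 20}"
    by (rule complex_roots_unity) simp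
  finally show ?thesis using that unfolding root20_def by blast
qed

lemma matrix_vector_mult_smult: "(A :: complex ^ 2 ^ 2) *v (c *s z) = c *s (A *v z)"
  by (simp add: vec2_eq_iff matrix_vector_mult_def sum_2 algebra_simps)

definition icosian :: "real \<Rightarrow> real \<Rightarrow> real \<Rightarrow> real \<Rightarrow> complex ^ 2 ^ 2" where
  "icosian a b c d = quaternion_matrix (quat a b c d)"

lemma icosian_in:
  "icosian 0 1 0 0 \<in> binary_icosahedral" "icosian 0 0 1 0 \<in> binary_icosahedral"
  "icosian (- 1) 0 0 0 \<in> binary_icosahedral"
  "icosian (golden_ratio / 2) (1/2) 0 (1 / (2 * golden_ratio)) \<in> binary_icosahedral"
  using quat_unit_icosian by (auto simp: icosian_def binary_icosahedral_def)

lemma orbit_minus: "orbit (- z) = orbit z"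
proof -
  have I: "Complex (- 1) 0 = - 1" "Complex 0 0 = 0" by (simp_all add: complex_eq_iff)
  have "icosian (- 1) 0 0 0 *v z = - z"
    by (simp add: icosian_def vec2_eq_iff quaternion_matrix_nth I)
  then show ?thesis using orbit_mult[OF icosian_in(3), of z] by simp
qed

lemma icosian_real_point:
  "icosian 0 1 0 0 *v real_point a b = \<i> *s real_point a (- b)"
  "icosian 0 0 1 0 *v real_point a b = real_point b (- a)"
proof -
  have I: "Complex 0 1 = \<i>" "Complex 0 0 = 0" "Complex 1 0 = 1" by (simp_all add: complex_eq_iff)
  show "icosian 0 1 0 0 *v real_point a b = \<i> *s real_point a (- b)"
    "icosian 0 0 1 0 *v real_point a b = real_point b (- a)"
    by (simp_all add: icosian_def vec2_eq_iff quaternion_matrix_nth I real_point_def)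
qed

lemma mirror_base_eq:
  assumes "a\<^sup>2 + b\<^sup>2 = 1" "\<bar>b\<bar> \<le> a" "0 \<le> b"
  shows "real_point a b = mirror_base (4 * a\<^sup>2 * b\<^sup>2)"
proof -
  define c where "c = a\<^sup>2 - b\<^sup>2"
  have "b\<^sup>2 \<le> a\<^sup>2" using assms by (simp add: power_mono)
  have b2: "b\<^sup>2 = 1 - a\<^sup>2" using assms by simp
  have "1 - 4 * a\<^sup>2 * b\<^sup>2 = c\<^sup>2" unfolding c_def b2 by (simp add: power2_eq_square algebra_simps)
  then have c: "sqrt (1 - 4 * a\<^sup>2 * b\<^sup>2) = c" using \<open>b\<^sup>2 \<le> a\<^sup>2\<close> by (simp add: c_def)
  have e: "(1 + c) / 2 = a\<^sup>2" "(1 - c) / 2 = b\<^sup>2" using b2 by (simp_all add: c_def)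
  have "sqrt ((1 + c) / 2) = a" "sqrt ((1 - c) / 2) = b" unfolding e using assms by simp_all
  then show ?thesis unfolding mirror_base_def c by simp
qed

text \<open>The quaternion \<open>i\<close> changes the relative sign of the two real coordinates, up to a phase, and \<open>j\<close> exchanges them, up to sign; a
common sign is part of the phase. So one may assume \<open>a \<ge> b \<ge> 0\<close>.\<close>
lemma mirror_normal_form:
  fixes a b :: real
  assumes ab: "a\<^sup>2 + b\<^sup>2 = 1" and l: "cmod l = 1"
  obtains l' where "cmod l' = 1" "orbit (l *s real_point a b) = orbit (l' *s mirror_base (4 * a\<^sup>2 * b\<^sup>2))"
    "\<exists>A\<in>binary_icosahedral. A *v (l *s real_point a b) = l' *s mirror_base (4 * a\<^sup>2 * b\<^sup>2)"
proof -
  define R where "R = (\<lambda>l a b. \<exists>l'. cmod l' = 1 \<and> (\<exists>A\<in>binary_icosahedral. A *v (l *s real_point a b) = l' *s mirror_base (4 * a\<^sup>2 * b\<^sup>2)))"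
  have R_step: "R l a b" if step: "B \<in> binary_icosahedral" "B *v (l *s real_point a b) = l1 *s real_point a1 b1"
    "R l1 a1 b1" "4 * a\<^sup>2 * b\<^sup>2 = 4 * a1\<^sup>2 * b1\<^sup>2" for B l a b l1 a1 b1
  proof -
    obtain l' A where A: "cmod l' = 1" "A \<in> binary_icosahedral"
      "A *v (l1 *s real_point a1 b1) = l' *s mirror_base (4 * a1\<^sup>2 * b1\<^sup>2)"
      using step(3) unfolding R_def by blast
    have "(A ** B) *v (l *s real_point a b) = l' *s mirror_base (4 * a\<^sup>2 * b\<^sup>2)"
      unfolding matrix_vector_mul_assoc[symmetric] step(2,4) by (rule A(3))
    then show ?thesis unfolding R_def using A(1) binary_icosahedral_mult[OF A(2) step(1)] by blast
  qed
  have R1: "R l a b" if "a\<^sup>2 + b\<^sup>2 = 1" "cmod l = 1" "\<bar>b\<bar> \<le> a" "0 \<le> b" for l a b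
    unfolding R_def using that one_binary_icosahedral mirror_base_eq[of a b] by (metis matrix_vector_mul_lid)
  have R2: "R l a b" if "a\<^sup>2 + b\<^sup>2 = 1" "cmod l = 1" "\<bar>b\<bar> \<le> a" for l a b
  proof (cases "0 \<le> b")
    case True
    then show ?thesis using R1 that by blast
  next
    case False
    have "icosian 0 1 0 0 *v (l *s real_point a b) = (l * \<i>) *s real_point a (- b)"
      by (simp add: matrix_vector_mult_smult icosian_real_point vector_smult_assoc)
    moreover have "R (l * \<i>) a (- b)" using that False by (intro R1) (auto simp: norm_mult)
    ultimately show ?thesis by (rule R_step[OF icosian_in(1)]) simp
  qed
  have R3: "R l a b" if "a\<^sup>2 + b\<^sup>2 = 1" "cmod l = 1" "\<bar>b\<bar> \<le> \<bar>a\<bar>" for l a b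
  proof (cases "0 \<le> a")
    case True
    then show ?thesis using R2 that by simp
  next
    case False
    have "mat 1 *v (l *s real_point a b) = (- l) *s real_point (- a) (- b)"
      by (simp add: vec2_eq_iff real_point_def)
    moreover have "R (- l) (- a) (- b)" using that False by (intro R2) auto
    ultimately show ?thesis by (rule R_step[OF one_binary_icosahedral]) simp
  qed
  have "R l a b"
  proof (cases "\<bar>b\<bar> \<le> \<bar>a\<bar>")
    case True
    then show ?thesis using R3 ab l by blast
  next
    case False
    have "icosian 0 0 1 0 *v (l *s real_point a b) = l *s real_point b (- a)"
      by (simp add: matrix_vector_mult_smult icosian_real_point)
    moreover have "R l b (- a)" using ab l False by (intro R3) (auto simp: add.commute)
    ultimately show ?thesis by (rule R_step[OF icosian_in(2)]) simp
  qed
  then show ?thesis unfolding R_def using that orbit_mult by metis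
qed

text \<open>The group element of order 10 whose axis passes through the chosen vertex. It acts on the fibre by a phase, and the real part of
this phase is \<open>\<phi> / 2\<close>, which lies strictly between 0 and 1.\<close>
lemma vertex_rotation:
  obtains l where "icosian (golden_ratio / 2) (1/2) 0 (1 / (2 * golden_ratio)) *v mirror_base vertex_param = l *s mirror_base vertex_param"
    "l \<noteq> 1" "l \<noteq> - 1"
proof -
  define g s where "g = golden_ratio" and "s = sqrt 5"
  have s: "s * s = 5" by (simp add: s_def)
  have sb: "2 < s" "s < 3" using sqrt_bounds by (simp_all add: s_def)
  have g: "2 * g = 1 + s" by (simp add: g_def s_def golden_ratio_def)
  have "0 < g" using g sb by linarith
  have u: "0 < vertex_param" "vertex_param < 1" using sb by (simp_all add: vertex_param_def s_def)
  obtain a b where ab: "mirror_base vertex_param = real_point a b" "a\<^sup>2 + b\<^sup>2 = 1" "4 * a\<^sup>2 * b\<^sup>2 = vertex_param" "0 < b" "b < a"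
    using mirror_base[OF u] by metis
  have "(2 * a * b * g)\<^sup>2 = (a\<^sup>2 - b\<^sup>2)\<^sup>2"
  proof -
    have "4 * ((2 * a * b * g)\<^sup>2) = vertex_param * (2 * g)\<^sup>2"
      unfolding ab(3)[symmetric] by (simp add: power_mult_distrib)
    also have "\<dots> = 4 * (1 - vertex_param)"
      unfolding g vertex_param_def s_def[symmetric] using s by (simp add: power2_eq_square field_simps)
    finally have "(2 * a * b * g)\<^sup>2 = 1 - vertex_param" by simp
    moreover have "(a\<^sup>2 - b\<^sup>2)\<^sup>2 = (a\<^sup>2 + b\<^sup>2)\<^sup>2 - 4 * a\<^sup>2 * b\<^sup>2" by (simp add: power2_eq_square algebra_simps)
    ultimately show ?thesis unfolding ab(2,3) by simp
  qed
  moreover have "0 \<le> 2 * a * b * g" "0 \<le> a\<^sup>2 - b\<^sup>2" using ab(4,5) \<open>0 < g\<close> by (simp_all add: power_mono)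
  ultimately have key: "2 * a * b * g = a\<^sup>2 - b\<^sup>2" by (simp add: power2_eq_iff_nonneg)
  define z where "z = icosian (g / 2) (1/2) 0 (1 / (2 * g)) *v mirror_base vertex_param"
  have z1: "z $ 1 = Complex (g / 2) (1/2) * of_real a + Complex 0 (1 / (2 * g)) * of_real b"
    and z2: "z $ 2 = Complex 0 (1 / (2 * g)) * of_real a + Complex (g / 2) (- (1/2)) * of_real b"
    unfolding z_def icosian_def ab(1) quaternion_matrix_nth real_point_def
    by (simp_all add: complex_eq_iff)
  define l where "l = z $ 1 / of_real a"
  have a0: "a \<noteq> 0" using ab(4,5) by simp
  have l1: "z $ 1 = l * of_real a" using a0 by (simp add: l_def)
  have "a * z $ 2 = b * z $ 1"
    using key \<open>0 < g\<close> unfolding z1 z2 by (simp add: complex_eq_iff power2_eq_square field_simps)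
  then have "of_real a * (z $ 2) = of_real a * (l * of_real b)" unfolding l1 by (simp add: mult_ac)
  then have l2: "z $ 2 = l * of_real b" using a0 by simp
  have "z = l *s mirror_base vertex_param"
    unfolding ab(1) by (simp add: vec2_eq_iff real_point_def l1 l2)
  moreover have "Re l = g / 2" using a0 unfolding l_def z1 by (simp add: Re_divide_of_real)
  then have "0 < Re l" "Re l < 1" using \<open>0 < g\<close> g sb by linarith+
  then have "l \<noteq> 1" "l \<noteq> - 1" by auto
  ultimately show ?thesis using that unfolding z_def g_def by blast
qed

section \<open>The twelve critical points\<close>

definition saddle_point :: "nat \<Rightarrow> complex ^ 2" where
  "saddle_point k = root20 k *s mirror_base saddle_param"

definition vertex_point :: "nat \<Rightarrow> complex ^ 2" where
  "vertex_point k = root20 k *s mirror_base vertex_param"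

lemma orbit_period_10: "orbit (root20 (k + 10) *s z) = orbit (root20 k *s z)"
proof -
  have "root20 (k + 10) *s z = - (root20 k *s z)" by (simp add: root20_add root20_10 vec2_eq_iff)
  then show ?thesis by (simp add: orbit_minus)
qed

lemma orbit_period_10n: "orbit (root20 (k + 10 * n) *s z) = orbit (root20 k *s z)"
proof (induction n)
  case (Suc n)
  have "k + 10 * Suc n = (k + 10 * n) + 10" by simp
  then show ?case using Suc orbit_period_10 by metis
qed simp

lemma orbit_saddle_point: "orbit (saddle_point k) = orbit (saddle_point (k mod 10))"
proof -
  have "k = k mod 10 + 10 * (k div 10)" by simp
  then show ?thesis unfolding saddle_point_def using orbit_period_10n by metis
qed

text \<open>The phase \<open>l\<close> of the rotation that fixes the vertex satisfies \<open>l\<^sup>1\<^sup>0 = 1\<close>, because \<open>phi 1\<close> is invariant and has weight 10.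
As \<open>l \<noteq> \<plusminus> 1\<close>, the powers of \<open>l\<close> and \<open>- 1\<close> together are all tenth roots of unity.\<close>
lemma orbit_vertex_point_2: "orbit (vertex_point (k + 2)) = orbit (vertex_point k)"
proof -
  define A where "A = icosian (golden_ratio / 2) (1/2) 0 (1 / (2 * golden_ratio))"
  have A: "A \<in> binary_icosahedral" unfolding A_def by (rule icosian_in(4))
  obtain l where l: "A *v mirror_base vertex_param = l *s mirror_base vertex_param" "l \<noteq> 1" "l \<noteq> - 1"
    unfolding A_def using vertex_rotation by blast
  have v: "vertex_param \<in> critical_params" by (simp add: critical_params_def)
  obtain p where p: "p \<noteq> 0" "phi 1 (1 *s mirror_base vertex_param) = 1 ^ 10 * complex_of_real p"
    using mirror_base_critical[OF v, of 1] by (metis power_one)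
  have "norm (mirror_base vertex_param) = 1"
    using mirror_base_in_S3[OF v, of 1] by simp
  moreover have "norm (l *s mirror_base vertex_param) = cmod l * norm (mirror_base vertex_param)"
  proof -
    have "norm (l *s mirror_base vertex_param) ^ 2 = (cmod l * norm (mirror_base vertex_param)) ^ 2"
      unfolding power_mult_distrib norm_complex2 by (simp add: norm_mult power_mult_distrib algebra_simps)
    then show ?thesis by (simp add: power2_eq_iff_nonneg)
  qed
  ultimately have "cmod l = 1" using norm_binary_icosahedral[OF A, of "mirror_base vertex_param"] l(1) by simp
  then have "l * cnj l = 1" using unit_cnj[of l] by simp
  have "phi 1 (mirror_base vertex_param) = l ^ 11 * cnj l * phi 1 (mirror_base vertex_param)"
    using phi_binary_icosahedral[OF A, of 1 "mirror_base vertex_param"] phi_scale[of 1 l "mirror_base vertex_param"]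
    unfolding l(1) by simp
  then have "l ^ 11 * cnj l = 1" using p by simp
  moreover have "l ^ 11 * cnj l = l ^ 10 * (l * cnj l)" by (simp add: eval_nat_numeral)
  ultimately have l10: "l ^ 10 = 1" using \<open>l * cnj l = 1\<close> by simp
  then have "l ^ 20 = 1" using power_mult[of l 10 2] by simp
  then obtain m where m: "m < 20" "l = root20 m" by (rule root20_exhaust)
  have "root20 (10 * m) = root20 0" using l10 unfolding m(2) root20_power root20_0 .
  then have "(10 * m) mod 20 = 0" unfolding root20_eq_iff by simp
  then have "even m" by presburger
  moreover have "m \<noteq> 0" using l(2) m(2) root20_0 by metis
  moreover have "m \<noteq> 10" using l(3) m(2) root20_10 by metis
  ultimately have "m \<in> {2,4,6,8,12,14,16,18}" using m(1) by (auto elim!: evenE)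
  then have "\<exists>i e. (m * i + 10 * e) mod 20 = 2"
  proof -
    have "\<exists>i\<in>{1,2,3,4}. \<exists>e\<in>{0,1}. (m * i + 10 * e) mod 20 = 2"
      using \<open>m \<in> {2,4,6,8,12,14,16,18}\<close> by auto
    then show ?thesis by blast
  qed
  then obtain i e where ie: "(m * i + 10 * e) mod 20 = 2" by blast
  \<comment> \<open>the orbits are periodic in the phase with periods \<open>m\<close> and 10, hence with period 2\<close>
  have step: "orbit (vertex_point (j + m)) = orbit (vertex_point j)" for j
  proof -
    have "A *v vertex_point j = vertex_point (j + m)"
      unfolding vertex_point_def matrix_vector_mult_smult l(1) m(2)
      by (simp add: root20_add vector_smult_assoc)
    then show ?thesis using orbit_mult[OF A] by metis
  qed
  have steps: "orbit (vertex_point (j + m * i)) = orbit (vertex_point j)" for j i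
  proof (induction i)
    case (Suc i)
    have "j + m * Suc i = (j + m * i) + m" by simp
    then show ?case using Suc step by metis
  qed simp
  have "root20 (k + 2) = root20 (k + m * i + 10 * e)"
    unfolding root20_eq_iff using ie by (metis add.assoc mod_add_right_eq)
  then have "orbit (vertex_point (k + 2)) = orbit (root20 (k + m * i + 10 * e) *s mirror_base vertex_param)"
    by (simp add: vertex_point_def)
  also have "\<dots> = orbit (vertex_point (k + m * i))"
    unfolding orbit_period_10n vertex_point_def ..
  finally show ?thesis unfolding steps .
qed

lemma orbit_vertex_point: "orbit (vertex_point k) = orbit (vertex_point (k mod 2))"
proof -
  have "orbit (vertex_point (j + 2 * n)) = orbit (vertex_point j)" for j n
  proof (induction n)
    case (Suc n)
    have "j + 2 * Suc n = (j + 2 * n) + 2" by simp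
    then show ?case using Suc orbit_vertex_point_2 by metis
  qed simp
  moreover have "k = k mod 2 + 2 * (k div 2)" by simp
  ultimately show ?thesis by metis
qed

definition critical_rep :: "nat \<Rightarrow> complex ^ 2" where
  "critical_rep k = (if k < 10 then saddle_point k else vertex_point (k - 10))"

lemma critical_morse_lift_binary_icosahedral:
  assumes A: "A \<in> binary_icosahedral" and z: "z \<in> S3"
  shows "critical_at morse_lift (A *v z) \<longleftrightarrow> critical_at morse_lift z"
proof -
  have "A *v z \<in> S3" using z norm_binary_icosahedral[OF A] by simp
  then show ?thesis
    unfolding critical_morse_lift[OF z] by (subst critical_morse_lift) (simp_all only: phi_binary_icosahedral[OF A])
qed

text \<open>Move the point to the fixed mirror, bring it to the normal form there, and reduce the phase.\<close>
lemma critical_orbit: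
  assumes z: "z \<in> S3" and crit: "critical_at morse_lift z"
  shows "\<exists>k<12. orbit z = orbit (critical_rep k)"
proof -
  obtain A where A: "A \<in> binary_icosahedral" "hopf_y (A *v z) = 0"
    using critical_equivalent_to_mirror[OF z crit] by blast
  have S3: "A *v z \<in> S3" using z norm_binary_icosahedral[OF A(1)] by simp
  obtain l a b where lab: "cmod l = 1" "a\<^sup>2 + b\<^sup>2 = 1" "A *v z = l *s real_point a b"
    using mirror_point[OF S3 A(2)] by blast
  have c1: "critical_at morse_lift (l *s real_point a b)"
    using crit critical_morse_lift_binary_icosahedral[OF A(1) z] lab(3) by simp
  define u where "u = 4 * a\<^sup>2 * b\<^sup>2"
  have u: "u \<in> critical_params"
    using critical_real_pointD(2)[OF lab(2,1) c1] by (auto simp: u_def critical_params_def)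
  obtain l' B where l': "cmod l' = 1" "B \<in> binary_icosahedral"
    "B *v (l *s real_point a b) = l' *s mirror_base u" "orbit (l *s real_point a b) = orbit (l' *s mirror_base u)"
    using mirror_normal_form[OF lab(2,1)] unfolding u_def by metis
  have c2: "critical_at morse_lift (l' *s mirror_base u)"
    using c1 critical_morse_lift_binary_icosahedral[OF l'(2), of "l *s real_point a b"] S3 lab(3) l'(3) by simp
  obtain a' b' where ab': "mirror_base u = real_point a' b'" "a'\<^sup>2 + b'\<^sup>2 = 1"
    using mirror_base critical_params_bounds[OF u] by metis
  have "l' ^ 20 = 1" using critical_real_pointD(1)[OF ab'(2) l'(1)] c2 ab'(1) by simp
  then obtain k where k: "k < 20" "l' = root20 k" by (rule root20_exhaust)
  have o: "orbit z = orbit (root20 k *s mirror_base u)"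
    using orbit_mult[OF A(1), of z] l'(4) lab(3) k(2) by simp
  from u consider "u = saddle_param" | "u = vertex_param" unfolding critical_params_def by blast
  then show ?thesis
  proof cases
    case 1
    then have "orbit z = orbit (saddle_point (k mod 10))" using o orbit_saddle_point by (simp add: saddle_point_def)
    then show ?thesis by (intro exI[of _ "k mod 10"]) (simp add: critical_rep_def less_imp_le)
  next
    case 2
    then have "orbit z = orbit (vertex_point (k mod 2))" using o orbit_vertex_point by (simp add: vertex_point_def)
    then show ?thesis by (intro exI[of _ "10 + k mod 2"]) (simp add: critical_rep_def)
  qed
qed

lemma critical_rep_form:
  obtains l u where "critical_rep k = l *s mirror_base u" "l ^ 20 = 1" "cmod l = 1" "u \<in> critical_params"
  using that root20_root norm_root20
  unfolding critical_rep_def saddle_point_def vertex_point_def critical_params_def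
  by (metis insertCI)

lemma critical_rep_critical:
  "critical_rep k \<in> S3" "critical_at morse_lift (critical_rep k)" "phi 1 (critical_rep k) \<noteq> 0"
  "cmod (phi 1 (critical_rep k) * phi 3 (critical_rep k) - 288 * (cnj (phi 0 (critical_rep k)))\<^sup>2)
    \<noteq> cmod (34 * (phi 1 (critical_rep k))\<^sup>2 - 288 * (phi 0 (critical_rep k) * cnj (phi 0 (critical_rep k))))"
proof -
  obtain l u where *: "critical_rep k = l *s mirror_base u" "l ^ 20 = 1" "cmod l = 1" "u \<in> critical_params"
    by (rule critical_rep_form)
  show "critical_rep k \<in> S3" unfolding *(1) by (rule mirror_base_in_S3[OF *(4,3)])
  obtain p where p: "p \<noteq> 0" "phi 1 (l *s mirror_base u) = l ^ 10 * of_real p"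
    "critical_at morse_lift (l *s mirror_base u)"
    "cmod (phi 1 (l *s mirror_base u) * phi 3 (l *s mirror_base u) - 288 * (cnj (phi 0 (l *s mirror_base u)))\<^sup>2)
      \<noteq> cmod (34 * (phi 1 (l *s mirror_base u))\<^sup>2 - 288 * (phi 0 (l *s mirror_base u) * cnj (phi 0 (l *s mirror_base u))))"
    by (rule mirror_base_critical[OF *(4,2)])
  show "critical_at morse_lift (critical_rep k)" unfolding *(1) by (rule p(3))
  show "phi 1 (critical_rep k) \<noteq> 0" unfolding *(1) p(2) using p(1) *(3) by auto
  show "cmod (phi 1 (critical_rep k) * phi 3 (critical_rep k) - 288 * (cnj (phi 0 (critical_rep k)))\<^sup>2)
    \<noteq> cmod (34 * (phi 1 (critical_rep k))\<^sup>2 - 288 * (phi 0 (critical_rep k) * cnj (phi 0 (critical_rep k))))"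
    unfolding *(1) by (rule p(4))
qed

lemma phi_orbit_cong:
  assumes "orbit x = orbit y" shows "phi m x = phi m y"
proof -
  have "x \<in> orbit y" using assms orbit_refl by blast
  then show ?thesis using phi_binary_icosahedral unfolding orbit_def by auto
qed

text \<open>On the fibres, \<open>phi 0\<close> has weight 12 and \<open>phi 1\<close> has weight 10. Over the saddle both are nonzero and together they determine the phase modulo
sign; over the vertex \<open>phi 0\<close> vanishes and the sign of \<open>phi 1\<close> tells the two orbits apart.\<close>
lemma inj_orbit_critical_rep: "inj_on (\<lambda>k. orbit (critical_rep k)) {..<12}"
proof -
  have s: "saddle_param \<in> critical_params" and v: "vertex_param \<in> critical_params"
    by (simp_all add: critical_params_def)
  obtain ps where ps': "ps \<noteq> 0" "phi 1 (1 *s mirror_base saddle_param) = 1 ^ 10 * of_real ps"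
    "phi 0 (1 *s mirror_base saddle_param) = 1 ^ 12 * of_real (profile saddle_param)"
    by (rule mirror_base_critical[OF s, of 1]) auto
  then have ps: "ps \<noteq> 0" "phi 1 (mirror_base saddle_param) = of_real ps"
    and ps0: "phi 0 (mirror_base saddle_param) = of_real (profile saddle_param)"
    by simp_all
  obtain pv where pv': "pv \<noteq> 0" "phi 1 (1 *s mirror_base vertex_param) = 1 ^ 10 * of_real pv"
    "phi 0 (1 *s mirror_base vertex_param) = 1 ^ 12 * of_real (profile vertex_param)"
    by (rule mirror_base_critical[OF v, of 1]) auto
  then have pv: "pv \<noteq> 0" "phi 1 (mirror_base vertex_param) = of_real pv"
    and pv0: "phi 0 (mirror_base vertex_param) = of_real (profile vertex_param)"
    by simp_all
  have ph1: "phi 1 (root20 k *s z) = root20 (10 * k) * phi 1 z" for k z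
  proof -
    have "root20 k ^ 11 * cnj (root20 k) = root20 k ^ 10 * (root20 k * cnj (root20 k))"
      by (simp add: eval_nat_numeral)
    also have "root20 k * cnj (root20 k) = 1" using unit_cnj[OF norm_root20[of k]] by simp
    finally show ?thesis using phi_scale[of 1 "root20 k" z] by (simp add: root20_power)
  qed
  have ph0: "phi 0 (root20 k *s z) = root20 (12 * k) * phi 0 z" for k z
    using phi_scale[of 0 "root20 k" z] by (simp add: root20_power)
  have r0: "root20 k \<noteq> 0" for k using norm_root20[of k] by auto
  have ss: "j = k" if jk: "j < 10" "k < 10" and eq: "orbit (saddle_point j) = orbit (saddle_point k)" for j k
  proof -
    have "root20 (12 * j) = root20 (12 * k)" "root20 (10 * j) = root20 (10 * k)"
      using phi_orbit_cong[OF eq, of 0] phi_orbit_cong[OF eq, of 1] ps ps0 saddle_values(3)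
      unfolding saddle_point_def ph0 ph1 by simp_all
    then have "(12 * j) mod 20 = (12 * k) mod 20" "(10 * j) mod 20 = (10 * k) mod 20"
      unfolding root20_eq_iff by simp_all
    then have "(12 * j + 10 * j) mod 20 = (12 * k + 10 * k) mod 20" by (rule mod_add_cong)
    moreover have "(12 * n + 10 * n) mod 20 = 2 * n" if "n < 10" for n :: nat
    proof -
      have "12 * n + 10 * n = 2 * n + 20 * n" by simp
      then show ?thesis using that by (simp only: mod_mult_self2) simp
    qed
    ultimately show "j = k" using jk by simp
  qed
  have sv: "orbit (saddle_point j) \<noteq> orbit (vertex_point k)" for j k
  proof
    assume eq: "orbit (saddle_point j) = orbit (vertex_point k)"
    then show False
      using phi_orbit_cong[OF eq, of 0] ps0 pv0 vertex_values(1) saddle_values(3) r0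
      unfolding saddle_point_def vertex_point_def ph0 by simp
  qed
  have vv: "j = k" if jk: "j < 2" "k < 2" and eq: "orbit (vertex_point j) = orbit (vertex_point k)" for j k
  proof -
    have "root20 (10 * j) = root20 (10 * k)"
      using phi_orbit_cong[OF eq, of 1] pv unfolding vertex_point_def ph1 by simp
    then have "(10 * j) mod 20 = (10 * k) mod 20" unfolding root20_eq_iff .
    then show "j = k" using jk by simp
  qed
  show ?thesis
  proof (rule inj_onI)
    fix j k assume jk: "j \<in> {..<12::nat}" "k \<in> {..<12}" "orbit (critical_rep j) = orbit (critical_rep k)"
    show "j = k"
    proof (cases "j < 10")
      case True
      then have "k < 10" using jk(3) sv by (metis critical_rep_def)
      then show ?thesis using True jk ss by (simp add: critical_rep_def)
    next
      case False
      then have "\<not> k < 10" using jk(3) sv by (metis critical_rep_def)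
      then have "j - 10 = k - 10" using False jk by (intro vv) (auto simp: critical_rep_def)
      then show ?thesis using False \<open>\<not> k < 10\<close> by simp
    qed
  qed
qed

lemma nondegenerate_morse_lift_critical:
  assumes z: "z \<in> S3" and crit: "critical_at morse_lift z"
  shows "nondegenerate_at morse_lift z"
proof -
  obtain k where "orbit z = orbit (critical_rep k)" using critical_orbit[OF z crit] by blast
  note eq = phi_orbit_cong[OF this]
  show ?thesis
    by (rule nondegenerate_morse_lift[OF z crit]; unfold eq; rule critical_rep_critical)
qed

definition morse_fun :: "(complex ^ 2) set \<Rightarrow> real" where
  "morse_fun p = morse_lift (SOME x. x \<in> p)"

lemma morse_fun_orbit: "morse_fun \<circ> orbit = morse_lift"
proof
  fix z
  have "(SOME x. x \<in> orbit z) \<in> orbit z" using orbit_refl by (rule someI)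
  then obtain A where "A \<in> binary_icosahedral" "(SOME x. x \<in> orbit z) = A *v z"
    unfolding orbit_def by blast
  then show "(morse_fun \<circ> orbit) z = morse_lift z"
    by (simp add: morse_fun_def morse_lift_def phi_binary_icosahedral)
qed

lemma poincare_spaceE:
  assumes "p \<in> poincare_space" "x \<in> p"
  shows "x \<in> S3" "p = orbit x"
proof -
  obtain y where y: "y \<in> S3" "p = orbit y" using assms(1) unfolding poincare_space_def by blast
  then obtain A where A: "A \<in> binary_icosahedral" "x = A *v y" using assms(2) unfolding orbit_def by blast
  show "x \<in> S3" using A y norm_binary_icosahedral by simp
  show "p = orbit x" using A y orbit_mult by simp
qed

lemma critical_points_morse_fun: "critical_points morse_fun = (\<lambda>k. orbit (critical_rep k)) ` {..<12}"
proof (intro equalityI subsetI)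
  fix p assume p: "p \<in> critical_points morse_fun"
  then obtain y where y: "y \<in> S3" "p = orbit y" unfolding critical_points_def poincare_space_def by blast
  then have "critical_at morse_lift y"
    using p orbit_refl[of y] unfolding critical_points_def morse_fun_orbit by blast
  then show "p \<in> (\<lambda>k. orbit (critical_rep k)) ` {..<12}"
    using critical_orbit[OF y(1)] y(2) by blast
next
  fix p assume "p \<in> (\<lambda>k. orbit (critical_rep k)) ` {..<12}"
  then obtain k where p: "p = orbit (critical_rep k)" by blast
  have "critical_at morse_lift x" if "x \<in> p" for x
    using that critical_morse_lift_binary_icosahedral critical_rep_critical(1,2) unfolding p orbit_def by blast
  then show "p \<in> critical_points morse_fun"
    using critical_rep_critical(1) unfolding critical_points_def morse_fun_orbit poincare_space_def p by blast
qed

theorem proposition8p1: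
  shows "(\<exists>F\<in>eigenspace 168. is_morse F \<and> finite (critical_points F) \<and> card (critical_points F) \<ge> 8)
       \<and> (\<exists>F\<in>eigenspace 168. is_morse F \<and> finite (critical_points F) \<and> card (critical_points F) = 12)"
proof -
  have "morse_fun \<in> eigenspace 168"
  proof -
    have "laplace_beltrami morse_lift x = 168 * morse_fun p" if "p \<in> poincare_space" "x \<in> p" for p x
    proof -
      have "morse_fun p = morse_lift x" using poincare_spaceE(2)[OF that] morse_fun_orbit by (metis comp_apply)
      then show ?thesis using laplace_beltrami_morse_lift[OF poincare_spaceE(1)[OF that]] by simp
    qed
    then show ?thesis unfolding eigenspace_def mem_Collect_eq morse_fun_orbit using smooth_morse_lift by blast
  qed
  moreover have "is_morse morse_fun"
    unfolding is_morse_def morse_fun_orbit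
  proof (intro conjI ballI)
    show "smooth_S3 morse_lift" by (rule smooth_morse_lift)
    fix p x assume p: "p \<in> critical_points morse_fun" and x: "x \<in> p"
    then have "p \<in> poincare_space" "critical_at morse_lift x" unfolding critical_points_def morse_fun_orbit by auto
    then show "nondegenerate_at morse_lift x" using nondegenerate_morse_lift_critical poincare_spaceE(1) x by blast
  qed
  moreover have "finite (critical_points morse_fun)" "card (critical_points morse_fun) = 12"
    unfolding critical_points_morse_fun using card_image[OF inj_orbit_critical_rep] by auto
  ultimately show ?thesis by (intro conjI bexI[of _ morse_fun]) auto
qed

end
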